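(* Let $G=G(\Gamma)$ be the fundamental group of a graph of groups over a finite connected graph $\Gamma$ with all vertex groups isomorphic to $\mathbb{Z}^2$ and all edge groups isomorphic to $\mathbb{Z}$, such that $G$ is free by $\mathbb{Z}$. Then there exists a finite index subgroup $H$ of $G$ which can be written as (the fundamental group of) a finite graph of groups $H(\Delta)$ with all vertex groups isomorphic to $\mathbb{Z}^2$ and all edge groups isomorphic to $\mathbb{Z}$, where all inclusions of edge groups into vertex groups are maximal.
   Context: A free by $\mathbb{Z}$ group is a group of the form $F\rtimes_\alpha\mathbb{Z}$ where $F$ is a free group of finite rank and $\alpha$ is an automorphism of $F$. An inclusion of an edge group into a vertex group $V\cong\mathbb{Z}^2$ is maximal if its image $\langle x\rangle$ is a maximal cyclic subgroup of $V$, i.e. there are no $g\in V\setminus\{id\}$ and $n>1$ with $x=g^n$. *)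

theory Defs
  imports "HOL-Algebra.Elementary_Groups" "HOL-Algebra.Bij" "Graph_Theory.Digraph_Component"
begin

section \<open>Free-by-\<open>\<int>\<close> groups\<close>

text \<open>
  A word over \<open>S\<close> is a list of letters \<open>(x, b)\<close>, standing for the generator \<open>x \<in> S\<close>
  if \<open>b\<close> holds and for its formal inverse otherwise.
\<close>

inductive word_red :: "'x set \<Rightarrow> ('x \<times> bool) list \<Rightarrow> ('x \<times> bool) list \<Rightarrow> bool"
  for S :: "'x set"
where
  "\<lbrakk>us \<in> lists (S \<times> UNIV); vs \<in> lists (S \<times> UNIV); x \<in> S\<rbrakk>
    \<Longrightarrow> word_red S (us @ [(x, b), (x, \<not> b)] @ vs) (us @ vs)"

definition free_group :: "'x set \<Rightarrow> ('x \<times> bool) list set monoid" where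
  "free_group S =
    \<lparr>carrier = lists (S \<times> UNIV) // {(v, w). equivclp (word_red S) v w},
     monoid.mult = \<lambda>A B. {w. \<exists>u\<in>A. \<exists>v\<in>B. equivclp (word_red S) (u @ v) w},
     one = {w. equivclp (word_red S) [] w}\<rparr>"

definition semidirect_product ::
    "('a, 'c) monoid_scheme \<Rightarrow> ('b, 'd) monoid_scheme \<Rightarrow> ('b \<Rightarrow> 'a \<Rightarrow> 'a) \<Rightarrow> ('a \<times> 'b) monoid"
where
  "semidirect_product N Q \<phi> =
    \<lparr>carrier = carrier N \<times> carrier Q,
     monoid.mult = \<lambda>(f, s) (g, t). (f \<otimes>\<^bsub>N\<^esub> \<phi> s g, s \<otimes>\<^bsub>Q\<^esub> t),
     one = (\<one>\<^bsub>N\<^esub>, \<one>\<^bsub>Q\<^esub>)\<rparr>"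

definition free_by_Z :: "('a, 'c) monoid_scheme \<Rightarrow> bool" where
  "free_by_Z G \<longleftrightarrow> (\<exists>(n :: nat) \<alpha>. \<alpha> \<in> auto (free_group {..<n}) \<and>
     G \<cong> semidirect_product (free_group {..<n}) integer_group
           (\<lambda>k :: int. \<alpha> [^]\<^bsub>AutoGroup (free_group {..<n})\<^esub> k))"


section \<open>Graphs of groups\<close>

text \<open>
  The arcs of a digraph represent the geometric edges of the underlying graph, each with an
  arbitrarily chosen orientation; loops and multiple edges are allowed. An oriented edge is a
  pair \<open>(e, b)\<close>: the arc \<open>e\<close> traversed from tail to head if \<open>b\<close> holds, and from head to tail
  otherwise.
\<close>

definition rev_edge :: "'e \<times> bool \<Rightarrow> 'e \<times> bool" where
  "rev_edge x = (fst x, \<not> snd x)"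

definition edge_end :: "('v, 'e) pre_digraph \<Rightarrow> 'e \<times> bool \<Rightarrow> 'v" where
  "edge_end \<Gamma> x = (if snd x then head \<Gamma> (fst x) else tail \<Gamma> (fst x))"

definition edge_start :: "('v, 'e) pre_digraph \<Rightarrow> 'e \<times> bool \<Rightarrow> 'v" where
  "edge_start \<Gamma> x = edge_end \<Gamma> (rev_edge x)"

text \<open>
  \<open>edge_incl \<G> x\<close> is the inclusion of the edge group of \<open>x\<close> into the vertex group at the
  terminal vertex of the oriented edge \<open>x\<close>; the inclusion at the initial vertex is
  \<open>edge_incl \<G> (rev_edge x)\<close>.
\<close>

record ('v, 'e, 'a, 'b) gog =
  gog_graph :: "('v, 'e) pre_digraph"
  vertex_group :: "'v \<Rightarrow> 'a monoid"
  edge_group :: "'e \<Rightarrow> 'b monoid"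
  edge_incl :: "'e \<times> bool \<Rightarrow> 'b \<Rightarrow> 'a"

locale graph_of_groups =
  fixes \<G> :: "('v, 'e, 'a, 'b) gog"
  assumes wf_digraph_gog_graph: "wf_digraph (gog_graph \<G>)"
    and group_vertex_group: "v \<in> verts (gog_graph \<G>) \<Longrightarrow> group (vertex_group \<G> v)"
    and group_edge_group: "e \<in> arcs (gog_graph \<G>) \<Longrightarrow> group (edge_group \<G> e)"
    and edge_incl_mon: "e \<in> arcs (gog_graph \<G>) \<Longrightarrow>
      edge_incl \<G> (e, b) \<in> mon (edge_group \<G> e) (vertex_group \<G> (edge_end (gog_graph \<G>) (e, b)))"

text \<open>
  The fundamental group at a base vertex \<open>v\<^sub>0\<close> consists of the homotopy classes of
  \<open>\<G>\<close>-loops at \<open>v\<^sub>0\<close>. A \<open>\<G>\<close>-path is a sequence \<open>g\<^sub>0, x\<^sub>1, g\<^sub>1, \<dots>, x\<^sub>n, g\<^sub>n\<close> with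
  \<open>x\<^sub>1, \<dots>, x\<^sub>n\<close> an edge path and each \<open>g\<^sub>i\<close> in the group of the vertex reached after \<open>x\<^sub>i\<close>.
\<close>

datatype ('e, 'a) gog_path = Elt 'a | Step 'a "'e \<times> bool" "('e, 'a) gog_path"

primrec is_gog_path :: "('v, 'e, 'a, 'b) gog \<Rightarrow> 'v \<Rightarrow> ('e, 'a) gog_path \<Rightarrow> 'v \<Rightarrow> bool" where
  "is_gog_path \<G> u (Elt g) v \<longleftrightarrow>
     u = v \<and> u \<in> verts (gog_graph \<G>) \<and> g \<in> carrier (vertex_group \<G> u)"
| "is_gog_path \<G> u (Step g x p) v \<longleftrightarrow>
     g \<in> carrier (vertex_group \<G> u) \<and> fst x \<in> arcs (gog_graph \<G>) \<and>
     edge_start (gog_graph \<G>) x = u \<and> is_gog_path \<G> (edge_end (gog_graph \<G>) x) p v"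

text \<open>
  Concatenation multiplies the last element of the first path with the first element of the
  second; \<open>K\<close> is the vertex group at the vertex where the paths meet.
\<close>

fun gog_conc :: "'a monoid \<Rightarrow> ('e, 'a) gog_path \<Rightarrow> ('e, 'a) gog_path \<Rightarrow> ('e, 'a) gog_path" where
  "gog_conc K (Elt g) (Elt h) = Elt (g \<otimes>\<^bsub>K\<^esub> h)"
| "gog_conc K (Elt g) (Step h x q) = Step (g \<otimes>\<^bsub>K\<^esub> h) x q"
| "gog_conc K (Step g x p) q = Step g x (gog_conc K p q)"

text \<open>
  Homotopy of paths from \<open>u\<close> to \<open>v\<close> is generated by replacing a subpath \<open>x c x\<inverse>\<close>, where \<open>c\<close>
  lies in the image of the edge group at the end of \<open>x\<close>, by the image of the same edge group
  element at the start of \<open>x\<close>. Taking \<open>c = 1\<close> cancels \<open>x x\<inverse>\<close>.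
\<close>

inductive gog_red ::
    "('v, 'e, 'a, 'b) gog \<Rightarrow> 'v \<Rightarrow> 'v \<Rightarrow> ('e, 'a) gog_path \<Rightarrow> ('e, 'a) gog_path \<Rightarrow> bool"
  for \<G> :: "('v, 'e, 'a, 'b) gog" and u v :: 'v
where
  "\<lbrakk>fst x \<in> arcs (gog_graph \<G>); w = edge_start (gog_graph \<G>) x; K = vertex_group \<G> w;
    is_gog_path \<G> u p w; is_gog_path \<G> w q v; c \<in> carrier (edge_group \<G> (fst x))\<rbrakk>
    \<Longrightarrow> gog_red \<G> u v
          (gog_conc K p
            (gog_conc K (Step \<one>\<^bsub>K\<^esub> x (Step (edge_incl \<G> x c) (rev_edge x) (Elt \<one>\<^bsub>K\<^esub>))) q))
          (gog_conc K p (gog_conc K (Elt (edge_incl \<G> (rev_edge x) c)) q))"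

definition fundamental_group ::
    "('v, 'e, 'a, 'b) gog \<Rightarrow> 'v \<Rightarrow> ('e, 'a) gog_path set monoid"
where
  "fundamental_group \<G> v0 =
    \<lparr>carrier = {p. is_gog_path \<G> v0 p v0} // {(p, q). equivclp (gog_red \<G> v0 v0) p q},
     monoid.mult = \<lambda>A B. {r. \<exists>p\<in>A. \<exists>q\<in>B.
        equivclp (gog_red \<G> v0 v0) (gog_conc (vertex_group \<G> v0) p q) r},
     one = {r. equivclp (gog_red \<G> v0 v0) (Elt \<one>\<^bsub>vertex_group \<G> v0\<^esub>) r}\<rparr>"

definition finite_connected_Z2_Z_gog :: "('v, 'e, 'a, 'b) gog \<Rightarrow> bool" where
  "finite_connected_Z2_Z_gog \<G> \<longleftrightarrow>
     graph_of_groups \<G> \<and> fin_digraph (gog_graph \<G>) \<and> connected (gog_graph \<G>) \<and>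
     (\<forall>v\<in>verts (gog_graph \<G>). vertex_group \<G> v \<cong> integer_group \<times>\<times> integer_group) \<and>
     (\<forall>e\<in>arcs (gog_graph \<G>). edge_group \<G> e \<cong> integer_group)"

definition maximal_cyclic :: "('a, 'c) monoid_scheme \<Rightarrow> 'a set \<Rightarrow> bool" where
  "maximal_cyclic V C \<longleftrightarrow>
     (\<exists>x\<in>carrier V. C = generate V {x} \<and>
        \<not> (\<exists>g\<in>carrier V - {\<one>\<^bsub>V\<^esub>}. \<exists>n::nat. n > 1 \<and> x = g [^]\<^bsub>V\<^esub> n))"

definition all_inclusions_maximal :: "('v, 'e, 'a, 'b) gog \<Rightarrow> bool" where
  "all_inclusions_maximal \<G> \<longleftrightarrow>
     (\<forall>e\<in>arcs (gog_graph \<G>). \<forall>b.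
        maximal_cyclic (vertex_group \<G> (edge_end (gog_graph \<G>) (e, b)))
          (edge_incl \<G> (e, b) ` carrier (edge_group \<G> e)))"

end

theory Submission
  imports Defs
begin

text \<open>
  Let \<open>\<phi>\<close> be the projection of \<open>G = F \<rtimes> \<int>\<close> to \<open>\<int>\<close>. If \<open>\<phi>\<close> is nonzero on every edge group, let
  \<open>N\<close> be a common multiple of the values of \<open>\<phi>\<close> on the generators of the edge groups and
  \<open>H = \<phi>\<inverse>(N\<int>)\<close>. The vertex groups of the covering graph of groups of \<open>H\<close> are the subgroups
  \<open>V \<inter> H\<close>, and a generator of an edge group \<open>C \<inter> H\<close> has \<open>\<phi>\<close>-value \<open>\<plusminus>N\<close>, so it is not a
  proper power in \<open>V \<inter> H\<close>, on which \<open>\<phi>\<close> takes values in \<open>N\<int>\<close>.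

  That \<open>\<phi>\<close> does not vanish on an edge group is a dimension count which uses only that \<open>F\<close> is
  finitely generated. Let \<open>G\<close> act on \<open>\<rat>\<close> by \<open>g \<cdot> q = 2\<^sup>\<phi>\<^sup>(\<^sup>g\<^sup>) q\<close>. The values on \<open>F\<close> of a derivation
  \<open>G \<rightarrow> \<rat>\<close> have bounded denominators and are closed under halving, hence vanish, so every
  derivation is inner. On the other hand, derivations of the fundamental groupoid of the graph of
  groups are the solutions of a linear system with one equation per edge; the unknowns are one
  value per edge, and for each vertex one value if \<open>\<phi>\<close> is nonzero on its group, otherwise two.
  The inner ones form a space whose dimension is the number of vertices. If \<open>\<phi>\<close> vanished on an
  edge group, then either it would vanish on an adjacent vertex group, or the equation of that edge
  would be void; both leave a solution that is not inner.
\<close>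

section \<open>Paths in a graph of groups\<close>

text \<open>The inner derivation given by \<open>q\<close> sends \<open>g\<close> to
  \<open>(2^\<phi>(g) - 1) q\<close>, so it takes the value \<open>q\<close> at an element
  \<open>s\<close> of height 1. Every derivation thus differs from one with \<open>d(s) = 0\<close>
  by a unique inner one, and "all derivations are inner" becomes "\<open>d(s) = 0\<close> implies
  \<open>d = 0\<close>". With this normalisation conjugation by \<open>s\<close> gives
  \<open>d(\<alpha>(f)) = 2 d(f)\<close>, and surjectivity of \<open>\<alpha>\<close> is what makes
  the values on \<open>F\<close> closed under halving. For the groupoid the same normalisation costs
  one equation per vertex: a loop for \<open>s\<close> and the base paths to the other vertices get
  value 0.

  The covering has no canonical heights: its vertices are orbits of heights, so one height is chosen
  in each orbit, and lifts and projections are corrected by vertex group elements \<open>tau\<close>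
  that lead from the chosen height to the actual one. Lift and projection are compared on arbitrary
  paths, where they are inverse to each other only up to conjugators at both endpoints; this form
  survives induction, and for loops at the base vertex whose height is divisible by \<open>N\<close>
  the conjugators are trivial.\<close>

lemma rev_edge_simps [simp]:
  "fst (rev_edge x) = fst x" "rev_edge (rev_edge x) = x"
  "edge_start \<Gamma> (rev_edge x) = edge_end \<Gamma> x" "edge_end \<Gamma> (rev_edge x) = edge_start \<Gamma> x"
  by (auto simp: rev_edge_def edge_start_def edge_end_def)

context graph_of_groups
begin

abbreviation "V \<equiv> verts (gog_graph \<G>)"
abbreviation "E \<equiv> arcs (gog_graph \<G>)"
abbreviation "vg \<equiv> vertex_group \<G>"
abbreviation "eg \<equiv> edge_group \<G>"
abbreviation "incl \<equiv> edge_incl \<G>"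
abbreviation "start \<equiv> edge_start (gog_graph \<G>)"
abbreviation "fin \<equiv> edge_end (gog_graph \<G>)"
abbreviation "path \<equiv> is_gog_path \<G>"
abbreviation "eqv u v \<equiv> equivclp (gog_red \<G> u v)"
abbreviation "conc v p q \<equiv> gog_conc (vg v) p q"

lemma vgroup [simp]: "v \<in> V \<Longrightarrow> Group.group (vg v)" by (rule group_vertex_group)
lemma vmonoid [simp]: "v \<in> V \<Longrightarrow> Group.monoid (vg v)" by (simp add: group.is_monoid)

lemma fin_in_verts [simp]: "fst x \<in> E \<Longrightarrow> fin x \<in> V"
  using wf_digraph_gog_graph by (simp add: edge_end_def wf_digraph_def)

lemma start_in_verts [simp]: "fst x \<in> E \<Longrightarrow> start x \<in> V"
  by (metis fin_in_verts rev_edge_simps(1,4))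

lemma incl_hom: "fst x \<in> E \<Longrightarrow> incl x \<in> hom (eg (fst x)) (vg (fin x))"
  using edge_incl_mon[of "fst x" "snd x"] by (simp add: mon_def)

lemma incl_inj: "fst x \<in> E \<Longrightarrow> inj_on (incl x) (carrier (eg (fst x)))"
  using edge_incl_mon[of "fst x" "snd x"] by (simp add: mon_def)

lemma incl_closed [simp]:
  "fst x \<in> E \<Longrightarrow> c \<in> carrier (eg (fst x)) \<Longrightarrow> incl x c \<in> carrier (vg (fin x))"
  by (meson hom_in_carrier incl_hom)

lemma incl_rev_closed [simp]:
  "fst x \<in> E \<Longrightarrow> c \<in> carrier (eg (fst x)) \<Longrightarrow> incl (rev_edge x) c \<in> carrier (vg (start x))"
  using incl_closed[of "rev_edge x"] by simp

lemma incl_one [simp]: "fst x \<in> E \<Longrightarrow> incl x \<one>\<^bsub>eg (fst x)\<^esub> = \<one>\<^bsub>vg (fin x)\<^esub>"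
  using hom_one[OF incl_hom] by (simp add: group_edge_group)

lemma incl_rev_one [simp]: "fst x \<in> E \<Longrightarrow> incl (rev_edge x) \<one>\<^bsub>eg (fst x)\<^esub> = \<one>\<^bsub>vg (start x)\<^esub>"
  using incl_one[of "rev_edge x"] by simp

lemma path_verts: "path u p v \<Longrightarrow> u \<in> V \<and> v \<in> V"
  by (induction p arbitrary: u) auto

lemma path_conc [simp]: "path u p w \<Longrightarrow> path w q v \<Longrightarrow> path u (conc w p q) v"
proof (induction p arbitrary: u)
  case (Elt g)
  then show ?case by (cases q) (auto simp: monoid.m_closed)
qed auto

lemma conc_assoc:
  "path u p w \<Longrightarrow> path w q v \<Longrightarrow> path v r t \<Longrightarrow>
    conc v (conc w p q) r = conc w p (conc v q r)"
proof (induction p arbitrary: u)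
  case (Elt g)
  then show ?case by (cases q; cases r) (auto simp: monoid.m_assoc)
qed auto

lemma conc_one_left [simp]: "path u p v \<Longrightarrow> conc u (Elt \<one>\<^bsub>vg u\<^esub>) p = p"
  using path_verts[of u p v] by (cases p) (auto simp: monoid.l_one)

lemma conc_one_right [simp]: "path u p v \<Longrightarrow> conc v p (Elt \<one>\<^bsub>vg v\<^esub>) = p"
proof (induction p arbitrary: u)
  case (Elt g)
  then show ?case by (auto simp: monoid.r_one)
qed auto

definition edge_path :: "'e \<times> bool \<Rightarrow> ('e, 'a) gog_path" where
  "edge_path x = Step \<one>\<^bsub>vg (start x)\<^esub> x (Elt \<one>\<^bsub>vg (fin x)\<^esub>)"

lemma path_Elt [simp]: "u \<in> V \<Longrightarrow> g \<in> carrier (vg u) \<Longrightarrow> path u (Elt g) u" by simp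

lemma path_edge_path [simp]: "fst x \<in> E \<Longrightarrow> path (start x) (edge_path x) (fin x)"
  by (simp add: edge_path_def monoid.one_closed)

lemma Step_eq_conc:
  assumes "path u (Step g x p) v"
  shows "Step g x p = conc u (Elt g) (conc (fin x) (edge_path x) p)"
  using assms path_verts[of _ p] by (auto simp: edge_path_def monoid.r_one)

lemma red_path: "gog_red \<G> u v p q \<Longrightarrow> path u p v \<and> path u q v"
proof (induction rule: gog_red.induct)
  case (1 x w K p q c)
  have "path w (Step \<one>\<^bsub>K\<^esub> x (Step (incl x c) (rev_edge x) (Elt \<one>\<^bsub>K\<^esub>))) w"
    using 1 by (auto simp: monoid.one_closed)
  then have "path w (gog_conc K (Step \<one>\<^bsub>K\<^esub> x (Step (incl x c) (rev_edge x) (Elt \<one>\<^bsub>K\<^esub>))) q) v"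
    using 1 by simp
  moreover have "path w (Elt (incl (rev_edge x) c)) w" using 1 by auto
  then have "path w (gog_conc K (Elt (incl (rev_edge x) c)) q) v"
    using 1(3,5) path_conc by blast
  ultimately show ?case using 1 by simp
qed

lemma eqv_path: "eqv u v p q \<Longrightarrow> path u p v \<longleftrightarrow> path u q v"
  by (induction rule: equivclp_induct) (auto dest: red_path)

lemma eqv_refl [simp]: "eqv u v p p" by (rule equivclp_refl)
lemma eqv_sym: "eqv u v p q \<Longrightarrow> eqv u v q p" by (rule equivclp_sym)
lemma eqv_trans: "eqv u v p q \<Longrightarrow> eqv u v q r \<Longrightarrow> eqv u v p r" by (rule equivclp_trans)

lemma gog_redI:
  assumes "fst x \<in> E" "path u p (start x)" "path (start x) q v" "c \<in> carrier (eg (fst x))"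
  shows "gog_red \<G> u v
    (conc (start x) p (conc (start x) (Step \<one>\<^bsub>vg (start x)\<^esub> x (Step (incl x c) (rev_edge x) (Elt \<one>\<^bsub>vg (start x)\<^esub>))) q))
    (conc (start x) p (conc (start x) (Elt (incl (rev_edge x) c)) q))"
  using gog_red.intros[OF assms(1) refl refl assms(2,3,4)] .

lemma spur_path:
  assumes "fst x \<in> E" "c \<in> carrier (eg (fst x))"
  shows "path (start x) (Step \<one>\<^bsub>vg (start x)\<^esub> x (Step (incl x c) (rev_edge x) (Elt \<one>\<^bsub>vg (start x)\<^esub>))) (start x)"
  using assms by (auto simp: monoid.one_closed)

text \<open>The rule of \<open>gog_red\<close> already carries a prefix and a suffix, so
  \<open>q\<close> is absorbed into the suffix by associativity.\<close>

lemma red_conc_right: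
  assumes "gog_red \<G> u w p p'" "path w q v"
  shows "gog_red \<G> u v (conc w p q) (conc w p' q)"
  using assms(1)
proof (cases rule: gog_red.cases)
  case (1 x t K r s c)
  let ?s = "Step \<one>\<^bsub>vg t\<^esub> x (Step (incl x c) (rev_edge x) (Elt \<one>\<^bsub>vg t\<^esub>))"
    and ?e = "Elt (incl (rev_edge x) c)"
  have ty: "path t ?s t" "path t ?e t" "path u r t" "path t s w"
    using spur_path 1 by (simp_all del: gog_conc.simps)
  have p: "conc w p q = conc t r (conc t ?s (conc w s q))"
    unfolding 1(1,5) by (metis conc_assoc path_conc ty assms(2))
  have p': "conc w p' q = conc t r (conc t ?e (conc w s q))"
    unfolding 1(2,5) by (metis conc_assoc path_conc ty assms(2))
  show ?thesis unfolding p p' 1(4) by (rule gog_redI) (use 1 assms(2) in simp_all)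
qed

lemma red_conc_left:
  assumes "gog_red \<G> w v p p'" "path u q w"
  shows "gog_red \<G> u v (conc w q p) (conc w q p')"
  using assms(1)
proof (cases rule: gog_red.cases)
  case (1 x t K r s c)
  let ?s = "Step \<one>\<^bsub>vg t\<^esub> x (Step (incl x c) (rev_edge x) (Elt \<one>\<^bsub>vg t\<^esub>))"
    and ?e = "Elt (incl (rev_edge x) c)"
  have ty: "path t ?s t" "path t ?e t" "path w r t" "path t s v"
    using spur_path 1 by (simp_all del: gog_conc.simps)
  have p: "conc w q p = conc t (conc w q r) (conc t ?s s)"
    unfolding 1(1,5) by (metis conc_assoc path_conc ty assms(2))
  have p': "conc w q p' = conc t (conc w q r) (conc t ?e s)"
    unfolding 1(2,5) by (metis conc_assoc path_conc ty assms(2))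
  show ?thesis unfolding p p' 1(4) by (rule gog_redI) (use 1 assms(2) in simp_all)
qed

lemma eqv_conc_right: "eqv u w p p' \<Longrightarrow> path w q v \<Longrightarrow> eqv u v (conc w p q) (conc w p' q)"
proof (induction rule: equivclp_induct)
  case (step y z)
  then show ?case by (meson red_conc_right equivclp_sym equivclp_trans r_into_equivclp)
qed simp

lemma eqv_conc_left: "eqv w v p p' \<Longrightarrow> path u q w \<Longrightarrow> eqv u v (conc w q p) (conc w q p')"
proof (induction rule: equivclp_induct)
  case (step y z)
  then show ?case by (meson red_conc_left equivclp_sym equivclp_trans r_into_equivclp)
qed simp

lemma eqv_conc:
  assumes "eqv u w p p'" "eqv w v q q'" "path u p w" "path w q v"
  shows "eqv u v (conc w p q) (conc w p' q')"
  using eqv_conc_right[OF assms(1,4)] eqv_conc_left[OF assms(2)] assms eqv_path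
  by (meson eqv_trans)

lemma edge_relation:
  assumes "fst x \<in> E" "c \<in> carrier (eg (fst x))"
  shows "eqv (start x) (start x)
    (conc (fin x) (edge_path x) (conc (fin x) (Elt (incl x c)) (edge_path (rev_edge x))))
    (Elt (incl (rev_edge x) c))"
proof -
  let ?o = "Elt \<one>\<^bsub>vg (start x)\<^esub>"
  have "path (start x) ?o (start x)" using assms by (simp add: monoid.one_closed)
  from gog_redI[OF assms(1) this this assms(2)]
  have "gog_red \<G> (start x) (start x)
     (Step \<one>\<^bsub>vg (start x)\<^esub> x (Step (incl x c) (rev_edge x) ?o)) (Elt (incl (rev_edge x) c))"
    using assms by (simp add: monoid.r_one monoid.l_one monoid.one_closed)
  then show ?thesis using assms
    by (simp add: edge_path_def monoid.r_one monoid.l_one r_into_equivclp)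
qed

lemma edge_cancel:
  assumes "fst x \<in> E"
  shows "eqv (start x) (start x) (conc (fin x) (edge_path x) (edge_path (rev_edge x)))
    (Elt \<one>\<^bsub>vg (start x)\<^esub>)"
  using edge_relation[OF assms monoid.one_closed[OF group.is_monoid[OF group_edge_group[OF assms]]]]
    assms conc_one_left[OF path_edge_path[of "rev_edge x"]] by simp

section \<open>Inverse paths\<close>

primrec rev_path :: "'v \<Rightarrow> ('e, 'a) gog_path \<Rightarrow> ('e, 'a) gog_path" where
  "rev_path u (Elt g) = Elt (inv\<^bsub>vg u\<^esub> g)"
| "rev_path u (Step g x p) = conc (fin x) (rev_path (fin x) p)
     (conc u (edge_path (rev_edge x)) (Elt (inv\<^bsub>vg u\<^esub> g)))"

lemma path_rev_path [simp]: "path u p v \<Longrightarrow> path v (rev_path u p) u"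
proof (induction p arbitrary: u)
  case (Elt g)
  then show ?case by (auto simp: group.inv_closed)
next
  case (Step g x p)
  have "path (fin x) (edge_path (rev_edge x)) u" using path_edge_path[of "rev_edge x"] Step by auto
  moreover have "path u (Elt (inv\<^bsub>vg u\<^esub> g)) u" using Step by (auto simp: group.inv_closed)
  ultimately show ?case using Step by (auto simp del: is_gog_path.simps(1))
qed

lemma conc_rev_path: "path u p v \<Longrightarrow> eqv u u (conc v p (rev_path u p)) (Elt \<one>\<^bsub>vg u\<^esub>)"
proof (induction p arbitrary: u)
  case (Elt g)
  then show ?case by (auto simp: group.r_inv)
next
  case (Step g x p)
  let ?X = "edge_path x" and ?Y = "edge_path (rev_edge x)" and ?r = "rev_path (fin x) p"
  let ?g = "Elt g" and ?h = "Elt (inv\<^bsub>vg u\<^esub> g)"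
  have u: "u \<in> V" "u = start x" "g \<in> carrier (vg u)" "fst x \<in> E" and p: "path (fin x) p v"
    using Step.prems by auto
  have X: "path u ?X (fin x)" and Y: "path (fin x) ?Y u" and g: "path u ?g u" and h: "path u ?h u"
    using u path_edge_path[of x] path_edge_path[of "rev_edge x"] by (auto simp: group.inv_closed)
  have r: "path v ?r (fin x)" using p by simp
  have c: "eqv u u (conc (fin x) ?X ?Y) (Elt \<one>\<^bsub>vg u\<^esub>)"
    using edge_cancel[OF u(4)] unfolding u(2) .
  note ty = X Y g h p r path_conc
  let ?m = "conc u ?g (conc (fin x) ?X (conc (fin x) (conc v p ?r) (conc u ?Y ?h)))"
  let ?n = "conc u ?g (conc (fin x) ?X (conc (fin x) (Elt \<one>\<^bsub>vg (fin x)\<^esub>) (conc u ?Y ?h)))"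
  let ?k = "conc u ?g (conc u (Elt \<one>\<^bsub>vg u\<^esub>) ?h)"
  have "conc v (Step g x p) (rev_path u (Step g x p)) =
      conc v (conc u ?g (conc (fin x) ?X p)) (conc (fin x) ?r (conc u ?Y ?h))"
    unfolding Step_eq_conc[OF Step.prems, symmetric] by simp
  also have "\<dots> = conc u ?g (conc v (conc (fin x) ?X p) (conc (fin x) ?r (conc u ?Y ?h)))"
    by (meson conc_assoc ty)
  also have "\<dots> = conc u ?g (conc (fin x) ?X (conc v p (conc (fin x) ?r (conc u ?Y ?h))))"
    using conc_assoc[OF X p, of "conc (fin x) ?r (conc u ?Y ?h)" u] ty by simp
  also have "\<dots> = ?m"
    using conc_assoc[OF p r, of "conc u ?Y ?h" u] ty by simp
  finally have 1: "conc v (Step g x p) (rev_path u (Step g x p)) = ?m" .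
  \<comment> \<open>Cancellation works from the inside outwards: the inverse pair for
    \<open>p\<close>, next the edge and its reverse, finally \<open>g\<close>.\<close>
  have 2: "eqv u u ?m ?n"
    by (meson eqv_conc_left eqv_conc_right Step.IH ty)
  have 3: "?n = conc u ?g (conc u (conc (fin x) ?X ?Y) ?h)"
    by (simp only: conc_one_left[OF path_conc[OF Y h]] conc_assoc[OF X Y h])
  have 4: "eqv u u (conc u ?g (conc u (conc (fin x) ?X ?Y) ?h)) ?k"
    using eqv_conc_left[OF eqv_conc_right[OF c h] g] .
  have 5: "?k = Elt \<one>\<^bsub>vg u\<^esub>"
    using u by (simp add: monoid.l_one group.inv_closed group.r_inv)
  show ?case unfolding 1 by (rule eqv_trans[OF 2]) (use 3 4 5 in simp)
qed

text \<open>As in a group: \<open>?r\<close> is a right inverse of \<open>p\<close> and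
  \<open>?s\<close> one of \<open>?r\<close>, so
  \<open>?r p = ?r p (?r ?s) = ?r ?s = 1\<close>.\<close>

lemma rev_path_conc:
  assumes "path u p v"
  shows "eqv v v (conc u (rev_path u p) p) (Elt \<one>\<^bsub>vg v\<^esub>)"
proof -
  let ?r = "rev_path u p" and ?s = "rev_path v (rev_path u p)"
  have r: "path v ?r u" and s: "path u ?s v" using assms by auto
  note ty = assms r s path_conc
  have 1: "conc u ?r p = conc u ?r (conc v p (Elt \<one>\<^bsub>vg v\<^esub>))"
    by (metis conc_one_right ty)
  have 2: "eqv v v (conc u ?r (conc v p (Elt \<one>\<^bsub>vg v\<^esub>))) (conc u ?r (conc v p (conc u ?r ?s)))"
    by (meson conc_rev_path eqv_conc_left eqv_sym ty)
  have 3: "conc u ?r (conc v p (conc u ?r ?s)) = conc u ?r (conc u (conc v p ?r) ?s)"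
    by (metis conc_assoc ty)
  have 4: "eqv v v (conc u ?r (conc u (conc v p ?r) ?s)) (conc u ?r (conc u (Elt \<one>\<^bsub>vg u\<^esub>) ?s))"
    by (meson conc_rev_path eqv_conc_left eqv_conc_right ty)
  have 5: "conc u ?r (conc u (Elt \<one>\<^bsub>vg u\<^esub>) ?s) = conc u ?r ?s"
    by (metis conc_one_left ty)
  have 6: "eqv v v (conc u ?r ?s) (Elt \<one>\<^bsub>vg v\<^esub>)"
    by (meson conc_rev_path ty)
  show ?thesis unfolding 1 using 2 4 6 unfolding 3 5 by (meson eqv_trans)
qed

end

section \<open>The fundamental group at a base vertex\<close>

locale based_gog = graph_of_groups \<G> for \<G> :: "('v, 'e, 'a, 'b) gog" +
  fixes v0 :: 'v
  assumes base_vert [simp]: "v0 \<in> V"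
    and path_from_base: "v \<in> V \<Longrightarrow> \<exists>p. path v0 p v"
begin

text \<open>The trivial path at \<open>v0\<close> is forced so that \<open>loop_cls v0 v0 p\<close>
  is \<open>cls p\<close> and all conjugators at the base vertex are trivial.\<close>

definition base_path :: "'v \<Rightarrow> ('e, 'a) gog_path" where
  "base_path v = (if v = v0 then Elt \<one>\<^bsub>vg v0\<^esub> else (SOME p. path v0 p v))"

abbreviation back_path :: "'v \<Rightarrow> ('e, 'a) gog_path" where
  "back_path v \<equiv> rev_path v0 (base_path v)"

abbreviation FG :: "('e, 'a) gog_path set monoid" where
  "FG \<equiv> fundamental_group \<G> v0"

definition cls :: "('e, 'a) gog_path \<Rightarrow> ('e, 'a) gog_path set" where
  "cls p = {q. eqv v0 v0 p q}"

text \<open>The functor from the fundamental groupoid to the fundamental group given by the base paths.\<close>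

definition loop_cls :: "'v \<Rightarrow> 'v \<Rightarrow> ('e, 'a) gog_path \<Rightarrow> ('e, 'a) gog_path set" where
  "loop_cls u v p = cls (conc u (base_path u) (conc v p (back_path v)))"

lemma base_path [simp]: "v \<in> V \<Longrightarrow> path v0 (base_path v) v"
  using someI_ex[OF path_from_base[of v]] by (auto simp: base_path_def monoid.one_closed)

lemma back_path [simp]: "v \<in> V \<Longrightarrow> path v (back_path v) v0"
  by simp

lemma base_path_base [simp]: "base_path v0 = Elt \<one>\<^bsub>vg v0\<^esub>" by (simp add: base_path_def)

lemma cls_eq_iff: "cls p = cls q \<longleftrightarrow> eqv v0 v0 p q"
  unfolding cls_def by (auto intro: eqv_trans dest: eqv_sym)

lemma carrier_FG: "carrier FG = cls ` {p. path v0 p v0}"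
  by (auto simp: fundamental_group_def quotient_def cls_def)

lemma cls_closed [simp]: "path v0 p v0 \<Longrightarrow> cls p \<in> carrier FG"
  by (auto simp: carrier_FG)

lemma mult_cls: "path v0 p v0 \<Longrightarrow> path v0 q v0 \<Longrightarrow> cls p \<otimes>\<^bsub>FG\<^esub> cls q = cls (conc v0 p q)"
  by (auto simp: fundamental_group_def cls_def) (meson eqv_conc eqv_trans eqv_refl)+

lemma one_FG: "\<one>\<^bsub>FG\<^esub> = cls (Elt \<one>\<^bsub>vg v0\<^esub>)"
  by (simp add: fundamental_group_def cls_def)

lemma path_one_base [simp]: "path v0 (Elt \<one>\<^bsub>vg v0\<^esub>) v0"
  by (simp add: monoid.one_closed)

sublocale FG: Group.group FG
proof (rule groupI)
  fix x y assume "x \<in> carrier FG" "y \<in> carrier FG"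
  then show "x \<otimes>\<^bsub>FG\<^esub> y \<in> carrier FG" by (auto simp: carrier_FG mult_cls)
next
  show "\<one>\<^bsub>FG\<^esub> \<in> carrier FG" by (simp add: one_FG)
next
  fix x y z assume "x \<in> carrier FG" "y \<in> carrier FG" "z \<in> carrier FG"
  then show "x \<otimes>\<^bsub>FG\<^esub> y \<otimes>\<^bsub>FG\<^esub> z = x \<otimes>\<^bsub>FG\<^esub> (y \<otimes>\<^bsub>FG\<^esub> z)"
    by (auto simp: carrier_FG mult_cls conc_assoc[of v0 _ v0 _ v0 _ v0])
next
  fix x assume "x \<in> carrier FG"
  then obtain p where p: "x = cls p" "path v0 p v0" by (auto simp: carrier_FG)
  show "\<one>\<^bsub>FG\<^esub> \<otimes>\<^bsub>FG\<^esub> x = x" using p by (simp add: one_FG mult_cls del: is_gog_path.simps)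
  show "\<exists>y\<in>carrier FG. y \<otimes>\<^bsub>FG\<^esub> x = \<one>\<^bsub>FG\<^esub>"
    using p by (intro bexI[of _ "cls (rev_path v0 p)"])
      (simp_all add: one_FG mult_cls cls_eq_iff rev_path_conc)
qed

lemma loop_cls_closed [simp]: "path u p v \<Longrightarrow> loop_cls u v p \<in> carrier FG"
  using path_verts[of u p v] by (simp add: loop_cls_def)

lemma loop_cls_cong: "eqv u v p q \<Longrightarrow> path u p v \<Longrightarrow> loop_cls u v p = loop_cls u v q"
  unfolding loop_cls_def cls_eq_iff
  by (meson base_path back_path eqv_conc_left eqv_conc_right path_verts path_conc)

lemma loop_cls_mult:
  assumes p: "path u p v" and q: "path v q w"
  shows "loop_cls u v p \<otimes>\<^bsub>FG\<^esub> loop_cls v w q = loop_cls u w (conc v p q)"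
proof -
  have V: "u \<in> V" "v \<in> V" "w \<in> V" using path_verts p q by auto
  let ?P = base_path and ?R = back_path
  note ty = p q base_path[OF V(1)] base_path[OF V(2)] back_path[OF V(2)] back_path[OF V(3)] path_conc
  let ?o = "Elt \<one>\<^bsub>vg v\<^esub>"
  have o: "path v ?o v" using V by (simp add: monoid.one_closed)
  have 1: "loop_cls u v p \<otimes>\<^bsub>FG\<^esub> loop_cls v w q =
     cls (conc v0 (conc u (?P u) (conc v p (?R v))) (conc v (?P v) (conc w q (?R w))))"
    using ty V by (simp add: loop_cls_def mult_cls)
  have "conc v0 (conc u (?P u) (conc v p (?R v))) (conc v (?P v) (conc w q (?R w)))
     = conc u (?P u) (conc v0 (conc v p (?R v)) (conc v (?P v) (conc w q (?R w))))"
    by (meson conc_assoc ty)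
  also have "\<dots> = conc u (?P u) (conc v p (conc v0 (?R v) (conc v (?P v) (conc w q (?R w)))))"
    using conc_assoc[OF p ty(5), of "conc v (?P v) (conc w q (?R w))" v0] ty V by simp
  also have "\<dots> = conc u (?P u) (conc v p (conc v (conc v0 (?R v) (?P v)) (conc w q (?R w))))"
    using conc_assoc[OF ty(5) ty(4), of "conc w q (?R w)" v0] ty by simp
  finally have 2: "conc v0 (conc u (?P u) (conc v p (?R v))) (conc v (?P v) (conc w q (?R w)))
    = conc u (?P u) (conc v p (conc v (conc v0 (?R v) (?P v)) (conc w q (?R w))))" .
  \<comment> \<open>All that stands between \<open>p\<close> and \<open>q\<close> is the detour from
    \<open>v\<close> to \<open>v0\<close> and back, which contracts.\<close>
  have 3: "eqv v0 v0 (conc u (?P u) (conc v p (conc v (conc v0 (?R v) (?P v)) (conc w q (?R w)))))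
     (conc u (?P u) (conc v p (conc v ?o (conc w q (?R w)))))"
    by (meson rev_path_conc eqv_conc_left eqv_conc_right ty)
  have 4: "conc u (?P u) (conc v p (conc v ?o (conc w q (?R w)))) = conc u (?P u) (conc w (conc v p q) (?R w))"
    using conc_assoc[OF p q ty(6)] conc_one_left[of v "conc w q (?R w)" v0] ty by simp
  show ?thesis unfolding 1 2 using 3 unfolding 4 loop_cls_def cls_eq_iff .
qed

lemma loop_cls_base: "path v0 p v0 \<Longrightarrow> loop_cls v0 v0 p = cls p"
  using conc_one_left[of v0 p v0] conc_one_right[of v0 p v0]
  by (simp add: loop_cls_def group.is_monoid monoid.inv_one del: is_gog_path.simps)

lemma carrier_FG_loop_cls: "A \<in> carrier FG \<Longrightarrow> \<exists>p. path v0 p v0 \<and> A = loop_cls v0 v0 p"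
  by (auto simp: carrier_FG loop_cls_base)

lemma loop_cls_one: 
  assumes "v \<in> V" shows "loop_cls v v (Elt \<one>\<^bsub>vg v\<^esub>) = \<one>\<^bsub>FG\<^esub>"
proof -
  have o: "path v (Elt \<one>\<^bsub>vg v\<^esub>) v" using assms by (simp add: monoid.one_closed)
  then show ?thesis
    by (metis FG.r_cancel_one' conc_one_left loop_cls_closed loop_cls_mult)
qed

lemma loop_cls_base_path:
  assumes "v \<in> V" shows "loop_cls v0 v (base_path v) = \<one>\<^bsub>FG\<^esub>"
proof -
  have "loop_cls v0 v (base_path v) = cls (conc v (base_path v) (back_path v))"
    using assms conc_one_left[of v0 "conc v (base_path v) (back_path v)" v0] by (simp add: loop_cls_def)
  also have "\<dots> = \<one>\<^bsub>FG\<^esub>" using assms by (simp add: one_FG cls_eq_iff conc_rev_path)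
  finally show ?thesis .
qed

definition vcls :: "'v \<Rightarrow> 'a \<Rightarrow> ('e, 'a) gog_path set" where
  "vcls v g = loop_cls v v (Elt g)"

definition ecls :: "'e \<times> bool \<Rightarrow> ('e, 'a) gog_path set" where
  "ecls x = loop_cls (start x) (fin x) (edge_path x)"

lemma vcls_hom: "v \<in> V \<Longrightarrow> vcls v \<in> hom (vg v) FG"
  by (rule homI) (simp_all add: vcls_def loop_cls_mult)

lemma vcls_closed [simp]: "v \<in> V \<Longrightarrow> g \<in> carrier (vg v) \<Longrightarrow> vcls v g \<in> carrier FG"
  by (meson hom_in_carrier vcls_hom)

lemma vcls_mult: "v \<in> V \<Longrightarrow> g \<in> carrier (vg v) \<Longrightarrow> h \<in> carrier (vg v) \<Longrightarrow>
    vcls v (g \<otimes>\<^bsub>vg v\<^esub> h) = vcls v g \<otimes>\<^bsub>FG\<^esub> vcls v h"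
  by (meson hom_mult vcls_hom)

lemma vcls_one [simp]: "v \<in> V \<Longrightarrow> vcls v \<one>\<^bsub>vg v\<^esub> = \<one>\<^bsub>FG\<^esub>"
  by (simp add: vcls_def loop_cls_one)

lemma ecls_closed [simp]: "fst x \<in> E \<Longrightarrow> ecls x \<in> carrier FG"
  by (simp add: ecls_def)

text \<open>Lets maps out of the fundamental group be computed on the generators \<open>vcls\<close>
  and \<open>ecls\<close> by induction on paths.\<close>

lemma loop_cls_Step:
  assumes "path u (Step g x p) v"
  shows "loop_cls u v (Step g x p) = vcls u g \<otimes>\<^bsub>FG\<^esub> (ecls x \<otimes>\<^bsub>FG\<^esub> loop_cls (fin x) v p)"
proof -
  have ty: "path u (Elt g) u" "path u (edge_path x) (fin x)" "path (fin x) p v" "u = start x"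
    using assms by auto
  show ?thesis
    unfolding Step_eq_conc[OF assms] vcls_def ecls_def
    by (simp only: loop_cls_mult[OF ty(1) path_conc[OF ty(2,3)]] loop_cls_mult[OF ty(2,3)] ty(4)[symmetric])
qed

text \<open>The image of \<open>edge_relation\<close> under the functor
  \<open>loop_cls\<close>.\<close>

lemma ecls_relation:
  assumes "fst x \<in> E" "c \<in> carrier (eg (fst x))"
  shows "ecls x \<otimes>\<^bsub>FG\<^esub> (vcls (fin x) (incl x c) \<otimes>\<^bsub>FG\<^esub> ecls (rev_edge x)) = vcls (start x) (incl (rev_edge x) c)"
proof -
  let ?X = "edge_path x" and ?Y = "edge_path (rev_edge x)" and ?c = "Elt (incl x c)"
  have ty: "path (start x) ?X (fin x)" "path (fin x) ?c (fin x)" "path (fin x) ?Y (start x)"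
    using assms path_edge_path[of x] path_edge_path[of "rev_edge x"] by auto
  have "ecls x \<otimes>\<^bsub>FG\<^esub> (vcls (fin x) (incl x c) \<otimes>\<^bsub>FG\<^esub> ecls (rev_edge x)) =
      loop_cls (start x) (start x) (conc (fin x) ?X (conc (fin x) ?c ?Y))"
    unfolding ecls_def vcls_def rev_edge_simps
    by (simp only: loop_cls_mult[OF ty(2,3)] loop_cls_mult[OF ty(1) path_conc[OF ty(2,3)]])
  also have "\<dots> = vcls (start x) (incl (rev_edge x) c)"
    unfolding vcls_def by (intro loop_cls_cong edge_relation assms path_conc ty)
  finally show ?thesis .
qed

lemma ecls_rev: "fst x \<in> E \<Longrightarrow> ecls x \<otimes>\<^bsub>FG\<^esub> ecls (rev_edge x) = \<one>\<^bsub>FG\<^esub>"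
  using ecls_relation[of x "\<one>\<^bsub>eg (fst x)\<^esub>"] ecls_closed[of "rev_edge x"]
  by (simp add: group.is_monoid[OF group_edge_group] monoid.one_closed)

end

section \<open>Connectedness in terms of paths\<close>

lemma (in graph_of_groups) connected_imp_path:
  assumes "connected (gog_graph \<G>)" "u \<in> V" "v \<in> V"
  shows "\<exists>p. path u p v"
proof -
  interpret wf_digraph "gog_graph \<G>" by (rule wf_digraph_gog_graph)
  have "(u, v) \<in> rtrancl_on V (parcs (mk_symmetric (gog_graph \<G>)))"
    using assms by (auto simp: connected_def strongly_connected_def reachable_def)
  then show ?thesis
  proof (induction rule: rtrancl_on_induct)
    case base
    then show ?case using assms by (intro exI[of _ "Elt \<one>\<^bsub>vg u\<^esub>"]) (simp add: monoid.one_closed)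
  next
    case (step y z)
    then obtain p where p: "path u p y" by auto
    from step(2) obtain e where e: "e \<in> E"
      "y = tail (gog_graph \<G>) e \<and> z = head (gog_graph \<G>) e \<or> z = tail (gog_graph \<G>) e \<and> y = head (gog_graph \<G>) e"
      by (auto simp: parcs_mk_symmetric)
    have "start (e, True) = tail (gog_graph \<G>) e" "fin (e, True) = head (gog_graph \<G>) e"
      "start (e, False) = head (gog_graph \<G>) e" "fin (e, False) = tail (gog_graph \<G>) e"
      by (simp_all add: edge_end_def edge_start_def rev_edge_def)
    \<comment> \<open>Connectedness refers to the symmetric closure of the digraph, so the arc may
      have to be crossed backwards.\<close>
    with e(2) obtain b where "start (e, b) = y" "fin (e, b) = z" by metis
    with e have e: "e \<in> E" "start (e, b) = y" "fin (e, b) = z" by auto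
    then have "path y (edge_path (e, b)) z" using path_edge_path[of "(e, b)"] e by simp
    with p show ?case using path_conc by blast
  qed
qed

lemma (in graph_of_groups) path_imp_connected:
  assumes "v0 \<in> V" "\<And>v. v \<in> V \<Longrightarrow> \<exists>p. path v0 p v"
  shows "connected (gog_graph \<G>)"
proof -
  interpret wf_digraph "gog_graph \<G>" by (rule wf_digraph_gog_graph)
  let ?R = "parcs (mk_symmetric (gog_graph \<G>))"
  have *: "(u, v) \<in> rtrancl_on V ?R" if "path u p v" for u p v
    using that
  proof (induction p arbitrary: u)
    case (Step g x p)
    then have "(u, fin x) \<in> ?R" "u \<in> V"
      by (auto simp: parcs_mk_symmetric edge_end_def edge_start_def rev_edge_def)
    with Step show ?case using converse_rtrancl_on_into_rtrancl_on by fastforce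
  qed auto
  have "(u, v) \<in> rtrancl_on V ?R" if "u \<in> V" "v \<in> V" for u v
  proof -
    obtain p q where "path v0 p u" "path v0 q v" using assms(2)[OF \<open>u \<in> V\<close>] assms(2)[OF \<open>v \<in> V\<close>] by blast
    then have "path u (conc v0 (rev_path v0 p) q) v" by simp
    then show ?thesis by (rule *)
  qed
  then show ?thesis using assms by (auto simp: connected_def strongly_connected_def reachable_def)
qed

section \<open>Representations with heights\<close>

text \<open>
  Fix a homomorphism from the fundamental groupoid to \<open>\<int>\<close>, the height, given by \<open>hv\<close> on the vertex
  groups and by \<open>hx\<close> on the edges. A representation with heights is a functor to a group \<open>M\<close> from
  the groupoid of pairs of a path and an initial height; \<open>lam v z g\<close> is the value on the vertex group
  element \<open>g\<close> started at height \<open>z\<close>. Derivations \<open>d\<close> arise as \<open>lam v z g = 2\<^sup>z d(g)\<close>, the lifting of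
  paths to a covering is of this kind, and zero heights give ordinary homomorphisms.
\<close>

locale gog_height = graph_of_groups \<G> for \<G> :: "('v, 'e, 'a, 'b) gog" +
  fixes hv :: "'v \<Rightarrow> 'a \<Rightarrow> int" and hx :: "'e \<Rightarrow> int"
  assumes hv_mult: "\<lbrakk>v \<in> V; g \<in> carrier (vg v); h \<in> carrier (vg v)\<rbrakk> \<Longrightarrow>
      hv v (g \<otimes>\<^bsub>vg v\<^esub> h) = hv v g + hv v h"
    and hv_incl: "\<lbrakk>e \<in> E; c \<in> carrier (eg e)\<rbrakk> \<Longrightarrow>
      hv (fin (e, True)) (incl (e, True) c) = hv (fin (e, False)) (incl (e, False) c)"
begin

definition hxx :: "'e \<times> bool \<Rightarrow> int" where
  "hxx x = (if snd x then hx (fst x) else - hx (fst x))"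

primrec hgt :: "'v \<Rightarrow> ('e, 'a) gog_path \<Rightarrow> int" where
  "hgt u (Elt g) = hv u g"
| "hgt u (Step g x p) = hv u g + hxx x + hgt (fin x) p"

lemma hxx_rev [simp]: "hxx (rev_edge x) = - hxx x"
  by (simp add: hxx_def rev_edge_def)

lemma hv_one: "v \<in> V \<Longrightarrow> hv v \<one>\<^bsub>vg v\<^esub> = 0"
  using hv_mult[of v "\<one>\<^bsub>vg v\<^esub>" "\<one>\<^bsub>vg v\<^esub>"] by (simp add: monoid.one_closed monoid.l_one)

lemma hv_inv: "v \<in> V \<Longrightarrow> g \<in> carrier (vg v) \<Longrightarrow> hv v (inv\<^bsub>vg v\<^esub> g) = - hv v g"
  using hv_mult[of v g "inv\<^bsub>vg v\<^esub> g"] by (simp add: group.inv_closed group.r_inv hv_one)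

lemma hv_incl_rev:
  assumes "fst x \<in> E" "c \<in> carrier (eg (fst x))"
  shows "hv (start x) (incl (rev_edge x) c) = hv (fin x) (incl x c)"
proof (cases x)
  case (Pair e b)
  then show ?thesis using assms hv_incl[of e c] by (cases b) (simp_all add: rev_edge_def edge_start_def)
qed

lemma hgt_conc: "path u p w \<Longrightarrow> path w q v \<Longrightarrow> hgt u (conc w p q) = hgt u p + hgt w q"
proof (induction p arbitrary: u)
  case (Elt g)
  then show ?case by (cases q) (auto simp: hv_mult)
qed auto

lemma hgt_red: "gog_red \<G> u v p q \<Longrightarrow> hgt u p = hgt u q"
proof (induction rule: gog_red.induct)
  case (1 x t K r s c)
  let ?s = "Step \<one>\<^bsub>vg t\<^esub> x (Step (incl x c) (rev_edge x) (Elt \<one>\<^bsub>vg t\<^esub>))"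
    and ?e = "Elt (incl (rev_edge x) c)"
  have ty: "path t ?s t" "path t ?e t"
    using spur_path 1 by (simp_all del: gog_conc.simps)
  have "hgt t ?s = hgt t ?e" using 1 by (simp add: hv_incl_rev hv_one)
  then show ?case unfolding 1(3)
    by (simp only: hgt_conc[OF 1(4) path_conc[OF ty(1) 1(5)]] hgt_conc[OF 1(4) path_conc[OF ty(2) 1(5)]]
       hgt_conc[OF ty(1) 1(5)] hgt_conc[OF ty(2) 1(5)])
qed

lemma hgt_eqv: "eqv u v p q \<Longrightarrow> hgt u p = hgt u q"
  by (induction rule: equivclp_induct) (auto dest: hgt_red)

end

section \<open>Representations of paths and their homotopy invariance\<close>

locale gog_rep = gog_height \<G> hv hx + M: Group.group M
  for \<G> :: "('v, 'e, 'a, 'b) gog" and hv hx and M :: "'m monoid" +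
  fixes lam :: "'v \<Rightarrow> int \<Rightarrow> 'a \<Rightarrow> 'm" and mu :: "'e \<Rightarrow> int \<Rightarrow> 'm"
  assumes lam_closed: "\<lbrakk>v \<in> V; g \<in> carrier (vg v)\<rbrakk> \<Longrightarrow> lam v z g \<in> carrier M"
    and mu_closed: "e \<in> E \<Longrightarrow> mu e z \<in> carrier M"
    and lam_mult: "\<lbrakk>v \<in> V; g \<in> carrier (vg v); h \<in> carrier (vg v)\<rbrakk> \<Longrightarrow>
      lam v z (g \<otimes>\<^bsub>vg v\<^esub> h) = lam v z g \<otimes>\<^bsub>M\<^esub> lam v (z + hv v g) h"
    and mu_incl: "\<lbrakk>e \<in> E; c \<in> carrier (eg e)\<rbrakk> \<Longrightarrow>
      mu e z \<otimes>\<^bsub>M\<^esub> lam (fin (e, True)) (z + hx e) (incl (e, True) c) =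
      lam (fin (e, False)) z (incl (e, False) c) \<otimes>\<^bsub>M\<^esub> mu e (z + hv (fin (e, False)) (incl (e, False) c))"
begin

text \<open>An edge crossed backwards from height \<open>z\<close> arrives at
  \<open>z - hx e\<close>, so its value is the inverse of the forward value that starts
  there.\<close>

definition mux :: "'e \<times> bool \<Rightarrow> int \<Rightarrow> 'm" where
  "mux x z = (if snd x then mu (fst x) z else inv\<^bsub>M\<^esub> (mu (fst x) (z - hx (fst x))))"

primrec rep :: "'v \<Rightarrow> int \<Rightarrow> ('e, 'a) gog_path \<Rightarrow> 'm" where
  "rep u z (Elt g) = lam u z g"
| "rep u z (Step g x p) =
    lam u z g \<otimes>\<^bsub>M\<^esub> (mux x (z + hv u g) \<otimes>\<^bsub>M\<^esub> rep (fin x) (z + hv u g + hxx x) p)"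

lemma mux_closed [simp]: "fst x \<in> E \<Longrightarrow> mux x z \<in> carrier M"
  by (simp add: mux_def mu_closed)

lemmas [simp] = lam_closed

lemma lam_one [simp]: "v \<in> V \<Longrightarrow> lam v z \<one>\<^bsub>vg v\<^esub> = \<one>\<^bsub>M\<^esub>"
  using lam_mult[of v "\<one>\<^bsub>vg v\<^esub>" "\<one>\<^bsub>vg v\<^esub>" z] by (simp add: hv_one monoid.one_closed monoid.l_one)

lemma mux_rev [simp]: "fst x \<in> E \<Longrightarrow> mux x z \<otimes>\<^bsub>M\<^esub> mux (rev_edge x) (z + hxx x) = \<one>\<^bsub>M\<^esub>"
  by (simp add: mux_def hxx_def rev_edge_def mu_closed)

lemma mux_incl:
  assumes "fst x \<in> E" "c \<in> carrier (eg (fst x))"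
  shows "mux x z \<otimes>\<^bsub>M\<^esub> lam (fin x) (z + hxx x) (incl x c) =
    lam (start x) z (incl (rev_edge x) c) \<otimes>\<^bsub>M\<^esub> mux x (z + hv (fin x) (incl x c))"
proof (cases x)
  case (Pair e b)
  have e: "e \<in> E" "c \<in> carrier (eg e)" using assms Pair by auto
  show ?thesis
  proof (cases b)
    case True
    then show ?thesis using Pair e mu_incl[OF e, of z] hv_incl[OF e]
      by (simp add: mux_def hxx_def rev_edge_def edge_start_def)
  next
    case False
    \<comment> \<open>The relation to be inverted is the one at the height where the reversed edge
      ends.\<close>
    define y where "y = z - hx e"
    let ?h = "hv (fin (e, False)) (incl (e, False) c)"
    have *: "mu e y \<otimes>\<^bsub>M\<^esub> lam (fin (e, True)) z (incl (e, True) c) =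
      lam (fin (e, False)) y (incl (e, False) c) \<otimes>\<^bsub>M\<^esub> mu e (y + ?h)"
      using mu_incl[OF e, of y] by (simp add: y_def)
    let ?t = "lam (fin (e, True)) z (incl (e, True) c)" and ?f = "lam (fin (e, False)) y (incl (e, False) c)"
    have cl: "mu e y \<in> carrier M" "mu e (y + ?h) \<in> carrier M" "?t \<in> carrier M" "?f \<in> carrier M"
      using e incl_closed[of "(e, True)" c] incl_closed[of "(e, False)" c] by (auto simp: mu_closed)
    have "inv\<^bsub>M\<^esub> (mu e y) \<otimes>\<^bsub>M\<^esub> ?f = ?t \<otimes>\<^bsub>M\<^esub> inv\<^bsub>M\<^esub> (mu e (y + ?h))"
      using * cl by (metis M.inv_closed M.inv_solve_left M.inv_solve_right M.m_assoc M.m_closed)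
    then show ?thesis using Pair False e hv_incl[OF e]
      by (simp add: mux_def hxx_def rev_edge_def edge_start_def y_def algebra_simps)
  qed
qed

lemma rep_closed [simp]: "path u p v \<Longrightarrow> rep u z p \<in> carrier M"
  by (induction p arbitrary: u z) auto

lemma rep_conc:
  "path u p w \<Longrightarrow> path w q v \<Longrightarrow> rep u z (conc w p q) = rep u z p \<otimes>\<^bsub>M\<^esub> rep w (z + hgt u p) q"
proof (induction p arbitrary: u z)
  case (Elt g)
  then show ?case by (cases q) (auto simp: lam_mult hv_mult M.m_assoc add.assoc)
next
  case (Step g x p)
  then have "path (fin x) p w" "u \<in> V" by auto
  then show ?case using Step by (simp add: M.m_assoc add.assoc)
qed

lemma rep_red: "gog_red \<G> u v p q \<Longrightarrow> rep u z p = rep u z q"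
proof (induction rule: gog_red.induct)
  case (1 x t K r s c)
  let ?s = "Step \<one>\<^bsub>vg t\<^esub> x (Step (incl x c) (rev_edge x) (Elt \<one>\<^bsub>vg t\<^esub>))"
    and ?e = "Elt (incl (rev_edge x) c)"
  have ty: "path t ?s t" "path t ?e t"
    using spur_path 1 by (simp_all del: gog_conc.simps)
  have h: "hgt t ?s = hgt t ?e" using 1 by (simp add: hv_incl_rev hv_one)
  let ?i = "hv (fin x) (incl x c)"
  have "rep t y ?s = rep t y ?e" for y
  proof -
    have "mux (rev_edge x) (y + hxx x + ?i) = mux (rev_edge x) ((y + ?i) + hxx x)"
      by (simp add: algebra_simps)
    then show ?thesis using 1 mux_incl[of x c y]
      by (simp add: M.m_assoc[symmetric] hv_one) (simp add: M.m_assoc)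
  qed
  then show ?case unfolding 1(3)
    by (simp only: rep_conc[OF 1(4) path_conc[OF ty(1) 1(5)]] rep_conc[OF 1(4) path_conc[OF ty(2) 1(5)]]
       rep_conc[OF ty(1) 1(5)] rep_conc[OF ty(2) 1(5)] h)
qed

lemma rep_eqv: "eqv u v p q \<Longrightarrow> rep u z p = rep u z q"
  by (induction rule: equivclp_induct) (auto, (metis rep_red)+)

text \<open>Equivariance under a height shift passes from generators to paths. With \<open>f\<close>
  the identity and \<open>k = N\<close> it yields the periodicity of lifts.\<close>

lemma rep_shift:
  assumes f: "f \<in> hom M M"
    and v: "\<And>v z g. v \<in> V \<Longrightarrow> g \<in> carrier (vg v) \<Longrightarrow> lam v (z + k) g = f (lam v z g)"
    and e: "\<And>e z. e \<in> E \<Longrightarrow> mu e (z + k) = f (mu e z)"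
  shows "path u p w \<Longrightarrow> rep u (z + k) p = f (rep u z p)"
proof (induction p arbitrary: u z)
  case (Elt g)
  then show ?case by (auto simp: v)
next
  case (Step g x p)
  interpret group_hom M M f by unfold_locales (rule f)
  have "mux x (y + k) = f (mux x y)" for y
    using e[of "fst x" y] e[of "fst x" "y - hx (fst x)"] Step.prems 
    by (simp add: mux_def hom_inv mu_closed algebra_simps)
  from this[of "z + hv u g"] show ?case 
    using Step.IH[of "fin x" "z + hv u g + hxx x"] Step.prems v[of u g z]
    by (auto simp: algebra_simps)
qed

end

section \<open>Heights and representations on the fundamental group\<close>

locale based_height = based_gog \<G> v0 + gog_height \<G> hv hx
  for \<G> :: "('v, 'e, 'a, 'b) gog" and v0 hv hx +
  assumes hgt_base_path: "v \<in> V \<Longrightarrow> hgt v0 (base_path v) = 0"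
begin

definition fhgt :: "('e, 'a) gog_path set \<Rightarrow> int" where
  "fhgt A = hgt v0 (SOME p. p \<in> A)"

lemma fhgt_cls: "fhgt (cls p) = hgt v0 p"
  using someI[of "\<lambda>q. q \<in> cls p" p] by (simp add: fhgt_def cls_def hgt_eqv[of v0 v0 p])

lemma hgt_back_path: 
  assumes "v \<in> V" shows "hgt v (back_path v) = 0"
proof -
  have "hgt v0 (conc v (base_path v) (back_path v)) = hgt v0 (Elt \<one>\<^bsub>vg v0\<^esub>)"
    using assms by (intro hgt_eqv[of v0 v0] conc_rev_path) simp
  then show ?thesis using assms by (simp add: hgt_conc[of _ _ _ _ v0] hgt_base_path hv_one)
qed

text \<open>Base paths and their reverses have height 0, so closing a path up to a loop does not
  change its height.\<close>

lemma fhgt_loop_cls: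
  assumes "path u p v"
  shows "fhgt (loop_cls u v p) = hgt u p"
proof -
  have "u \<in> V" "v \<in> V" using path_verts assms by auto
  then have ty: "path v0 (base_path u) u" "path v (back_path v) v0" by auto
  show ?thesis unfolding loop_cls_def fhgt_cls 
    using hgt_conc[OF ty(1) path_conc[OF assms ty(2)]] hgt_conc[OF assms ty(2)] \<open>u \<in> V\<close> \<open>v \<in> V\<close>
    by (simp add: hgt_base_path hgt_back_path)
qed

end

locale based_rep = based_height \<G> v0 hv hx + gog_rep \<G> hv hx M lam mu
  for \<G> :: "('v, 'e, 'a, 'b) gog" and v0 hv hx and M :: "'m monoid" and lam mu
begin

definition frep :: "int \<Rightarrow> ('e, 'a) gog_path set \<Rightarrow> 'm" where
  "frep z A = rep v0 z (SOME p. p \<in> A)"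

definition conjr :: "'v \<Rightarrow> int \<Rightarrow> 'm" where
  "conjr v z = rep v0 z (base_path v)"

lemma frep_cls: "frep z (cls p) = rep v0 z p"
  using someI[of "\<lambda>q. q \<in> cls p" p] by (simp add: frep_def cls_def rep_eqv[of v0 v0 p])

lemma frep_closed [simp]: "A \<in> carrier FG \<Longrightarrow> frep z A \<in> carrier M"
  by (auto simp: carrier_FG frep_cls)

lemma frep_mult: "A \<in> carrier FG \<Longrightarrow> B \<in> carrier FG \<Longrightarrow>
    frep z (A \<otimes>\<^bsub>FG\<^esub> B) = frep z A \<otimes>\<^bsub>M\<^esub> frep (z + fhgt A) B"
  by (auto simp: carrier_FG mult_cls fhgt_cls frep_cls rep_conc)

lemma conjr_closed [simp]: "v \<in> V \<Longrightarrow> conjr v z \<in> carrier M"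
  by (simp add: conjr_def rep_closed[of v0 _ v])

lemma conjr_base [simp]: "conjr v0 z = \<one>\<^bsub>M\<^esub>" by (simp add: conjr_def)

lemma rep_back_path:
  assumes "v \<in> V" shows "rep v z (back_path v) = inv\<^bsub>M\<^esub> (conjr v z)"
proof -
  have "rep v0 z (conc v (base_path v) (back_path v)) = rep v0 z (Elt \<one>\<^bsub>vg v0\<^esub>)"
    using assms by (intro rep_eqv[of v0 v0] conc_rev_path) simp
  then have "conjr v z \<otimes>\<^bsub>M\<^esub> rep v z (back_path v) = \<one>\<^bsub>M\<^esub>"
    using assms rep_conc[of v0 "base_path v" v "back_path v" v0 z] by (simp add: hgt_base_path conjr_def)
  then show ?thesis 
    using assms by (metis M.inv_equality M.inv_inv back_path conjr_closed rep_closed)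
qed

text \<open>Closing up along base paths changes \<open>rep\<close> only by the conjugators
  \<open>conjr\<close>; the second one is taken at the height where \<open>p\<close> ends.\<close>

lemma frep_loop_cls:
  assumes "path u p v"
  shows "frep z (loop_cls u v p) = conjr u z \<otimes>\<^bsub>M\<^esub> (rep u z p \<otimes>\<^bsub>M\<^esub> inv\<^bsub>M\<^esub> (conjr v (z + hgt u p)))"
proof -
  have V: "u \<in> V" "v \<in> V" using path_verts assms by auto
  then have ty: "path v0 (base_path u) u" "path v (back_path v) v0" by auto
  show ?thesis unfolding loop_cls_def frep_cls
    using rep_conc[OF ty(1) path_conc[OF assms ty(2)]] rep_conc[OF assms ty(2)] V
    by (simp add: hgt_base_path rep_back_path conjr_def[symmetric])
qed

end

section \<open>Derivations on free-by-\<open>\<int>\<close> groups\<close>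

definition word_cls :: "'x set \<Rightarrow> ('x \<times> bool) list \<Rightarrow> ('x \<times> bool) list set" where
  "word_cls S w = {w'. equivclp (word_red S) w w'}"

lemma word_red_lists: "word_red S v w \<Longrightarrow> v \<in> lists (S \<times> UNIV) \<and> w \<in> lists (S \<times> UNIV)"
  by (induction rule: word_red.induct) auto

lemma word_equiv_lists:
  "equivclp (word_red S) v w \<Longrightarrow> v \<in> lists (S \<times> UNIV) \<longleftrightarrow> w \<in> lists (S \<times> UNIV)"
  by (induction rule: equivclp_induct) (auto dest: word_red_lists)

lemma word_red_append:
  assumes "word_red S v w" "u \<in> lists (S \<times> UNIV)"
  shows "word_red S (v @ u) (w @ u)" "word_red S (u @ v) (u @ w)"
  using assms
proof (induction rule: word_red.induct)
  case (1 us vs x b)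
  {
    case 1
    then show ?case using word_red.intros[of us S "vs @ u" x b] \<open>us \<in> _\<close> \<open>vs \<in> _\<close> \<open>x \<in> S\<close> by simp
  next
    case 2
    then show ?case using word_red.intros[of "u @ us" S vs x b] \<open>us \<in> _\<close> \<open>vs \<in> _\<close> \<open>x \<in> S\<close> by simp
  }
qed

lemma word_equiv_append_right:
  "equivclp (word_red S) v w \<Longrightarrow> u \<in> lists (S \<times> UNIV) \<Longrightarrow> equivclp (word_red S) (v @ u) (w @ u)"
proof (induction rule: equivclp_induct)
  case (step y z)
  from step(2) have "equivclp (word_red S) (y @ u) (z @ u)"
  proof
    assume "word_red S y z"
    from word_red_append(1)[OF this step.prems] show ?thesis by (rule r_into_equivclp)
  next
    assume "word_red S z y"
    from word_red_append(1)[OF this step.prems] show ?thesis by (intro equivclp_sym[OF r_into_equivclp])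
  qed
  with step.IH[OF step.prems] show ?case by (rule equivclp_trans)
qed simp

lemma word_equiv_append_left:
  "equivclp (word_red S) v w \<Longrightarrow> u \<in> lists (S \<times> UNIV) \<Longrightarrow> equivclp (word_red S) (u @ v) (u @ w)"
proof (induction rule: equivclp_induct)
  case (step y z)
  from step(2) have "equivclp (word_red S) (u @ y) (u @ z)"
  proof
    assume "word_red S y z"
    from word_red_append(2)[OF this step.prems] show ?thesis by (rule r_into_equivclp)
  next
    assume "word_red S z y"
    from word_red_append(2)[OF this step.prems] show ?thesis by (intro equivclp_sym[OF r_into_equivclp])
  qed
  with step.IH[OF step.prems] show ?case by (rule equivclp_trans)
qed simp

lemma carrier_free_group: "carrier (free_group S) = word_cls S ` lists (S \<times> UNIV)"
  by (auto simp: free_group_def quotient_def word_cls_def)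

lemma mult_free_group:
  assumes "u \<in> lists (S \<times> UNIV)" "v \<in> lists (S \<times> UNIV)"
  shows "word_cls S u \<otimes>\<^bsub>free_group S\<^esub> word_cls S v = word_cls S (u @ v)"
proof -
  have "equivclp (word_red S) (u @ v) (u' @ v')"
    if "equivclp (word_red S) u u'" "equivclp (word_red S) v v'" for u' v'
  proof (rule equivclp_trans)
    show "equivclp (word_red S) (u @ v) (u' @ v)" by (rule word_equiv_append_right[OF that(1) assms(2)])
    show "equivclp (word_red S) (u' @ v) (u' @ v')"
      using word_equiv_append_left[OF that(2)] word_equiv_lists[OF that(1)] assms by blast
  qed
  note * = this
  show ?thesis
    unfolding free_group_def word_cls_def
    by (auto intro: equivclp_trans[OF *]) (blast intro: equivclp_refl)
qed

lemma one_free_group: "\<one>\<^bsub>free_group S\<^esub> = word_cls S []"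
  by (simp add: free_group_def word_cls_def)

lemma common_denominator:
  "finite A \<Longrightarrow> \<exists>N::int. N > 0 \<and> (\<forall>a\<in>A. of_int N * (a::rat) \<in> \<int>)"
proof (induction rule: finite_induct)
  case empty
  then show ?case by (intro exI[of _ 1]) simp
next
  case (insert a A)
  then obtain N :: int where N: "N > 0" "\<forall>a\<in>A. of_int N * a \<in> \<int>" by auto
  obtain p q where pq: "quotient_of a = (p, q)" by (cases "quotient_of a")
  then have q: "q > 0" "a = of_int p / of_int q" by (auto simp: quotient_of_denom_pos quotient_of_div)
  show ?case
  proof (intro exI[of _ "N * q"] conjI ballI)
    fix b assume "b \<in> insert a A"
    then consider "b = a" | "b \<in> A" by auto
    then show "of_int (N * q) * b \<in> \<int>"
    proof cases
      case 1
      then have "of_int (N * q) * b = of_int (N * p)" using q by simp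
      then show ?thesis by (metis Ints_of_int)
    next
      case 2
      have "of_int (N * q) * b = of_int q * (of_int N * b)" by simp
      then show ?thesis using N 2 by (metis Ints_mult Ints_of_int)
    qed
  qed (use N q in simp)
qed

text \<open>The integer \<open>m = N b\<close> is divisible by \<open>2 ^ |m|\<close>, which exceeds
  \<open>|m|\<close>, so it is 0.\<close>

lemma halving_imp_zero:
  fixes B :: "rat set"
  assumes "N > 0" "\<And>b. b \<in> B \<Longrightarrow> of_int N * b \<in> \<int>" "\<And>b. b \<in> B \<Longrightarrow> b / 2 \<in> B" "b \<in> B"
  shows "b = 0"
proof -
  have k: "b / 2 ^ k \<in> B" for k
  proof (induction k)
    case (Suc k)
    then show ?case using assms(3)[of "b / 2 ^ k"] by (simp add: field_simps)
  qed (use assms in simp)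
  obtain m :: int where m: "of_int N * b = of_int m" using assms(2)[OF assms(4)] by (auto elim: Ints_cases)
  obtain l :: int where "of_int N * (b / 2 ^ nat \<bar>m\<bar>) = of_int l" using assms(2)[OF k] by (auto elim: Ints_cases)
  then have "(of_int m :: rat) = of_int (l * 2 ^ nat \<bar>m\<bar>)" using m by (simp add: field_simps)
  then have l: "m = l * 2 ^ nat \<bar>m\<bar>" by (simp only: of_int_eq_iff)
  have "l = 0"
  proof (rule ccontr)
    assume "l \<noteq> 0"
    then have "2 ^ nat \<bar>m\<bar> \<le> \<bar>m\<bar>" by (subst (2) l) (simp add: abs_mult)
    moreover have "int (nat \<bar>m\<bar>) < int (2 ^ nat \<bar>m\<bar>)" by (simp only: of_nat_less_iff less_exp)
    ultimately show False by simp
  qed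
  then show ?thesis using l m assms(1) by simp
qed

text \<open>Exponent 0 describes products that start in \<open>F\<close>, exponent 1 left
  multiplication by the stable letter.\<close>

lemma auto_group_pow:
  assumes "\<alpha> \<in> auto F"
  shows "(\<alpha> [^]\<^bsub>AutoGroup F\<^esub> (0::int)) = (\<lambda>x\<in>carrier F. x)"
    and "x \<in> carrier F \<Longrightarrow> (\<alpha> [^]\<^bsub>AutoGroup F\<^esub> (1::int)) x = \<alpha> x"
proof -
  show "(\<alpha> [^]\<^bsub>AutoGroup F\<^esub> (0::int)) = (\<lambda>x\<in>carrier F. x)"
    by (simp add: int_pow_def nat_pow_def AutoGroup_def BijGroup_def)
  show "(\<alpha> [^]\<^bsub>AutoGroup F\<^esub> (1::int)) x = \<alpha> x" if "x \<in> carrier F"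
    using assms that id_Bij[of "carrier F"] Bij_imp_funcset[of \<alpha> "carrier F"]
    by (auto simp: int_pow_def nat_pow_def AutoGroup_def BijGroup_def auto_def compose_def)
qed

text \<open>\<open>\<phi>\<close> is the second coordinate and \<open>s\<close> the stable letter.
  Finite rank of \<open>F\<close> enters through the common denominator of the values on letters,
  surjectivity of \<open>\<alpha>\<close> through halving.\<close>

theorem free_by_Z_derivations:
  assumes "Group.group G" "free_by_Z G"
  obtains \<phi> :: "'a \<Rightarrow> int" and s where
    "\<And>x y. x \<in> carrier G \<Longrightarrow> y \<in> carrier G \<Longrightarrow> \<phi> (x \<otimes>\<^bsub>G\<^esub> y) = \<phi> x + \<phi> y"
    "s \<in> carrier G" "\<phi> s = 1"
    "\<And>(d :: 'a \<Rightarrow> rat) x. \<lbrakk>\<And>x y. x \<in> carrier G \<Longrightarrow> y \<in> carrier G \<Longrightarrow> d (x \<otimes>\<^bsub>G\<^esub> y) = d x + 2 powi \<phi> x * d y;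
       d s = 0; x \<in> carrier G\<rbrakk> \<Longrightarrow> d x = 0"
proof -
  obtain n :: nat and \<alpha> where \<alpha>: "\<alpha> \<in> auto (free_group {..<n})" and
    "G \<cong> semidirect_product (free_group {..<n}) integer_group
           (\<lambda>k :: int. \<alpha> [^]\<^bsub>AutoGroup (free_group {..<n})\<^esub> k)"
    using assms(2) by (auto simp: free_by_Z_def)
  define F where "F = free_group {..<n}"
  define S where "S = semidirect_product F integer_group (\<lambda>k :: int. \<alpha> [^]\<^bsub>AutoGroup F\<^esub> k)"
  have "G \<cong> S" using \<open>G \<cong> _\<close> by (simp add: S_def F_def)
  then obtain h where h: "h \<in> iso G S" by (auto simp: is_iso_def)
  define g where "g = inv_into (carrier G) h"
  have "g \<in> iso S G" using group.iso_set_sym[OF assms(1) h] by (simp add: g_def)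
  then have g_mult: "\<And>x y. x \<in> carrier S \<Longrightarrow> y \<in> carrier S \<Longrightarrow> g (x \<otimes>\<^bsub>S\<^esub> y) = g x \<otimes>\<^bsub>G\<^esub> g y"
    and g_closed: "\<And>x. x \<in> carrier S \<Longrightarrow> g x \<in> carrier G"
    by (auto simp: iso_def hom_def)
  have hg: "\<And>x. x \<in> carrier S \<Longrightarrow> h (g x) = x" and gh: "\<And>x. x \<in> carrier G \<Longrightarrow> g (h x) = x"
    using h by (auto simp: iso_def bij_betw_def g_def f_inv_into_f)
  have h_closed: "\<And>x. x \<in> carrier G \<Longrightarrow> h x \<in> carrier S" and
    h_mult: "\<And>x y. x \<in> carrier G \<Longrightarrow> y \<in> carrier G \<Longrightarrow> h (x \<otimes>\<^bsub>G\<^esub> y) = h x \<otimes>\<^bsub>S\<^esub> h y"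
    using h by (auto simp: iso_def hom_def)
  let ?o = "\<one>\<^bsub>F\<^esub>"
  let ?L = "lists ({..<n} \<times> (UNIV :: bool set))"
  have carS: "carrier S = carrier F \<times> UNIV" by (simp add: S_def semidirect_product_def)
  have mS: "(f, k) \<otimes>\<^bsub>S\<^esub> (f', l) = (f \<otimes>\<^bsub>F\<^esub> (\<alpha> [^]\<^bsub>AutoGroup F\<^esub> k) f', k + l)" for f k f' l
    by (simp add: S_def semidirect_product_def)
  have m0: "(f, 0) \<otimes>\<^bsub>S\<^esub> (f', l) = (f \<otimes>\<^bsub>F\<^esub> f', l)" if "f' \<in> carrier F" for f f' l
    using that auto_group_pow(1)[OF \<alpha>] by (simp add: mS F_def)
  have m1: "(f, 1) \<otimes>\<^bsub>S\<^esub> (f', l) = (f \<otimes>\<^bsub>F\<^esub> \<alpha> f', 1 + l)" if "f' \<in> carrier F" for f f' l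
    using that auto_group_pow(2)[OF \<alpha>] by (simp add: mS F_def)
  have carF: "carrier F = word_cls {..<n} ` ?L" by (simp add: F_def carrier_free_group)
  have oF: "?o \<in> carrier F" "?o = word_cls {..<n} []" by (auto simp: F_def carrier_free_group one_free_group)
  have lone: "?o \<otimes>\<^bsub>F\<^esub> f = f" and rone: "f \<otimes>\<^bsub>F\<^esub> ?o = f" if "f \<in> carrier F" for f
  proof -
    from that obtain w where w: "w \<in> ?L" "f = word_cls {..<n} w" unfolding carF by blast
    then show "?o \<otimes>\<^bsub>F\<^esub> f = f" "f \<otimes>\<^bsub>F\<^esub> ?o = f"
      using mult_free_group[of "[]" "{..<n}" w] mult_free_group[of w "{..<n}" "[]"]
      by (simp_all add: F_def one_free_group del: in_lists_conv_set)
  qed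
  have \<alpha>F: "\<alpha> f \<in> carrier F" if "f \<in> carrier F" for f
    using \<alpha> that by (auto simp: auto_def hom_def F_def)
  have \<alpha>surj: "\<exists>f'\<in>carrier F. f = \<alpha> f'" if "f \<in> carrier F" for f
    using \<alpha> that by (auto simp: auto_def Bij_def bij_betw_def F_def image_iff)
  show ?thesis
  proof (rule that[of "\<lambda>x. snd (h x)" "g (?o, 1)"])
    fix x y assume xy: "x \<in> carrier G" "y \<in> carrier G"
    show "snd (h (x \<otimes>\<^bsub>G\<^esub> y)) = snd (h x) + snd (h y)"
      by (cases "h x"; cases "h y") (simp add: h_mult xy mS)
  next
    show "g (?o, 1) \<in> carrier G" "snd (h (g (?o, 1))) = 1"
      using oF by (auto simp: carS hg intro!: g_closed)
  next
    fix d :: "'a \<Rightarrow> rat" and x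
    assume d: "\<And>x y. x \<in> carrier G \<Longrightarrow> y \<in> carrier G \<Longrightarrow> d (x \<otimes>\<^bsub>G\<^esub> y) = d x + 2 powi snd (h x) * d y"
      and ds: "d (g (?o, 1)) = 0" and x: "x \<in> carrier G"
    define D where "D f k = d (g (f, k))" for f k
    have D: "d (g ((f, k) \<otimes>\<^bsub>S\<^esub> (f', l))) = D f k + 2 powi k * D f' l"
      if "f \<in> carrier F" "f' \<in> carrier F" for f k f' l
      using that by (simp add: g_mult carS d g_closed D_def hg)
    have D0: "D (f \<otimes>\<^bsub>F\<^esub> f') k = D f 0 + D f' k" if "f \<in> carrier F" "f' \<in> carrier F" for f f' k
      using D[OF that, of 0 k] m0[OF that(2), of f k] by (simp add: D_def)
    \<comment> \<open>The stable letter contributes nothing itself, by \<open>ds\<close>, and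
      doubles what follows it.\<close>
    have D1: "D (\<alpha> f) (1 + k) = 2 * D f k" if "f \<in> carrier F" for f k
      using D[OF oF(1) that, of 1 k] m1[OF that, of ?o k] lone[OF \<alpha>F[OF that]] ds by (simp add: D_def)
    have Do: "D ?o 0 = 0" using D0[OF oF(1) oF(1), of 0] lone oF by simp
    have D\<alpha>: "D (\<alpha> f) 0 = 2 * D f 0" if "f \<in> carrier F" for f
    proof -
      have "D (\<alpha> f \<otimes>\<^bsub>F\<^esub> ?o) 1 = D (\<alpha> f) 0" using D0[OF \<alpha>F[OF that] oF(1), of 1] ds by (simp add: D_def)
      then show ?thesis using D1[OF that, of 0] rone[OF \<alpha>F[OF that]] by simp
    qed
    \<comment> \<open>On \<open>F\<close> the derivation is additive, so a denominator common to the
      single letters, inverse letters included, works for every word.\<close>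
    obtain N :: int where N: "N > 0" and NA: "\<And>a. a \<in> (\<lambda>l. D (word_cls {..<n} [l]) 0) ` ({..<n} \<times> UNIV) \<Longrightarrow> of_int N * a \<in> \<int>"
      using common_denominator[of "(\<lambda>l. D (word_cls {..<n} [l]) 0) ` ({..<n} \<times> (UNIV :: bool set))"] by auto
    have Nw: "of_int N * D (word_cls {..<n} w) 0 \<in> \<int>" if "w \<in> ?L" for w
      using that
    proof (induction w)
      case Nil
      then show ?case using Do oF by simp
    next
      case (Cons l w)
      have l: "word_cls {..<n} [l] \<in> carrier F" and w: "word_cls {..<n} w \<in> carrier F"
        using Cons.hyps by (auto simp: carF intro!: imageI)
      have "D (word_cls {..<n} (l # w)) 0 = D (word_cls {..<n} [l]) 0 + D (word_cls {..<n} w) 0"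
        using D0[OF l w, of 0] mult_free_group[of "[l]" "{..<n}" w] Cons.hyps by (simp add: F_def)
      then show ?case using NA[of "D (word_cls {..<n} [l]) 0"] Cons by (auto simp: distrib_left)
    qed
    have F0: "D f 0 = 0" if "f \<in> carrier F" for f
    proof (rule halving_imp_zero[of N "(\<lambda>f. D f 0) ` carrier F"])
      show "of_int N * b \<in> \<int>" if "b \<in> (\<lambda>f. D f 0) ` carrier F" for b
        using that Nw by (auto simp: carF)
      show "b / 2 \<in> (\<lambda>f. D f 0) ` carrier F" if "b \<in> (\<lambda>f. D f 0) ` carrier F" for b
      proof -
        from that obtain f where f: "f \<in> carrier F" "b = D f 0" by auto
        from \<alpha>surj[OF f(1)] obtain f' where "f' \<in> carrier F" "f = \<alpha> f'" by auto
        with f D\<alpha> show ?thesis by auto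
      qed
    qed (use that N in auto)
    \<comment> \<open>The element \<open>\<alpha> ?o\<close> is treated as any element of
      \<open>F\<close>: as a left factor it adds its value at exponent 0, which \<open>F0\<close>
      kills.\<close>
    have Dk: "D (\<alpha> ?o) k = D ?o k" for k
      using D0[OF \<alpha>F[OF oF(1)] oF(1), of k] rone[OF \<alpha>F[OF oF(1)]] F0[OF \<alpha>F[OF oF(1)]] by simp
    have Dstep: "D ?o (1 + k) = 2 * D ?o k" for k
      using D1[OF oF(1), of k] Dk by simp
    have "D ?o k = 0" for k
    proof (induction k rule: int_induct[of _ 0])
      case base
      then show ?case by (rule Do)
    next
      case (step1 i)
      then show ?case using Dstep[of i] by (simp add: add.commute)
    next
      case (step2 i)
      then show ?case using Dstep[of "i - 1"] by simp
    qed
    then have "D f k = 0" if "f \<in> carrier F" for f k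
      using D0[OF that oF(1), of k] rone[OF that] F0[OF that] by simp
    moreover have "h x \<in> carrier F \<times> UNIV" using h_closed[OF x] carS by simp
    ultimately show "d x = 0" using gh[OF x] by (metis D_def mem_Sigma_iff prod.collapse)
  qed
qed

section \<open>Homogeneous linear systems\<close>

text \<open>Elimination without matrices: two solutions of the other equations with different
  supports are combined so as to satisfy one more equation. The support condition keeps the
  combination nonzero.\<close>

lemma homogeneous_system_solvable:
  fixes L :: "'i \<Rightarrow> ('j \<Rightarrow> rat) \<Rightarrow> rat"
  assumes "finite I" "finite J" "card I < card J"
    and "\<And>i a x y. i \<in> I \<Longrightarrow> L i (\<lambda>j. a * x j + y j) = a * L i x + L i y"
  shows "\<exists>x. (\<exists>j\<in>J. x j \<noteq> 0) \<and> (\<forall>j. j \<notin> J \<longrightarrow> x j = 0) \<and> (\<forall>i\<in>I. L i x = 0)"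
  using assms
proof (induction I arbitrary: J rule: finite_induct)
  case empty
  then obtain j where "j \<in> J" by fastforce
  then show ?case by (intro exI[of _ "\<lambda>k. if k = j then 1 else 0"]) auto
next
  case (insert i I)
  have lin: "L k (\<lambda>j. a * x j + y j) = a * L k x + L k y" if "k \<in> insert i I" for k a x y
    using insert.prems(3) that by blast
  have IH: "\<exists>x. (\<exists>j\<in>J - {k}. x j \<noteq> 0) \<and> (\<forall>j. j \<notin> J - {k} \<longrightarrow> x j = 0) \<and> (\<forall>i\<in>I. L i x = 0)"
    if "k \<in> J" for k
    using that insert.prems insert.hyps lin by (intro insert.IH) (auto simp: card_Diff_singleton)
  obtain k where "k \<in> J" using insert.prems by fastforce
  from IH[OF this] obtain x l where x: "l \<in> J" "x l \<noteq> 0" "\<forall>j. j \<notin> J \<longrightarrow> x j = 0" "\<forall>i\<in>I. L i x = 0" by auto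
  \<comment> \<open>This second solution vanishes at \<open>l\<close>, where \<open>x\<close> does
    not, so adding a multiple of it leaves the entry \<open>x l\<close> intact.\<close>
  from IH[OF x(1)] obtain y where y: "\<exists>j\<in>J. y j \<noteq> 0" "\<forall>j. j \<notin> J - {l} \<longrightarrow> y j = 0" "\<forall>i\<in>I. L i y = 0" by auto
  show ?case
  proof (cases "L i y = 0")
    case True
    then show ?thesis using y by (intro exI[of _ y]) auto
  next
    case False
    define z where "z = (\<lambda>j. (- L i x / L i y) * y j + x j)"
    have "L k z = (- L i x / L i y) * L k y + L k x" if "k \<in> insert i I" for k
      unfolding z_def by (rule lin[OF that])
    then have "\<forall>k\<in>insert i I. L k z = 0" using False x y by auto
    moreover have "z l \<noteq> 0" "\<forall>j. j \<notin> J \<longrightarrow> z j = 0" using x y by (auto simp: z_def)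
    ultimately show ?thesis using x(1) by blast
  qed
qed

section \<open>Heights of the edge groups\<close>

locale phi_gog = based_gog \<G> v0 for \<G> :: "('v, 'e, 'a, 'b) gog" and v0 +
  fixes \<phi> :: "('e, 'a) gog_path set \<Rightarrow> int"
  assumes \<phi>_mult: "A \<in> carrier FG \<Longrightarrow> B \<in> carrier FG \<Longrightarrow> \<phi> (A \<otimes>\<^bsub>FG\<^esub> B) = \<phi> A + \<phi> B"
begin

definition hv :: "'v \<Rightarrow> 'a \<Rightarrow> int" where "hv v g = \<phi> (vcls v g)"
definition hx :: "'e \<Rightarrow> int" where "hx e = \<phi> (ecls (e, True))"

lemma \<phi>_one [simp]: "\<phi> \<one>\<^bsub>FG\<^esub> = 0"
  using \<phi>_mult[of "\<one>\<^bsub>FG\<^esub>" "\<one>\<^bsub>FG\<^esub>"] by simp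

lemma \<phi>_ecls_rev: "fst x \<in> E \<Longrightarrow> \<phi> (ecls (rev_edge x)) = - \<phi> (ecls x)"
  using arg_cong[OF ecls_rev[of x], of \<phi>] by (simp add: \<phi>_mult)

sublocale gog_height \<G> hv hx
proof
  fix v g h assume "v \<in> V" "g \<in> carrier (vg v)" "h \<in> carrier (vg v)"
  then show "hv v (g \<otimes>\<^bsub>vg v\<^esub> h) = hv v g + hv v h"
    by (simp add: hv_def vcls_mult \<phi>_mult)
next
  fix e c assume e: "e \<in> E" "c \<in> carrier (eg e)"
  define x where "x = (e, True)"
  have x: "fst x \<in> E" "c \<in> carrier (eg (fst x))" "incl x c \<in> carrier (vg (fin x))" "fin x \<in> V"
    using e incl_closed[of x c] by (auto simp: x_def)
  have "\<phi> (ecls x \<otimes>\<^bsub>FG\<^esub> (vcls (fin x) (incl x c) \<otimes>\<^bsub>FG\<^esub> ecls (rev_edge x))) = \<phi> (vcls (start x) (incl (rev_edge x) c))"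
    using ecls_relation[OF x(1,2)] by simp
  then have "\<phi> (vcls (fin x) (incl x c)) = \<phi> (vcls (start x) (incl (rev_edge x) c))"
    using x by (simp add: \<phi>_mult \<phi>_ecls_rev)
  then show "hv (fin (e, True)) (incl (e, True) c) = hv (fin (e, False)) (incl (e, False) c)"
    by (simp add: x_def hv_def rev_edge_def edge_start_def)
qed

lemmas [simp] = hv_one

lemma hxx_eq: "fst x \<in> E \<Longrightarrow> hxx x = \<phi> (ecls x)"
  using \<phi>_ecls_rev[of "(fst x, True)"] by (cases x) (auto simp: hxx_def hx_def rev_edge_def)

text \<open>As base paths represent the identity under \<open>loop_cls\<close>, this gives them
  height 0, which \<open>based_height\<close> demands.\<close>

lemma hgt_eq: "path u p v \<Longrightarrow> hgt u p = \<phi> (loop_cls u v p)"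
proof (induction p arbitrary: u)
  case (Elt g)
  then show ?case by (simp add: hv_def[symmetric] vcls_def[symmetric])
next
  case (Step g x p)
  then show ?case by (auto simp: loop_cls_Step[OF Step.prems] \<phi>_mult hxx_eq hv_def[symmetric])
qed

sublocale based_height \<G> v0 hv hx
  by unfold_locales (simp add: hgt_eq[OF base_path] loop_cls_base_path)

lemma fhgt_eq: "A \<in> carrier FG \<Longrightarrow> fhgt A = \<phi> A"
  using hgt_eq fhgt_loop_cls carrier_FG_loop_cls by metis

end

definition rat_group :: "rat monoid" where
  "rat_group = \<lparr>carrier = UNIV, monoid.mult = (+), one = 0\<rparr>"

lemma rat_group_simps [simp]:
  "carrier rat_group = UNIV" "x \<otimes>\<^bsub>rat_group\<^esub> y = x + y" "\<one>\<^bsub>rat_group\<^esub> = 0"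
  by (simp_all add: rat_group_def)

lemma group_rat_group [simp]: "Group.group rat_group"
  by (rule groupI) (auto simp: add.assoc intro: exI[of _ "- _"])

lemma inv_rat_group [simp]: "inv\<^bsub>rat_group\<^esub> x = - x"
  by (rule group.inv_equality) auto

lemma two_powi_add: "(2 :: rat) powi (a + b) = 2 powi a * 2 powi b"
  by (simp add: power_int_add)

text \<open>Guarantees that the factor \<open>2 powi h - 1\<close> of an inner derivation is nonzero
  at nonzero height.\<close>

lemma two_powi_eq_one: "(2 :: rat) powi a = 1 \<longleftrightarrow> a = 0"
proof -
  have *: "(2 :: rat) ^ n = 1 \<longleftrightarrow> n = 0" for n
    using one_less_power[of "2 :: rat" n] by (cases n) auto
  show ?thesis by (auto simp: power_int_def * power_inverse power_one_over)
qed

section \<open>Derivations as solutions of a linear system\<close>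

locale Z2_gog = phi_gog \<G> v0 \<phi> for \<G> :: "('v, 'e, 'a, 'b) gog" and v0 \<phi> +
  assumes finite_V: "finite V" and finite_E: "finite E"
    and vg_iso: "v \<in> V \<Longrightarrow> vg v \<cong> integer_group \<times>\<times> integer_group"
    and eg_iso: "e \<in> E \<Longrightarrow> eg e \<cong> integer_group"
begin

definition co :: "'v \<Rightarrow> 'a \<Rightarrow> int \<times> int" where
  "co v = (SOME f. f \<in> iso (vg v) (integer_group \<times>\<times> integer_group))"

definition ie :: "'e \<Rightarrow> int \<Rightarrow> 'b" where
  "ie e = (SOME f. f \<in> iso integer_group (eg e))"

lemma co_iso: "v \<in> V \<Longrightarrow> co v \<in> iso (vg v) (integer_group \<times>\<times> integer_group)"
  unfolding co_def using vg_iso[of v] by (metis is_iso_def some_in_eq)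

lemma ie_iso: "e \<in> E \<Longrightarrow> ie e \<in> iso integer_group (eg e)"
  unfolding ie_def using group.iso_sym[OF group_edge_group eg_iso, of e] by (metis is_iso_def some_in_eq)

lemma co_mult:
  assumes "v \<in> V" "g \<in> carrier (vg v)" "h \<in> carrier (vg v)"
  shows "co v (g \<otimes>\<^bsub>vg v\<^esub> h) = (fst (co v g) + fst (co v h), snd (co v g) + snd (co v h))"
  using co_iso[OF assms(1)] assms(2,3) by (simp add: iso_def hom_def mult_DirProd')

lemma co_bij: "v \<in> V \<Longrightarrow> bij_betw (co v) (carrier (vg v)) UNIV"
  using co_iso[of v] by (simp add: iso_def)

lemma vg_comm: "v \<in> V \<Longrightarrow> g \<in> carrier (vg v) \<Longrightarrow> h \<in> carrier (vg v) \<Longrightarrow>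
    g \<otimes>\<^bsub>vg v\<^esub> h = h \<otimes>\<^bsub>vg v\<^esub> g"
proof -
  assume v: "v \<in> V" "g \<in> carrier (vg v)" "h \<in> carrier (vg v)"
  have "co v (g \<otimes>\<^bsub>vg v\<^esub> h) = co v (h \<otimes>\<^bsub>vg v\<^esub> g)" using v by (simp add: co_mult)
  then show ?thesis using co_bij[OF v(1)] v monoid.m_closed[OF vmonoid] by (metis bij_betw_inv_into_left)
qed

lemma ie_add: "e \<in> E \<Longrightarrow> ie e (k + l) = ie e k \<otimes>\<^bsub>eg e\<^esub> ie e l"
  using ie_iso[of e] by (simp add: iso_def hom_def)

lemma ie_bij: "e \<in> E \<Longrightarrow> bij_betw (ie e) UNIV (carrier (eg e))"
  using ie_iso[of e] by (simp add: iso_def)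

lemma ie_closed [simp]: "e \<in> E \<Longrightarrow> ie e k \<in> carrier (eg e)"
  using ie_bij[of e] by (auto simp: bij_betw_def)

definition flat :: "'v \<Rightarrow> bool" where
  "flat v \<longleftrightarrow> (\<forall>g\<in>carrier (vg v). hv v g = 0)"

text \<open>
  A vector \<open>x\<close> of unknowns prescribes a derivation on each vertex group: on a flat one the two values
  on a basis are free, on any other one the derivation is inner and has one parameter. \<open>edge_defect\<close>
  measures the failure of the relation of an edge.
\<close>

definition dv :: "('v \<times> bool + 'e \<Rightarrow> rat) \<Rightarrow> 'v \<Rightarrow> 'a \<Rightarrow> rat" where
  "dv x v g = (if flat v then of_int (fst (co v g)) * x (Inl (v, True)) + of_int (snd (co v g)) * x (Inl (v, False))
     else (2 powi hv v g - 1) * x (Inl (v, True)))"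

text \<open>The value on a reversed edge is dictated by the derivation rule for \<open>x\<close>
  followed by its reverse, where the total is 0.\<close>

definition edv :: "('v \<times> bool + 'e \<Rightarrow> rat) \<Rightarrow> 'e \<times> bool \<Rightarrow> rat" where
  "edv x y = (if snd y then x (Inr (fst y)) else - (2 powi (- hx (fst y)) * x (Inr (fst y))))"

primrec pdv :: "('v \<times> bool + 'e \<Rightarrow> rat) \<Rightarrow> 'v \<Rightarrow> ('e, 'a) gog_path \<Rightarrow> rat" where
  "pdv x u (Elt g) = dv x u g"
| "pdv x u (Step g y p) = dv x u g + 2 powi hv u g * (edv x y + 2 powi hxx y * pdv x (fin y) p)"

definition edge_defect :: "('v \<times> bool + 'e \<Rightarrow> rat) \<Rightarrow> 'e \<Rightarrow> 'b \<Rightarrow> rat" where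
  "edge_defect x e c = (1 - 2 powi hv (fin (e, True)) (incl (e, True) c)) * x (Inr e)
     + 2 powi hx e * dv x (fin (e, True)) (incl (e, True) c) - dv x (fin (e, False)) (incl (e, False) c)"

lemma dv_linear: "dv (\<lambda>j. a * x j + y j) v g = a * dv x v g + dv y v g"
  by (simp add: dv_def algebra_simps)

lemma pdv_linear: "pdv (\<lambda>j. a * x j + y j) u p = a * pdv x u p + pdv y u p"
proof (induction p arbitrary: u)
  case (Elt g)
  then show ?case by (simp only: pdv.simps dv_linear)
next
  case (Step g z p)
  have "edv (\<lambda>j. a * x j + y j) z = a * edv x z + edv y z" by (simp add: edv_def algebra_simps)
  then show ?case unfolding pdv.simps dv_linear Step.IH by (simp only: algebra_simps)
qed

lemma edge_defect_linear: "edge_defect (\<lambda>j. a * x j + y j) e c = a * edge_defect x e c + edge_defect y e c"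
  unfolding edge_defect_def dv_linear by (simp only: algebra_simps)

lemma dv_mult:
  assumes "v \<in> V" "g \<in> carrier (vg v)" "h \<in> carrier (vg v)"
  shows "dv x v (g \<otimes>\<^bsub>vg v\<^esub> h) = dv x v g + 2 powi hv v g * dv x v h"
proof (cases "flat v")
  case True
  then have "hv v g = 0" using assms by (simp add: flat_def)
  then show ?thesis using True assms by (simp add: dv_def co_mult algebra_simps)
next
  case False
  then show ?thesis using assms by (simp add: dv_def hv_mult two_powi_add algebra_simps)
qed

text \<open>The defect at \<open>c\<close> is the derivation of "edge, then image of
  \<open>c\<close> at its head" minus that of "image of \<open>c\<close> at its tail, then edge". As
  a function of \<open>c\<close> it is again a derivation.\<close>

lemma edge_defect_mult:
  assumes "e \<in> E" "c \<in> carrier (eg e)" "c' \<in> carrier (eg e)"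
  shows "edge_defect x e (c \<otimes>\<^bsub>eg e\<^esub> c') =
    edge_defect x e c + 2 powi hv (fin (e, True)) (incl (e, True) c) * edge_defect x e c'"
proof -
  have m: "incl (e, b) (c \<otimes>\<^bsub>eg e\<^esub> c') = incl (e, b) c \<otimes>\<^bsub>vg (fin (e, b))\<^esub> incl (e, b) c'" for b
    using hom_mult[OF incl_hom[of "(e, b)"]] assms by simp
  have c: "fin (e, b) \<in> V" "incl (e, b) c \<in> carrier (vg (fin (e, b)))" "incl (e, b) c' \<in> carrier (vg (fin (e, b)))" for b
    using assms incl_closed[of "(e, b)"] fin_in_verts[of "(e, b)"] by auto
  show ?thesis unfolding edge_defect_def m dv_mult[OF c] hv_mult[OF c] two_powi_add
      hv_incl[OF assms(1,2), symmetric]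
    by (simp add: algebra_simps)
qed

text \<open>A derivation on a cyclic group that vanishes at a generator is 0, so a single equation
  accounts for the whole edge group.\<close>

lemma edge_defect_zero:
  assumes "e \<in> E" "edge_defect x e (ie e 1) = 0" "c \<in> carrier (eg e)"
  shows "edge_defect x e c = 0"
proof -
  let ?f = "\<lambda>k. edge_defect x e (ie e k)"
  let ?h = "\<lambda>k. hv (fin (e, True)) (incl (e, True) (ie e k))"
  have f: "?f (k + l) = ?f k + 2 powi ?h k * ?f l" for k l
    using assms by (simp add: ie_add edge_defect_mult)
  have f0: "?f 0 = 0" using f[of 1 0] assms(2) by simp
  have "?f k = 0" for k
  proof (induction k rule: int_induct[of _ 0])
    case base
    then show ?case by (rule f0)
  next
    case (step1 i)
    then show ?case using f[of i 1] assms(2) by simp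
  next
    case (step2 i)
    then show ?case using f[of 1 "i - 1"] assms(2) by simp
  qed
  then show ?thesis using ie_bij[OF assms(1)] assms(3) by (metis bij_betw_inv_into_right)
qed

text \<open>The count produces a nonzero vector of unknowns satisfying all equations,
  \<open>der\<close> makes the derivation it defines vanish, and each unknown can be recovered from
  values of that derivation.\<close>

theorem edge_height_nonzero:
  assumes s: "s \<in> carrier FG" "\<phi> s = 1"
    and der: "\<And>(d :: _ \<Rightarrow> rat) x. \<lbrakk>\<And>x y. x \<in> carrier FG \<Longrightarrow> y \<in> carrier FG \<Longrightarrow> d (x \<otimes>\<^bsub>FG\<^esub> y) = d x + 2 powi \<phi> x * d y;
       d s = 0; x \<in> carrier FG\<rbrakk> \<Longrightarrow> d x = 0"
    and e0: "e0 \<in> E"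
  shows "hv (fin (e0, True)) (incl (e0, True) (ie e0 1)) \<noteq> 0"
proof
  assume zero: "hv (fin (e0, True)) (incl (e0, True) (ie e0 1)) = 0"
  obtain ps where ps: "path v0 ps v0" "s = cls ps" using s(1) by (auto simp: carrier_FG)
  define W where "W = {v\<in>V. flat v}"
  \<comment> \<open>One unknown must be in excess. A flat vertex supplies a second parameter; if
    there is none, the equation of \<open>e0\<close> holds by itself and is dropped.\<close>
  define E' where "E' = (if W = {} then E - {e0} else E)"
  define J where "J = (Inl ` (V \<times> {True} \<union> W \<times> {False}) \<union> Inr ` E :: ('v \<times> bool + 'e) set)"
  define I where "I = (Inl ` V \<union> Inr ` E' :: ('v + 'e) set)"
  define L where "L i x = (case i of Inl v \<Rightarrow> pdv x v0 (if v = v0 then ps else base_path v)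
      | Inr e \<Rightarrow> edge_defect x e (ie e 1))" for i :: "'v + 'e" and x
  have fins: "finite W" "finite E'" "finite I" "finite J"
    using finite_V finite_E by (auto simp: W_def E'_def I_def J_def)
  have "card J = card (V \<times> {True} \<union> W \<times> {False}) + card E"
    unfolding J_def using finite_V finite_E fins(1)
    by (subst card_Un_disjoint) (auto simp: card_image)
  also have "card (V \<times> {True} \<union> W \<times> {False}) = card V + card W"
    using finite_V fins(1) by (subst card_Un_disjoint) (auto simp: card_cartesian_product)
  finally have cJ: "card J = card V + card W + card E" .
  have cI: "card I = card V + card E'"
    unfolding I_def using finite_V fins(2) by (subst card_Un_disjoint) (auto simp: card_image)
  have "card E' < card W + card E"
  proof (cases "W = {}")
    case True
    then show ?thesis using card_Diff1_less[OF finite_E e0] by (simp add: E'_def)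
  next
    case False
    then have "card W > 0" using fins(1) by (simp add: card_gt_0_iff)
    then show ?thesis using False by (simp add: E'_def)
  qed
  then have "card I < card J" using cI cJ by simp
  moreover have "L i (\<lambda>j. a * x j + y j) = a * L i x + L i y" for i a x y
    unfolding L_def by (cases i) (simp_all only: sum.case pdv_linear edge_defect_linear)
  ultimately obtain x where x: "\<exists>j\<in>J. x j \<noteq> 0" "\<And>i. i \<in> I \<Longrightarrow> L i x = 0"
    using homogeneous_system_solvable[OF fins(3,4), of L] by blast
  have defect: "edge_defect x e c = 0" if e: "e \<in> E" and "c \<in> carrier (eg e)" for e c
  proof (rule edge_defect_zero[OF e _ that(2)])
    show "edge_defect x e (ie e 1) = 0"
    proof (cases "e \<in> E'")
      case True
      then show ?thesis using x(2)[of "Inr e"] by (auto simp: I_def L_def)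
    next
      case False
      then have [simp]: "e = e0" and "W = {}" using e by (auto simp: E'_def split: if_splits)
      then have "\<not> flat (fin (e0, b))" for b using fin_in_verts[of "(e0, b)"] e0 by (auto simp: W_def)
      \<comment> \<open>Both end groups carry inner derivations, so every term of the defect has a
        factor \<open>1 - 2 powi 0\<close> up to sign.\<close>
      then show ?thesis using zero hv_incl[OF e0 ie_closed[OF e0], of 1] by (simp add: edge_defect_def dv_def)
    qed
  qed
  define lam where "lam v z g = 2 powi z * dv x v g" for v z g
  define mu where "mu e z = 2 powi z * x (Inr e)" for e z
  interpret rat: Group.group rat_group by simp
  interpret r: based_rep \<G> v0 hv hx rat_group lam mu
  proof
    fix v g h z assume "v \<in> V" "g \<in> carrier (vg v)" "h \<in> carrier (vg v)"
    then show "lam v z (g \<otimes>\<^bsub>vg v\<^esub> h) = lam v z g \<otimes>\<^bsub>rat_group\<^esub> lam v (z + hv v g) h"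
      by (simp add: lam_def dv_mult two_powi_add algebra_simps)
  next
    fix e c z assume e: "e \<in> E" "c \<in> carrier (eg e)"
    have "2 powi z * edge_defect x e c = 0" using defect[OF e] by simp
    then show "mu e z \<otimes>\<^bsub>rat_group\<^esub> lam (fin (e, True)) (z + hx e) (incl (e, True) c) =
       lam (fin (e, False)) z (incl (e, False) c) \<otimes>\<^bsub>rat_group\<^esub> mu e (z + hv (fin (e, False)) (incl (e, False) c))"
      using hv_incl[OF e]
      by (simp add: lam_def mu_def edge_defect_def two_powi_add algebra_simps)
  qed simp_all
  have mux: "r.mux y z = 2 powi z * edv x y" for y z
    by (simp add: r.mux_def edv_def mu_def two_powi_add power_int_diff power_int_minus divide_simps)
  have rep: "r.rep u z p = 2 powi z * pdv x u p" for u z p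
    by (induction p arbitrary: u z) (simp_all add: lam_def mux two_powi_add algebra_simps)
  define d where "d A = r.frep 0 A" for A
  have d: "d A = 0" if "A \<in> carrier FG" for A
  proof (rule der[OF _ _ that])
    show "d s = 0" using ps x(2)[of "Inl v0"] by (simp add: d_def r.frep_cls rep I_def L_def)
  next
    fix A B assume AB: "A \<in> carrier FG" "B \<in> carrier FG"
    have "r.frep (\<phi> A) B = 2 powi \<phi> A * r.frep 0 B"
      by (simp add: r.frep_def rep)
    then show "d (A \<otimes>\<^bsub>FG\<^esub> B) = d A + 2 powi \<phi> A * d B"
      using AB by (simp add: d_def r.frep_mult fhgt_eq)
  qed
  have pdv1: "dv x v \<one>\<^bsub>vg v\<^esub> = 0" if "v \<in> V" for v
    using dv_mult[of v "\<one>\<^bsub>vg v\<^esub>" "\<one>\<^bsub>vg v\<^esub>" x] that by (simp add: monoid.one_closed monoid.l_one)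
  \<comment> \<open>The vertex equations say precisely that base paths have value 0; hence vanishing
    on loops at \<open>v0\<close> extends to arbitrary paths in \<open>loop0\<close>.\<close>
  have conj0: "r.conjr v z = 0" if "v \<in> V" for v z
    using that x(2)[of "Inl v"] r.conjr_base[of z]
    by (cases "v = v0") (auto simp: r.conjr_def rep I_def L_def simp del: base_path_base)
  have loop0: "pdv x u p = 0" if "path u p v" for u p v
    using d[OF loop_cls_closed[OF that]] path_verts[OF that]
    by (simp add: d_def r.frep_loop_cls[OF that] conj0 rep)
  have dv0: "dv x v g = 0" if "v \<in> V" "g \<in> carrier (vg v)" for v g
    using loop0[OF path_Elt[OF that]] by simp
  have edv0: "x (Inr e) = 0" if "e \<in> E" for e
    using loop0[OF path_edge_path[of "(e, True)"]] that
    by (simp add: edge_path_def pdv1 edv_def)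
  have v0: "x (Inl (v, True)) = 0" "flat v \<Longrightarrow> x (Inl (v, False)) = 0" if "v \<in> V" for v
  proof -
    have ex: "\<exists>g\<in>carrier (vg v). co v g = k" for k
      using co_bij[OF that] by (metis UNIV_I bij_betw_iff_bijections)
    obtain g h where "g \<in> carrier (vg v)" "co v g = (1, 0)" "h \<in> carrier (vg v)" "co v h = (0, 1)"
      using ex by meson
    then have fl: "flat v \<Longrightarrow> x (Inl (v, True)) = 0 \<and> x (Inl (v, False)) = 0"
      using dv0[OF that, of g] dv0[OF that, of h] by (auto simp: dv_def)
    then show "flat v \<Longrightarrow> x (Inl (v, False)) = 0" by simp
    show "x (Inl (v, True)) = 0"
    proof (cases "flat v")
      case False
      then obtain k where "k \<in> carrier (vg v)" "hv v k \<noteq> 0" by (auto simp: flat_def)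
      then show ?thesis using dv0[OF that, of k] False two_powi_eq_one[of "hv v k"] by (auto simp: dv_def)
    qed (use fl in simp)
  qed
  show False using x(1) v0 edv0 by (auto simp: J_def W_def)
qed

end

section \<open>The covering graph of groups\<close>

text \<open>The generator is the least positive element; a remainder modulo it stays in
  \<open>S\<close> and must be 0.\<close>

lemma int_subgroup_principal:
  fixes S :: "int set"
  assumes "m \<in> S" "m > 0" "\<And>x y. x \<in> S \<Longrightarrow> y \<in> S \<Longrightarrow> x - y \<in> S"
  obtains p where "p > 0" "\<And>x. x \<in> S \<longleftrightarrow> p dvd x"
proof -
  define n where "n = (LEAST n::nat. n > 0 \<and> int n \<in> S)"
  have n: "n > 0" "int n \<in> S"
    using LeastI[of "\<lambda>n::nat. n > 0 \<and> int n \<in> S" "nat m"] assms by (auto simp: n_def)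
  have min: "k \<ge> n" if "k > 0" "int k \<in> S" for k
    unfolding n_def using that by (intro Least_le) simp
  have z: "0 \<in> S" using assms(3)[OF n(2) n(2)] by simp
  have neg: "- x \<in> S" if "x \<in> S" for x using assms(3)[OF z that] by simp
  have add: "x + y \<in> S" if "x \<in> S" "y \<in> S" for x y using assms(3)[OF that(1) neg[OF that(2)]] by simp
  have mult_nat: "int n * int k \<in> S" for k
    by (induction k) (auto simp: z distrib_left intro: add n)
  have mult: "int n * k \<in> S" for k
    using mult_nat[of "nat k"] neg[OF mult_nat[of "nat (- k)"]] by (cases "k \<ge> 0") auto
  have "int n dvd x" if "x \<in> S" for x
  proof (rule ccontr)
    assume "\<not> int n dvd x"
    then have "x mod int n \<noteq> 0" by (simp add: dvd_eq_mod_eq_0)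
    moreover have "x mod int n \<ge> 0" using n by simp
    ultimately have "x mod int n > 0" by linarith
    moreover have "x mod int n \<in> S" using assms(3)[OF that mult[of "x div int n"]] by (simp add: minus_mult_div_eq_mod)
    ultimately have "int n \<le> x mod int n" using min[of "nat (x mod int n)"] by (simp add: le_nat_iff)
    moreover have "x mod int n < int n" using n by simp
    ultimately show False by simp
  qed
  then show ?thesis using that[of "int n"] n mult by (auto simp: dvd_def)
qed

text \<open>A triangular basis \<open>(p, j)\<close>, \<open>(0, q)\<close> of a sublattice of
  finite index: \<open>p\<close> generates its projection to the first coordinate and
  \<open>q\<close> its intersection with the second axis. Subtracting \<open>s\<close> times the
  first vector moves a lattice point onto that axis.\<close>

lemma lattice_basis:
  fixes a b N :: int
  assumes "N > 0"
  obtains p j q where "p > 0" "q > 0"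
    "\<And>x y. N dvd a * x + b * y \<longleftrightarrow> (\<exists>s t. x = p * s \<and> y = j * s + q * t)"
proof -
  define S where "S = {x. \<exists>y. N dvd a * x + b * y}"
  obtain p where p: "p > 0" "\<And>x. x \<in> S \<longleftrightarrow> p dvd x"
  proof (rule int_subgroup_principal[of N S])
    show "N \<in> S" by (auto simp: S_def intro: exI[of _ 0])
    show "x - y \<in> S" if xy: "x \<in> S" "y \<in> S" for x y
    proof -
      obtain k l where "N dvd a * x + b * k" "N dvd a * y + b * l" using xy by (auto simp: S_def)
      from dvd_diff[OF this] show ?thesis by (auto simp: S_def algebra_simps intro!: exI[of _ "k - l"])
    qed
  qed (use assms in auto)
  obtain q where q: "q > 0" "\<And>y. N dvd b * y \<longleftrightarrow> q dvd y"
  proof (rule int_subgroup_principal[of N "{y. N dvd b * y}"])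
    show "x - y \<in> {y. N dvd b * y}" if "x \<in> {y. N dvd b * y}" "y \<in> {y. N dvd b * y}" for x y
      using that by (auto simp: right_diff_distrib)
  qed (use assms in auto)
  from p(2)[of p] obtain j where j: "N dvd a * p + b * j" by (auto simp: S_def)
  have "N dvd a * x + b * y \<longleftrightarrow> (\<exists>s t. x = p * s \<and> y = j * s + q * t)" for x y
  proof
    assume xy: "N dvd a * x + b * y"
    then have "x \<in> S" by (auto simp: S_def)
    then obtain s where s: "x = p * s" using p(2) by (auto elim: dvdE)
    have "a * x + b * y - s * (a * p + b * j) = b * (y - j * s)" using s by (simp add: algebra_simps)
    then have "N dvd b * (y - j * s)" using dvd_diff[OF xy dvd_mult[OF j, of s]] by simp
    then obtain t where "y - j * s = q * t" using q(2) by (auto elim: dvdE)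
    then show "\<exists>s t. x = p * s \<and> y = j * s + q * t" using s by (intro exI[of _ s] exI[of _ t]) simp
  next
    assume "\<exists>s t. x = p * s \<and> y = j * s + q * t"
    then obtain s t where st: "x = p * s" "y = j * s + q * t" by auto
    have "a * x + b * y = s * (a * p + b * j) + b * (q * t)" using st by (simp add: algebra_simps)
    moreover have "N dvd b * (q * t)" using q(2)[of "q * t"] by simp
    ultimately show "N dvd a * x + b * y" using j by simp
  qed
  with p q that show ?thesis by blast
qed

text \<open>Since \<open>N\<close> is positive, \<open>eps_dvd\<close> also makes the heights of
  edge generators nonzero. Surjectivity of \<open>\<phi>\<close> will make the covering
  connected.\<close>

locale cover_gog = Z2_gog \<G> v0 \<phi> for \<G> :: "('v, 'e, 'a, 'b) gog" and v0 \<phi> +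
  fixes N :: int
  assumes N_pos: "N > 0"
    and eps_dvd: "e \<in> E \<Longrightarrow> hv (fin (e, True)) (incl (e, True) (ie e 1)) dvd N"
    and \<phi>_surj: "\<exists>s\<in>carrier FG. \<phi> s = 1"
begin

abbreviation "src e \<equiv> fin (e, False)"
abbreviation "tgt e \<equiv> fin (e, True)"
abbreviation "isrc e \<equiv> incl (e, False)"
abbreviation "itgt e \<equiv> incl (e, True)"

text \<open>Both ends of an edge give the same height by \<open>hv_incl\<close>; the one at the head
  is taken.\<close>

definition eh :: "'e \<Rightarrow> 'b \<Rightarrow> int" where "eh e c = hv (tgt e) (itgt e c)"
definition eps :: "'e \<Rightarrow> int" where "eps e = eh e (ie e 1)"

lemma src_tgt [simp]: "e \<in> E \<Longrightarrow> src e \<in> V" "e \<in> E \<Longrightarrow> tgt e \<in> V"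
  by simp_all

lemma isrc_closed [simp]: "e \<in> E \<Longrightarrow> c \<in> carrier (eg e) \<Longrightarrow> isrc e c \<in> carrier (vg (src e))"
  and itgt_closed [simp]: "e \<in> E \<Longrightarrow> c \<in> carrier (eg e) \<Longrightarrow> itgt e c \<in> carrier (vg (tgt e))"
  using incl_closed[of "(e, False)" c] incl_closed[of "(e, True)" c] by auto

lemma incl_mult: "e \<in> E \<Longrightarrow> c \<in> carrier (eg e) \<Longrightarrow> d \<in> carrier (eg e) \<Longrightarrow>
   incl (e, b) (c \<otimes>\<^bsub>eg e\<^esub> d) = incl (e, b) c \<otimes>\<^bsub>vg (fin (e, b))\<^esub> incl (e, b) d"
  using hom_mult[OF incl_hom[of "(e, b)"]] by simp

lemma eh_src: "e \<in> E \<Longrightarrow> c \<in> carrier (eg e) \<Longrightarrow> hv (src e) (isrc e c) = eh e c"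
  by (simp add: eh_def hv_incl)

lemma eg_group [simp]: "e \<in> E \<Longrightarrow> Group.group (eg e)" by (rule group_edge_group)

lemma eh_mult: "e \<in> E \<Longrightarrow> c \<in> carrier (eg e) \<Longrightarrow> d \<in> carrier (eg e) \<Longrightarrow>
   eh e (c \<otimes>\<^bsub>eg e\<^esub> d) = eh e c + eh e d"
  by (simp add: eh_def incl_mult hv_mult)

lemma eh_ie: "e \<in> E \<Longrightarrow> eh e (ie e k) = k * eps e"
proof (induction k rule: int_induct[of _ 0])
  case base
  then show ?case using eh_mult[of e "ie e 0" "ie e 0"] ie_add[of e 0 0] by simp
next
  case (step1 i)
  then show ?case by (simp add: ie_add eh_mult eps_def[symmetric] algebra_simps)
next
  case (step2 i)
  then show ?case using eh_mult[of e "ie e (i - 1)" "ie e 1"] ie_add[of e "i - 1" 1]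
    by (simp add: eps_def[symmetric] algebra_simps)
qed

lemma eps: "e \<in> E \<Longrightarrow> eps e dvd N" "e \<in> E \<Longrightarrow> eps e \<noteq> 0"
  using eps_dvd[of e] N_pos by (auto simp: eps_def eh_def)

lemma eh_one [simp]: "e \<in> E \<Longrightarrow> eh e \<one>\<^bsub>eg e\<^esub> = 0"
  using eh_mult[of e "\<one>\<^bsub>eg e\<^esub>" "\<one>\<^bsub>eg e\<^esub>"] by (simp add: group.is_monoid monoid.one_closed monoid.l_one)

lemma eh_inv: "e \<in> E \<Longrightarrow> c \<in> carrier (eg e) \<Longrightarrow> eh e (inv\<^bsub>eg e\<^esub> c) = - eh e c"
  using eh_mult[of e c "inv\<^bsub>eg e\<^esub> c"] by (simp add: group.inv_closed group.r_inv)

text \<open>The edge group of the covering: the elements of height divisible by \<open>N\<close> are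
  powers of the \<open>(N div eps e)\<close>-th power of the generator. The quotient absorbs the
  sign of \<open>eps e\<close>, so the new generator has height exactly \<open>N\<close>.\<close>

definition je :: "'e \<Rightarrow> int \<Rightarrow> 'b" where "je e k = ie e (N div eps e * k)"

lemma je_closed [simp]: "e \<in> E \<Longrightarrow> je e k \<in> carrier (eg e)" by (simp add: je_def)

lemma je_add: "e \<in> E \<Longrightarrow> je e (k + l) = je e k \<otimes>\<^bsub>eg e\<^esub> je e l"
  by (simp add: je_def distrib_left ie_add)

lemma eh_je: "e \<in> E \<Longrightarrow> eh e (je e k) = N * k"
  using eps[of e] by (simp add: je_def eh_ie mult.commute mult.left_commute)

lemma je_inj: "e \<in> E \<Longrightarrow> inj (je e)"
proof (rule injI)
  fix x y assume e: "e \<in> E" "je e x = je e y"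
  then have "N * x = N * y" using eh_je[OF e(1)] by metis
  then show "x = y" using N_pos by simp
qed

text \<open>Lets \<open>ecls_psi_comm\<close> recognise an arbitrary element of suitable height as
  one of the covering edge group.\<close>

lemma je_range: 
  assumes "e \<in> E" "c \<in> carrier (eg e)" "N dvd eh e c"
  shows "\<exists>k. c = je e k"
proof -
  obtain l where l: "c = ie e l" using ie_bij[OF assms(1)] assms(2) by (auto simp: bij_betw_def)
  obtain m where m: "l * eps e = N * m" using assms(3) l by (auto simp: eh_ie assms(1) elim: dvdE)
  have "N = N div eps e * eps e" using eps[OF assms(1)] by simp
  then have "l * eps e = (N div eps e * m) * eps e" using m by (metis mult.assoc mult.commute)
  then have "l = N div eps e * m" using eps(2)[OF assms(1)] by simp
  then show ?thesis using l by (auto simp: je_def)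
qed

text \<open>The vertex groups of the covering, which \<open>jv\<close> below identifies with \<open>\<int>\<^sup>2\<close>.\<close>

definition subv :: "'v \<Rightarrow> 'a set" where "subv v = {g \<in> carrier (vg v). N dvd hv v g}"

lemma subvI: "g \<in> carrier (vg v) \<Longrightarrow> N dvd hv v g \<Longrightarrow> g \<in> subv v" by (simp add: subv_def)
lemma subvD: "g \<in> subv v \<Longrightarrow> N dvd hv v g" by (simp add: subv_def)
lemma subv_carrier [simp]: "g \<in> subv v \<Longrightarrow> g \<in> carrier (vg v)" by (simp add: subv_def)

lemma subv_iso_exists:
  assumes v: "v \<in> V"
  shows "\<exists>f :: int \<times> int \<Rightarrow> 'a. (\<forall>a b c d. f (a + c, b + d) = f (a, b) \<otimes>\<^bsub>vg v\<^esub> f (c, d)) \<and> bij_betw f UNIV (subv v)"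
proof -
  let ?i = "inv_into (carrier (vg v)) (co v)"
  have i_closed: "?i k \<in> carrier (vg v)" and co_i: "co v (?i k) = k" for k
    using bij_betw_imp_surj_on[OF co_bij[OF v]] inv_into_into[of k "co v" "carrier (vg v)"]
      f_inv_into_f[of k "co v" "carrier (vg v)"] by simp_all
  have i_co: "?i (co v g) = g" if "g \<in> carrier (vg v)" for g
    using co_bij[OF v] that by (simp add: bij_betw_def)
  have i_add: "?i (a + c, b + d) = ?i (a, b) \<otimes>\<^bsub>vg v\<^esub> ?i (c, d)" for a b c d
    using i_co[of "?i (a, b) \<otimes>\<^bsub>vg v\<^esub> ?i (c, d)"] by (simp add: co_mult v i_closed co_i monoid.m_closed)
  \<comment> \<open>In coordinates the height is a linear form, so \<open>subv v\<close> turns into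
    the lattice treated by \<open>lattice_basis\<close>.\<close>
  define f where "f k = hv v (?i k)" for k
  have f_add: "f (a + c, b + d) = f (a, b) + f (c, d)" for a b c d
    by (simp add: f_def i_add hv_mult v i_closed)
  have f0: "f (0, 0) = 0" using f_add[of 0 0 0 0] by simp
  have f1: "f (x, 0) = f (1, 0) * x" for x
  proof (induction x rule: int_induct[of _ 0])
    case (step1 i)
    then show ?case using f_add[of i 1 0 0] by (simp add: algebra_simps)
  next
    case (step2 i)
    then show ?case using f_add[of "i - 1" 1 0 0] by (simp add: algebra_simps)
  qed (simp add: f0)
  have f2: "f (0, x) = f (0, 1) * x" for x
  proof (induction x rule: int_induct[of _ 0])
    case (step1 i)
    then show ?case using f_add[of 0 0 i 1] by (simp add: algebra_simps)
  next
    case (step2 i)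
    then show ?case using f_add[of 0 0 "i - 1" 1] by (simp add: algebra_simps)
  qed (simp add: f0)
  have f: "f (x, y) = f (1, 0) * x + f (0, 1) * y" for x y
    using f_add[of x 0 0 y] f1[of x] f2[of y] by simp
  obtain p j q where pq: "p > 0" "q > 0"
    "\<And>x y. N dvd f (1, 0) * x + f (0, 1) * y \<longleftrightarrow> (\<exists>s t. x = p * s \<and> y = j * s + q * t)"
    using lattice_basis[OF N_pos, of "f (1, 0)" "f (0, 1)"] by metis
  define F where "F = (\<lambda>(s, t). ?i (p * s, j * s + q * t))"
  have Fm: "F (a + c, b + d) = F (a, b) \<otimes>\<^bsub>vg v\<^esub> F (c, d)" for a b c d
    using i_add[of "p * a" "p * c" "j * a + q * b" "j * c + q * d"] by (simp add: F_def algebra_simps)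
  have Fb: "bij_betw F UNIV (subv v)"
    unfolding bij_betw_def
  proof
    show "inj F"
    proof (rule injI)
      fix x y assume "F x = F y"
      then have "co v (F x) = co v (F y)" by simp
      then show "x = y" using pq(1,2) by (cases x; cases y) (auto simp: F_def co_i)
    qed
    show "range F = subv v"
    proof
      show "range F \<subseteq> subv v"
      proof
        fix g assume "g \<in> range F"
        then obtain s t where "g = ?i (p * s, j * s + q * t)" by (auto simp: F_def)
        moreover have "N dvd f (p * s, j * s + q * t)" unfolding f[of "p * s" "j * s + q * t"] pq(3) by blast
        ultimately show "g \<in> subv v" by (auto intro!: subvI simp: f_def i_closed)
      qed
      show "subv v \<subseteq> range F"
      proof
        fix g assume g: "g \<in> subv v"
        obtain x y where xy: "co v g = (x, y)" by (cases "co v g")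
        then have gi: "g = ?i (x, y)" using i_co[of g] g by simp
        then have "N dvd f (x, y)" using subvD[OF g] by (simp add: f_def)
        then obtain s t where "x = p * s" "y = j * s + q * t" unfolding f[of x y] pq(3) by blast
        then have "g = F (s, t)" using gi by (simp add: F_def)
        then show "g \<in> range F" by simp
      qed
    qed
  qed
  show ?thesis using Fm Fb by (intro exI[of _ F]) simp
qed

definition jv :: "'v \<Rightarrow> int \<times> int \<Rightarrow> 'a" where
  "jv v = (SOME f. (\<forall>a b c d. f (a + c, b + d) = f (a, b) \<otimes>\<^bsub>vg v\<^esub> f (c, d)) \<and> bij_betw f UNIV (subv v))"

definition jinv :: "'v \<Rightarrow> 'a \<Rightarrow> int \<times> int" where "jinv v = inv_into UNIV (jv v)"

abbreviation (input) Z2 :: "(int \<times> int) monoid" where "Z2 \<equiv> integer_group \<times>\<times> integer_group"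

lemma jv: "v \<in> V \<Longrightarrow> (\<forall>a b c d. jv v (a + c, b + d) = jv v (a, b) \<otimes>\<^bsub>vg v\<^esub> jv v (c, d)) \<and> bij_betw (jv v) UNIV (subv v)"
  using someI_ex[OF subv_iso_exists[of v]] unfolding jv_def .

lemma jv_subv [simp]: "v \<in> V \<Longrightarrow> jv v k \<in> subv v"
  using jv[of v] by (auto simp: bij_betw_def)

lemma jv_closed [simp]: "v \<in> V \<Longrightarrow> jv v k \<in> carrier (vg v)"
  by simp

lemma jv_mult: "v \<in> V \<Longrightarrow> jv v (k \<otimes>\<^bsub>Z2\<^esub> l) = jv v k \<otimes>\<^bsub>vg v\<^esub> jv v l"
  using jv[of v] by (cases k; cases l) simp

lemma jinv_jv [simp]: "v \<in> V \<Longrightarrow> jinv v (jv v k) = k"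
  using jv[of v] by (simp add: jinv_def bij_betw_def)

lemma jv_jinv [simp]: "v \<in> V \<Longrightarrow> g \<in> subv v \<Longrightarrow> jv v (jinv v g) = g"
  using jv[of v] by (auto simp: jinv_def bij_betw_def f_inv_into_f)

lemma jinv_mult: "v \<in> V \<Longrightarrow> g \<in> subv v \<Longrightarrow> h \<in> subv v \<Longrightarrow>
    jinv v (g \<otimes>\<^bsub>vg v\<^esub> h) = jinv v g \<otimes>\<^bsub>Z2\<^esub> jinv v h"
  by (metis jinv_jv jv_jinv jv_mult)

subsection \<open>Orbits of heights modulo \<open>N\<close>\<close>

text \<open>Vertices of the covering over \<open>v\<close> are double cosets of the vertex group and
  \<open>H\<close> in the fundamental group. As \<open>H\<close> is the kernel of
  \<open>\<phi>\<close> modulo \<open>N\<close>, these are the cosets in the integers of the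
  subgroup generated by \<open>N\<close> and the heights of the vertex group.\<close>

definition vrel :: "'v \<Rightarrow> int \<Rightarrow> int \<Rightarrow> bool" where
  "vrel v z z' \<longleftrightarrow> (\<exists>g\<in>carrier (vg v). N dvd z' - z - hv v g)"

definition erel :: "'e \<Rightarrow> int \<Rightarrow> int \<Rightarrow> bool" where
  "erel e z z' \<longleftrightarrow> (\<exists>c\<in>carrier (eg e). N dvd z' - z - eh e c)"

lemma vrel_dvd: "v \<in> V \<Longrightarrow> N dvd z' - z \<Longrightarrow> vrel v z z'"
  unfolding vrel_def by (intro bexI[of _ "\<one>\<^bsub>vg v\<^esub>"]) (simp_all add: monoid.one_closed)

lemma vrel_shift: "v \<in> V \<Longrightarrow> g \<in> carrier (vg v) \<Longrightarrow> vrel v z (z + hv v g)"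
  unfolding vrel_def by (intro bexI[of _ g]) simp_all

lemma vrel_sym: "v \<in> V \<Longrightarrow> vrel v z z' \<Longrightarrow> vrel v z' z"
  unfolding vrel_def
proof (elim bexE)
  fix g assume g: "v \<in> V" "g \<in> carrier (vg v)" "N dvd z' - z - hv v g"
  then have "N dvd - (z' - z - hv v g)" by (simp only: dvd_minus_iff)
  moreover have "- (z' - z - hv v g) = z - z' - hv v (inv\<^bsub>vg v\<^esub> g)" using g by (simp add: hv_inv)
  ultimately show "\<exists>g\<in>carrier (vg v). N dvd z - z' - hv v g"
    using g by (metis group.inv_closed vgroup)
qed

lemma vrel_trans: "v \<in> V \<Longrightarrow> vrel v z z' \<Longrightarrow> vrel v z' z'' \<Longrightarrow> vrel v z z''"
  unfolding vrel_def
proof (elim bexE)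
  fix g h assume g: "v \<in> V" "g \<in> carrier (vg v)" "N dvd z' - z - hv v g" "h \<in> carrier (vg v)" "N dvd z'' - z' - hv v h"
  have "N dvd (z' - z - hv v g) + (z'' - z' - hv v h)" using dvd_add[OF g(3,5)] .
  moreover have "(z' - z - hv v g) + (z'' - z' - hv v h) = z'' - z - hv v (g \<otimes>\<^bsub>vg v\<^esub> h)" using g by (simp add: hv_mult)
  ultimately show "\<exists>g\<in>carrier (vg v). N dvd z'' - z - hv v g"
    using g by (metis monoid.m_closed vmonoid)
qed

lemma erel_dvd: "e \<in> E \<Longrightarrow> N dvd z' - z \<Longrightarrow> erel e z z'"
  unfolding erel_def by (intro bexI[of _ "\<one>\<^bsub>eg e\<^esub>"]) (simp_all add: group.is_monoid monoid.one_closed)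

lemma erel_shift: "e \<in> E \<Longrightarrow> c \<in> carrier (eg e) \<Longrightarrow> erel e z (z + eh e c)"
  unfolding erel_def by (intro bexI[of _ c]) simp_all

lemma erel_sym: "e \<in> E \<Longrightarrow> erel e z z' \<Longrightarrow> erel e z' z"
  unfolding erel_def
proof (elim bexE)
  fix g assume g: "e \<in> E" "g \<in> carrier (eg e)" "N dvd z' - z - eh e g"
  then have "N dvd - (z' - z - eh e g)" by (simp only: dvd_minus_iff)
  moreover have "- (z' - z - eh e g) = z - z' - eh e (inv\<^bsub>eg e\<^esub> g)" using g by (simp add: eh_inv)
  ultimately show "\<exists>g\<in>carrier (eg e). N dvd z - z' - eh e g"
    using g by (metis group.inv_closed eg_group)
qed

lemma erel_trans: "e \<in> E \<Longrightarrow> erel e z z' \<Longrightarrow> erel e z' z'' \<Longrightarrow> erel e z z''"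
  unfolding erel_def
proof (elim bexE)
  fix g h assume g: "e \<in> E" "g \<in> carrier (eg e)" "N dvd z' - z - eh e g" "h \<in> carrier (eg e)" "N dvd z'' - z' - eh e h"
  have "N dvd (z' - z - eh e g) + (z'' - z' - eh e h)" using dvd_add[OF g(3,5)] .
  moreover have "(z' - z - eh e g) + (z'' - z' - eh e h) = z'' - z - eh e (g \<otimes>\<^bsub>eg e\<^esub> h)" using g by (simp add: eh_mult)
  ultimately show "\<exists>g\<in>carrier (eg e). N dvd z'' - z - eh e g"
    using g by (metis monoid.m_closed group.is_monoid eg_group)
qed

lemma erel_vrel:
  assumes "e \<in> E" "erel e z z'"
  shows "vrel (src e) z z'" "vrel (tgt e) (z + k) (z' + k)"
proof -
  obtain c where c: "c \<in> carrier (eg e)" "N dvd z' - z - eh e c" using assms by (auto simp: erel_def)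
  show "vrel (src e) z z'" unfolding vrel_def
    by (rule bexI[of _ "isrc e c"]) (use c assms in \<open>simp_all add: eh_src\<close>)
  show "vrel (tgt e) (z + k) (z' + k)" unfolding vrel_def
    by (rule bexI[of _ "itgt e c"]) (use c assms in \<open>simp_all add: eh_def\<close>)
qed

text \<open>The orbit as a set serves as its own name, so equality of codes amounts to
  \<open>vrel\<close>.\<close>

definition vcode :: "'v \<Rightarrow> int \<Rightarrow> 'v \<times> int set" where "vcode v z = (v, {z'. vrel v z z'})"
definition ecode :: "'e \<Rightarrow> int \<Rightarrow> 'e \<times> int set" where "ecode e z = (e, {z'. erel e z z'})"

lemma vcode_eq: "v \<in> V \<Longrightarrow> vcode v z = vcode v' z' \<longleftrightarrow> v = v' \<and> vrel v z z'"
  unfolding vcode_def by (auto dest: vrel_sym vrel_trans intro: vrel_dvd)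
     (metis dvd_0_right diff_self mem_Collect_eq vrel_dvd)

lemma ecode_eq: "e \<in> E \<Longrightarrow> ecode e z = ecode e' z' \<longleftrightarrow> e = e' \<and> erel e z z'"
  unfolding ecode_def by (auto dest: erel_sym erel_trans intro: erel_dvd)
     (metis dvd_0_right diff_self mem_Collect_eq erel_dvd)

lemma finite_vcodes: "finite {vcode v z | v z. v \<in> V}"
proof -
  have "{vcode v z | v z. v \<in> V} \<subseteq> (\<lambda>(v, z). vcode v z) ` (V \<times> {0..<N})"
  proof (rule subsetI)
    fix x assume "x \<in> {vcode v z | v z. v \<in> V}"
    then obtain v z where v: "v \<in> V" "x = vcode v z" by auto
    then have "x = vcode v (z mod N)" by (simp add: vcode_eq vrel_dvd mod_eq_dvd_iff[symmetric])
    moreover have "(v, z mod N) \<in> V \<times> {0..<N}" using N_pos v by simp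
    ultimately show "x \<in> (\<lambda>(v, z). vcode v z) ` (V \<times> {0..<N})" by force
  qed
  then show ?thesis by (rule finite_subset) (use finite_V in simp)
qed

lemma finite_ecodes: "finite {ecode e z | e z. e \<in> E}"
proof -
  have "{ecode v z | v z. v \<in> E} \<subseteq> (\<lambda>(v, z). ecode v z) ` (E \<times> {0..<N})"
  proof (rule subsetI)
    fix x assume "x \<in> {ecode v z | v z. v \<in> E}"
    then obtain v z where v: "v \<in> E" "x = ecode v z" by auto
    then have "x = ecode v (z mod N)" by (simp add: ecode_eq erel_dvd mod_eq_dvd_iff[symmetric])
    moreover have "(v, z mod N) \<in> E \<times> {0..<N}" using N_pos v by simp
    ultimately show "x \<in> (\<lambda>(v, z). ecode v z) ` (E \<times> {0..<N})" by force
  qed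
  then show ?thesis by (rule finite_subset) (use finite_E in simp)
qed

text \<open>Codes are numbered because vertices and arcs of the covering are to be natural numbers;
  finiteness of the set of codes makes the numbering injective.\<close>

definition wv :: "'v \<Rightarrow> int \<Rightarrow> nat" where "wv v z = to_nat_on {vcode v z | v z. v \<in> V} (vcode v z)"
definition fe :: "'e \<Rightarrow> int \<Rightarrow> nat" where "fe e z = to_nat_on {ecode e z | e z. e \<in> E} (ecode e z)"

lemma wv_eq:
  assumes "v \<in> V" "v' \<in> V"
  shows "wv v z = wv v' z' \<longleftrightarrow> v = v' \<and> vrel v z z'"
proof -
  have "vcode v z \<in> {vcode v z | v z. v \<in> V}" "vcode v' z' \<in> {vcode v z | v z. v \<in> V}"
    using assms by auto
  from inj_on_eq_iff[OF inj_on_to_nat_on[OF countable_finite[OF finite_vcodes]] this]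
  show ?thesis by (simp only: wv_def vcode_eq[OF assms(1)])
qed

lemma fe_eq:
  assumes "e \<in> E" "e' \<in> E"
  shows "fe e z = fe e' z' \<longleftrightarrow> e = e' \<and> erel e z z'"
proof -
  have "ecode e z \<in> {ecode e z | e z. e \<in> E}" "ecode e' z' \<in> {ecode e z | e z. e \<in> E}"
    using assms by auto
  from inj_on_eq_iff[OF inj_on_to_nat_on[OF countable_finite[OF finite_ecodes]] this]
  show ?thesis by (simp only: fe_def ecode_eq[OF assms(1)])
qed

text \<open>The vertices over \<open>v\<close> are the orbits of the vertex group of \<open>v\<close> on the heights modulo \<open>N\<close>, and
  likewise for the edges. \<open>vdec w\<close> is the vertex of \<open>\<G>\<close> below \<open>w\<close> together with a height in the orbit;
  the base vertex gets height \<open>0\<close>.\<close>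

definition vdec :: "nat \<Rightarrow> 'v \<times> int" where
  "vdec w = (SOME (v, z). v \<in> V \<and> w = wv v z \<and> (w = wv v0 0 \<longrightarrow> z = 0))"
definition edec :: "nat \<Rightarrow> 'e \<times> int" where
  "edec f = (SOME (e, z). e \<in> E \<and> f = fe e z)"

abbreviation "pv w \<equiv> fst (vdec w)"
abbreviation "vht w \<equiv> snd (vdec w)"
abbreviation "pe f \<equiv> fst (edec f)"
abbreviation "eht f \<equiv> snd (edec f)"

text \<open>The edge inclusions need no conjugating elements because the vertex groups are abelian.\<close>

definition cover :: "(nat, nat, int \<times> int, int) gog" where
  "cover = \<lparr>gog_graph = \<lparr>verts = {wv v z | v z. v \<in> V}, arcs = {fe e z | e z. e \<in> E},
       tail = (\<lambda>f. wv (src (pe f)) (eht f)), head = (\<lambda>f. wv (tgt (pe f)) (eht f + hx (pe f)))\<rparr>,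
     vertex_group = (\<lambda>_. integer_group \<times>\<times> integer_group), edge_group = (\<lambda>_. integer_group),
     edge_incl = (\<lambda>(f, b) k. jinv (fin (pe f, b)) (incl (pe f, b) (je (pe f) k)))\<rparr>"

abbreviation "w0 \<equiv> wv v0 0"

lemma vdec_ex: "w \<in> {wv v z | v z. v \<in> V} \<Longrightarrow> pv w \<in> V \<and> w = wv (pv w) (vht w) \<and> (w = w0 \<longrightarrow> vht w = 0)"
proof -
  assume "w \<in> {wv v z | v z. v \<in> V}"
  then have "\<exists>x. (case x of (v, z) \<Rightarrow> v \<in> V \<and> w = wv v z \<and> (w = w0 \<longrightarrow> z = 0))"
    by (cases "w = w0") (auto intro: exI[of _ v0] base_vert)
  from someI_ex[OF this] have "case vdec w of (v, z) \<Rightarrow> v \<in> V \<and> w = wv v z \<and> (w = w0 \<longrightarrow> z = 0)"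
    unfolding vdec_def .
  then show ?thesis by (simp add: case_prod_beta)
qed

lemma edec_ex: "f \<in> {fe e z | e z. e \<in> E} \<Longrightarrow> pe f \<in> E \<and> f = fe (pe f) (eht f)"
proof -
  assume "f \<in> {fe e z | e z. e \<in> E}"
  then have "\<exists>x. (case x of (e, z) \<Rightarrow> e \<in> E \<and> f = fe e z)" by auto
  from someI_ex[OF this] have "case edec f of (e, z) \<Rightarrow> e \<in> E \<and> f = fe e z"
    unfolding edec_def .
  then show ?thesis by (simp add: case_prod_beta)
qed

lemma cover_verts: "verts (gog_graph cover) = {wv v z | v z. v \<in> V}"
  and cover_arcs: "arcs (gog_graph cover) = {fe e z | e z. e \<in> E}"
  by (simp_all add: cover_def)

lemma wv_vert [simp]: "v \<in> V \<Longrightarrow> wv v z \<in> verts (gog_graph cover)"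
  and fe_arc [simp]: "e \<in> E \<Longrightarrow> fe e z \<in> arcs (gog_graph cover)"
  unfolding cover_verts cover_arcs by blast+

lemma cover_simps [simp]:
  "vertex_group cover w = integer_group \<times>\<times> integer_group" "edge_group cover f = integer_group"
  "edge_end (gog_graph cover) (f, True) = wv (tgt (pe f)) (eht f + hx (pe f))"
  "edge_end (gog_graph cover) (f, False) = wv (src (pe f)) (eht f)"
  "edge_incl cover (f, b) k = jinv (fin (pe f, b)) (incl (pe f, b) (je (pe f) k))"
  by (simp_all add: cover_def edge_end_def)

lemma incl_je_subv [simp]: "e \<in> E \<Longrightarrow> incl (e, b) (je e k) \<in> subv (fin (e, b))"
  by (cases b) (auto intro!: subvI simp: eh_src eh_def[symmetric] eh_je)

lemma graph_of_groups_cover: "graph_of_groups cover"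
proof (rule graph_of_groups.intro)
  show "wf_digraph (gog_graph cover)"
  proof
    fix f assume "f \<in> arcs (gog_graph cover)"
    then have "pe f \<in> E" using edec_ex[of f] by (simp add: cover_arcs)
    then show "tail (gog_graph cover) f \<in> verts (gog_graph cover)"
      "head (gog_graph cover) f \<in> verts (gog_graph cover)" unfolding cover_def by auto
  qed
  show "Group.group (vertex_group cover v)" for v by (simp add: DirProd_group)
  show "Group.group (edge_group cover f)" for f by simp
  fix f b assume "f \<in> arcs (gog_graph cover)"
  then have e: "pe f \<in> E" using edec_ex[of f] by (simp add: cover_arcs)
  have "jinv (fin (pe f, b)) (incl (pe f, b) (je (pe f) (k + l))) =
     jinv (fin (pe f, b)) (incl (pe f, b) (je (pe f) k)) \<otimes>\<^bsub>Z2\<^esub> jinv (fin (pe f, b)) (incl (pe f, b) (je (pe f) l))" for k l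
    using e by (simp add: je_add incl_mult jinv_mult)
  moreover have "inj (\<lambda>k. jinv (fin (pe f, b)) (incl (pe f, b) (je (pe f) k)))"
  proof (rule injI)
    fix k l assume "jinv (fin (pe f, b)) (incl (pe f, b) (je (pe f) k)) = jinv (fin (pe f, b)) (incl (pe f, b) (je (pe f) l))"
    then have "incl (pe f, b) (je (pe f) k) = incl (pe f, b) (je (pe f) l)"
      using e jv_jinv[of "fin (pe f, b)"] incl_je_subv[OF e] by (metis fin_in_verts fst_conv)
    then have "je (pe f) k = je (pe f) l" using incl_inj[of "(pe f, b)"] e by (auto simp: inj_on_def)
    then show "k = l" using je_inj[OF e] by (auto simp: inj_on_def)
  qed
  ultimately show "edge_incl cover (f, b) \<in> mon (edge_group cover f) (vertex_group cover (edge_end (gog_graph cover) (f, b)))"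
    by (auto simp: mon_def hom_def inj_on_def)
qed

sublocale H: graph_of_groups cover by (rule graph_of_groups_cover)

lemma vdec_wv: "v \<in> V \<Longrightarrow> pv (wv v z) \<in> V \<and> wv v z = wv (pv (wv v z)) (vht (wv v z))"
  using vdec_ex[of "wv v z"] by blast

lemma edec_fe: "e \<in> E \<Longrightarrow> pe (fe e z) \<in> E \<and> fe e z = fe (pe (fe e z)) (eht (fe e z))"
  using edec_ex[of "fe e z"] by blast

lemma pv_wv [simp]: "v \<in> V \<Longrightarrow> pv (wv v z) = v"
  using vdec_wv[of v z] wv_eq[of v "pv (wv v z)" z "vht (wv v z)"] by auto

lemma vht_wv: "v \<in> V \<Longrightarrow> vrel v z (vht (wv v z))"
  using vdec_wv[of v z] wv_eq[of v "pv (wv v z)" z "vht (wv v z)"] by auto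

lemma wv_vht [simp]: "v \<in> V \<Longrightarrow> wv v (vht (wv v z)) = wv v z"
  using vrel_sym[OF _ vht_wv[of v z]] by (simp add: wv_eq)

lemma vht_base [simp]: "vht w0 = 0" using vdec_ex[of w0] base_vert by blast

lemma pe_fe [simp]: "e \<in> E \<Longrightarrow> pe (fe e z) = e"
  using edec_fe[of e z] fe_eq[of e "pe (fe e z)" z "eht (fe e z)"] by auto

lemma eht_fe: "e \<in> E \<Longrightarrow> erel e z (eht (fe e z))"
  using edec_fe[of e z] fe_eq[of e "pe (fe e z)" z "eht (fe e z)"] by auto

lemma fe_eht [simp]: "e \<in> E \<Longrightarrow> fe e (eht (fe e z)) = fe e z"
  using erel_sym[OF _ eht_fe[of e z]] by (simp add: fe_eq)

lemma wv_eht [simp]: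
  assumes "e \<in> E"
  shows "wv (src e) (eht (fe e z)) = wv (src e) z"
    "wv (tgt e) (eht (fe e z) + k) = wv (tgt e) (z + k)"
proof -
  note r = erel_vrel[OF assms eht_fe[OF assms, of z]]
  show "wv (src e) (eht (fe e z)) = wv (src e) z"
    using vrel_sym[OF _ r(1)] assms by (simp add: wv_eq)
  show "wv (tgt e) (eht (fe e z) + k) = wv (tgt e) (z + k)"
    using vrel_sym[OF _ r(2)[of k]] assms by (simp add: wv_eq)
qed

lemma wv_shift [simp]: "v \<in> V \<Longrightarrow> g \<in> carrier (vg v) \<Longrightarrow> wv v (z + hv v g) = wv v z"
  using vrel_sym[OF _ vrel_shift[of v g z]] by (simp add: wv_eq)

lemma H_fin_fe [simp]: "e \<in> E \<Longrightarrow> H.fin (fe e z, True) = wv (tgt e) (z + hx e)"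
   "e \<in> E \<Longrightarrow> H.fin (fe e z, False) = wv (src e) z"
  by simp_all

text \<open>Only the underlying edge path matters for connectedness, so all group elements of the
  lift are taken trivial.\<close>

lemma path_lift: "path u p v \<Longrightarrow> \<exists>q. H.path (wv u z) q (wv v (z + hgt u p))"
proof (induction p arbitrary: u z)
  case (Elt g)
  then show ?case by (intro exI[of _ "Elt (0, 0)"]) auto
next
  case (Step g x p)
  obtain e b where x: "x = (e, b)" by (cases x)
  have e: "e \<in> E" "u = start (e, b)" "g \<in> carrier (vg u)" "path (fin (e, b)) p v" "u \<in> V"
    using Step.prems x by auto
  define z' where "z' = z + hv u g"
  have "\<exists>f. fst f \<in> H.E \<and> H.start f = wv u z \<and> H.fin f = wv (fin (e, b)) (z' + hxx x)"
  proof (cases b)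
    case True
    then show ?thesis using e x wv_shift[OF e(5,3), of z]
      by (intro exI[of _ "(fe e z', True)"]) (auto simp: edge_start_def rev_edge_def z'_def hxx_def)
  next
    case False
    \<comment> \<open>A covering arc is indexed by the height at its tail. Crossed backwards from
      \<open>z'\<close>, it therefore has index \<open>z' - hx e\<close>.\<close>
    then show ?thesis using e x wv_shift[OF e(5,3), of z]
      by (intro exI[of _ "(fe e (z' - hx e), False)"]) (auto simp: edge_start_def rev_edge_def z'_def hxx_def)
  qed
  then obtain f where f: "fst f \<in> H.E" "H.start f = wv u z" "H.fin f = wv (fin (e, b)) (z' + hxx x)" by blast
  from Step.IH[OF e(4), of "z' + hxx x"] obtain q where q: "H.path (wv (fin (e, b)) (z' + hxx x)) q (wv v (z' + hxx x + hgt (fin (e, b)) p))"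
    by auto
  show ?case
    using f q by (intro exI[of _ "Step (0, 0) f q"]) (simp add: x z'_def add.assoc)
qed

text \<open>A loop at \<open>v0\<close> of the desired height, which exists by
  \<open>\<phi>_surj\<close>, is put in front of the base path of height 0. Lifting such paths
  reaches every vertex of the covering.\<close>

lemma path_of_height:
  assumes "v \<in> V" shows "\<exists>p. path v0 p v \<and> hgt v0 p = z"
proof -
  obtain s where s: "s \<in> carrier FG" "\<phi> s = 1" using \<phi>_surj by auto
  have "\<exists>A\<in>carrier FG. \<phi> A = z"
  proof (induction z rule: int_induct[of _ 0])
    case base
    show ?case by (intro bexI[of _ "\<one>\<^bsub>FG\<^esub>"]) auto
  next
    case (step1 i)
    then obtain A where "A \<in> carrier FG" "\<phi> A = i" by auto
    then show ?case using s by (intro bexI[of _ "A \<otimes>\<^bsub>FG\<^esub> s"]) (auto simp: \<phi>_mult)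
  next
    case (step2 i)
    then obtain A where A: "A \<in> carrier FG" "\<phi> A = i" by auto
    have "\<phi> (inv\<^bsub>FG\<^esub> s) = - 1" using \<phi>_mult[of s "inv\<^bsub>FG\<^esub> s"] s by simp
    then show ?case using s A by (intro bexI[of _ "A \<otimes>\<^bsub>FG\<^esub> inv\<^bsub>FG\<^esub> s"]) (auto simp: \<phi>_mult)
  qed
  then obtain A where A: "A \<in> carrier FG" "\<phi> A = z" by auto
  then obtain q where q: "path v0 q v0" "A = cls q" by (auto simp: carrier_FG)
  then have p: "path v0 q v0" "hgt v0 q = z" using fhgt_eq[OF A(1)] A(2) by (simp_all add: fhgt_cls)
  show ?thesis using p assms hgt_conc[OF p(1) base_path[OF assms]]
    by (intro exI[of _ "conc v0 q (base_path v)"]) (auto simp: hgt_base_path)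
qed

sublocale H: based_gog cover w0
proof
  show "w0 \<in> H.V" by simp
  fix w assume "w \<in> H.V"
  then obtain v z where w: "v \<in> V" "w = wv v z" by (auto simp: cover_verts)
  obtain p where "path v0 p v" "hgt v0 p = z" using path_of_height[OF w(1)] by blast
  then show "\<exists>p. H.path w0 p w" using path_lift[of v0 p v 0] w by auto
qed

lemma finite_connected_cover: "finite_connected_Z2_Z_gog cover"
proof -
  have "{wv v z | v z. v \<in> V} \<subseteq> to_nat_on {vcode v z | v z. v \<in> V} ` {vcode v z | v z. v \<in> V}"
    unfolding wv_def by blast
  then have fV: "finite {wv v z | v z. v \<in> V}" by (rule finite_subset) (rule finite_imageI[OF finite_vcodes])
  have "{fe e z | e z. e \<in> E} \<subseteq> to_nat_on {ecode e z | e z. e \<in> E} ` {ecode e z | e z. e \<in> E}"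
    unfolding fe_def by blast
  then have fE: "finite {fe e z | e z. e \<in> E}" by (rule finite_subset) (rule finite_imageI[OF finite_ecodes])
  interpret wf_digraph "gog_graph cover" by (rule H.wf_digraph_gog_graph)
  have "fin_digraph (gog_graph cover)" by (rule fin_digraphI) (use fV fE in \<open>simp_all add: cover_verts cover_arcs\<close>)
  moreover have "connected (gog_graph cover)"
    by (rule H.path_imp_connected[OF H.base_vert H.path_from_base])
  ultimately show ?thesis unfolding finite_connected_Z2_Z_gog_def
    using graph_of_groups_cover by (auto simp: iso_refl)
qed

lemma cover_maximal: "all_inclusions_maximal cover"
  unfolding all_inclusions_maximal_def
proof (intro ballI allI)
  fix f b assume "f \<in> arcs (gog_graph cover)"
  then have e: "pe f \<in> E" using edec_ex[of f] by (simp add: cover_arcs)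
  define y where "y = edge_incl cover (f, b) 1"
  let ?v = "fin (pe f, b)"
  have vV: "?v \<in> V" using e by simp
  have mult: "edge_incl cover (f, b) (k + l) = edge_incl cover (f, b) k \<otimes>\<^bsub>Z2\<^esub> edge_incl cover (f, b) l" for k l
    using e by (simp add: je_add incl_mult jinv_mult)
  have hom: "edge_incl cover (f, b) \<in> hom integer_group Z2" by (rule homI) (simp, simp only: mult_integer_group mult)
  interpret Z2: Group.group Z2 by (simp add: DirProd_group)
  have "edge_incl cover (f, b) k = y [^]\<^bsub>Z2\<^esub> k" for k
    using hom_int_pow[OF hom, of 1 k] by (simp add: y_def DirProd_group)
  then have gen: "edge_incl cover (f, b) ` UNIV = generate Z2 {y}"
    using Z2.generate_pow[of y] by auto
  \<comment> \<open>The choice of \<open>je\<close> gives height exactly \<open>N\<close>, while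
    every element of the covering vertex group has height divisible by \<open>N\<close>; an
    \<open>n\<close>-th root would have height \<open>N m\<close> with
    \<open>n m = 1\<close>.\<close>
  have hy: "hv ?v (jv ?v y) = N"
    using e eh_je[OF e, of 1] vV by (cases b) (simp_all add: y_def eh_src eh_def)
  have "jv ?v \<in> hom Z2 (vg ?v)" using vV by (intro homI) (simp_all add: jv_mult)
  then have pow: "jv ?v (g [^]\<^bsub>Z2\<^esub> n) = jv ?v g [^]\<^bsub>vg ?v\<^esub> n" for g and n :: nat
    using vV by (intro hom_nat_pow) (simp_all add: DirProd_group)
  have hpow: "hv ?v (h [^]\<^bsub>vg ?v\<^esub> n) = int n * hv ?v h" if "h \<in> carrier (vg ?v)" for h and n :: nat
  proof (induction n)
    case 0
    then show ?case using vV by (simp add: monoid.nat_pow_0)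
  next
    case (Suc n)
    then show ?case using vV that
      by (simp add: monoid.nat_pow_Suc hv_mult monoid.nat_pow_closed algebra_simps)
  qed
  have "\<not> (\<exists>g\<in>carrier Z2 - {\<one>\<^bsub>Z2\<^esub>}. \<exists>n::nat. n > 1 \<and> y = g [^]\<^bsub>Z2\<^esub> n)"
  proof
    assume "\<exists>g\<in>carrier Z2 - {\<one>\<^bsub>Z2\<^esub>}. \<exists>n::nat. n > 1 \<and> y = g [^]\<^bsub>Z2\<^esub> n"
    then obtain g and n :: nat where n: "n > 1" "y = g [^]\<^bsub>Z2\<^esub> n" by blast
    have "N dvd hv ?v (jv ?v g)" using jv_subv[OF vV, of g] by (rule subvD)
    then obtain m where "hv ?v (jv ?v g) = N * m" by (auto elim: dvdE)
    then have "N = int n * (N * m)" using hy hpow[OF jv_closed[OF vV]] n(2) pow by metis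
    then have "N * (int n * m) = N * 1" by (simp add: algebra_simps)
    then have "int n * m = 1" using N_pos by (subst (asm) mult_cancel_left) simp
    then show False using n(1) by (simp add: zmult_eq_1_iff)
  qed
  then show "maximal_cyclic (vertex_group cover (edge_end (gog_graph cover) (f, b)))
          (edge_incl cover (f, b) ` carrier (edge_group cover f))"
    unfolding maximal_cyclic_def using gen by (intro bexI[of _ y]) auto
qed

end

section \<open>Lifting to the covering\<close>

text \<open>The edge relation multiplied by the edge: in this form edge group elements can be pushed
  across an edge.\<close>

lemma (in based_gog) ecls_vcls_comm:
  assumes "fst x \<in> E" "c \<in> carrier (eg (fst x))"
  shows "ecls x \<otimes>\<^bsub>FG\<^esub> vcls (fin x) (incl x c) = vcls (start x) (incl (rev_edge x) c) \<otimes>\<^bsub>FG\<^esub> ecls x"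
proof -
  let ?a = "ecls x" and ?b = "vcls (fin x) (incl x c)" and ?r = "ecls (rev_edge x)"
  have cl: "?a \<in> carrier FG" "?b \<in> carrier FG" "?r \<in> carrier FG" using assms by simp_all
  have r: "?r = inv\<^bsub>FG\<^esub> ?a" using ecls_rev[OF assms(1)] cl
    by (metis FG.inv_equality FG.inv_inv)
  have "?a \<otimes>\<^bsub>FG\<^esub> ?b = ?a \<otimes>\<^bsub>FG\<^esub> (?b \<otimes>\<^bsub>FG\<^esub> ?r) \<otimes>\<^bsub>FG\<^esub> ?a"
    using cl by (simp add: r FG.m_assoc)
  then show ?thesis by (simp only: ecls_relation[OF assms])
qed

lemma (in based_gog) ecls_rev_inv: "fst x \<in> E \<Longrightarrow> ecls (rev_edge x) = inv\<^bsub>FG\<^esub> (ecls x)"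
  using ecls_rev[of x] ecls_closed[of x] ecls_closed[of "rev_edge x"]
  by (metis FG.inv_equality FG.inv_inv rev_edge_simps(1))

context cover_gog
begin

abbreviation "M \<equiv> H.FG"

lemma vm_closed [simp]: "v \<in> V \<Longrightarrow> g \<in> carrier (vg v) \<Longrightarrow> h \<in> carrier (vg v) \<Longrightarrow> g \<otimes>\<^bsub>vg v\<^esub> h \<in> carrier (vg v)"
  by (simp add: monoid.m_closed)

lemma vinv_closed [simp]: "v \<in> V \<Longrightarrow> g \<in> carrier (vg v) \<Longrightarrow> inv\<^bsub>vg v\<^esub> g \<in> carrier (vg v)"
  by (simp add: group.inv_closed)

lemma vone_closed [simp]: "v \<in> V \<Longrightarrow> \<one>\<^bsub>vg v\<^esub> \<in> carrier (vg v)"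
  by (simp add: monoid.one_closed)

lemma em_closed [simp]: "e \<in> E \<Longrightarrow> c \<in> carrier (eg e) \<Longrightarrow> d \<in> carrier (eg e) \<Longrightarrow> c \<otimes>\<^bsub>eg e\<^esub> d \<in> carrier (eg e)"
  by (simp add: group.is_monoid monoid.m_closed)

lemma einv_closed [simp]: "e \<in> E \<Longrightarrow> c \<in> carrier (eg e) \<Longrightarrow> inv\<^bsub>eg e\<^esub> c \<in> carrier (eg e)"
  by (simp add: group.inv_closed)

lemma eone_closed [simp]: "e \<in> E \<Longrightarrow> \<one>\<^bsub>eg e\<^esub> \<in> carrier (eg e)"
  by (simp add: group.is_monoid monoid.one_closed)

lemma co_eqI: "v \<in> V \<Longrightarrow> g \<in> carrier (vg v) \<Longrightarrow> h \<in> carrier (vg v) \<Longrightarrow>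
    fst (co v g) = fst (co v h) \<Longrightarrow> snd (co v g) = snd (co v h) \<Longrightarrow> g = h"
  using co_bij[of v] by (metis bij_betw_inv_into_left prod_eqI)

lemma co_one: "v \<in> V \<Longrightarrow> co v \<one>\<^bsub>vg v\<^esub> = (0, 0)"
  using co_mult[of v "\<one>\<^bsub>vg v\<^esub>" "\<one>\<^bsub>vg v\<^esub>"] by (simp add: monoid.l_one prod_eq_iff)

lemma co_inv: "v \<in> V \<Longrightarrow> g \<in> carrier (vg v) \<Longrightarrow> co v (inv\<^bsub>vg v\<^esub> g) = (- fst (co v g), - snd (co v g))"
  using co_mult[of v g "inv\<^bsub>vg v\<^esub> g"] by (simp add: group.r_inv co_one prod_eq_iff)

lemma incl_inv: "e \<in> E \<Longrightarrow> c \<in> carrier (eg e) \<Longrightarrow> incl (e, b) (inv\<^bsub>eg e\<^esub> c) = inv\<^bsub>vg (fin (e, b))\<^esub> (incl (e, b) c)"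
  using group_hom.hom_inv[of "eg e" "vg (fin (e, b))" "incl (e, b)" c] incl_hom[of "(e, b)"]
  by (simp add: group_hom_def group_hom_axioms_def)

lemmas vg_simps = co_mult co_inv co_one incl_mult incl_inv

text \<open>
  \<open>tau v z\<close> leads from the chosen height of the orbit of \<open>z\<close> to \<open>z\<close> itself, and \<open>sig\<close> does the same for
  edges. Both depend on \<open>z\<close> only modulo \<open>N\<close> and are trivial at the chosen heights.
\<close>

definition tau :: "'v \<Rightarrow> int \<Rightarrow> 'a" where
  "tau v z = (if N dvd z - vht (wv v z) then \<one>\<^bsub>vg v\<^esub>
     else (SOME t. t \<in> carrier (vg v) \<and> N dvd z mod N - vht (wv v z) - hv v t))"

definition sig :: "'e \<Rightarrow> int \<Rightarrow> 'b" where
  "sig e z = (if N dvd z - eht (fe e z) then \<one>\<^bsub>eg e\<^esub>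
     else (SOME c. c \<in> carrier (eg e) \<and> N dvd z mod N - eht (fe e z) - eh e c))"

lemma dvd_minus_mod_self: "N dvd z - z mod N" "N dvd z mod N - z"
  by (simp_all add: mod_eq_dvd_iff[symmetric])

lemma tau:
  assumes v: "v \<in> V"
  shows tau_closed [simp]: "tau v z \<in> carrier (vg v)" and tau_dvd: "N dvd z - vht (wv v z) - hv v (tau v z)"
proof -
  have "vrel v (vht (wv v z)) (z mod N)"
    by (rule vrel_trans[OF v vrel_sym[OF v vht_wv[OF v]] vrel_dvd[OF v dvd_minus_mod_self(2)]])
  then have "\<exists>t. t \<in> carrier (vg v) \<and> N dvd z mod N - vht (wv v z) - hv v t" by (auto simp: vrel_def)
  from someI_ex[OF this] have t: "\<not> N dvd z - vht (wv v z) \<Longrightarrow> tau v z \<in> carrier (vg v) \<and> N dvd z mod N - vht (wv v z) - hv v (tau v z)"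
    by (simp add: tau_def)
  show "tau v z \<in> carrier (vg v)" using t v by (cases "N dvd z - vht (wv v z)") (simp_all add: tau_def)
  show "N dvd z - vht (wv v z) - hv v (tau v z)"
  proof (cases "N dvd z - vht (wv v z)")
    case True
    then show ?thesis using v by (simp add: tau_def)
  next
    case False
    then have "N dvd (z mod N - vht (wv v z) - hv v (tau v z)) + (z - z mod N)"
      by (intro dvd_add conjunct2[OF t] dvd_minus_mod_self(1))
    then show ?thesis by (simp add: algebra_simps)
  qed
qed

lemma sig:
  assumes e: "e \<in> E"
  shows sig_closed [simp]: "sig e z \<in> carrier (eg e)" and sig_dvd: "N dvd z - eht (fe e z) - eh e (sig e z)"
proof -
  have "erel e (eht (fe e z)) (z mod N)"
    by (rule erel_trans[OF e erel_sym[OF e eht_fe[OF e]] erel_dvd[OF e dvd_minus_mod_self(2)]])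
  then have "\<exists>t. t \<in> carrier (eg e) \<and> N dvd z mod N - eht (fe e z) - eh e t" by (auto simp: erel_def)
  from someI_ex[OF this] have t: "\<not> N dvd z - eht (fe e z) \<Longrightarrow> sig e z \<in> carrier (eg e) \<and> N dvd z mod N - eht (fe e z) - eh e (sig e z)"
    by (simp add: sig_def)
  show "sig e z \<in> carrier (eg e)" using t e by (cases "N dvd z - eht (fe e z)") (simp_all add: sig_def)
  show "N dvd z - eht (fe e z) - eh e (sig e z)"
  proof (cases "N dvd z - eht (fe e z)")
    case True
    then show ?thesis using e by (simp add: sig_def)
  next
    case False
    then have "N dvd (z mod N - eht (fe e z) - eh e (sig e z)) + (z - z mod N)"
      by (intro dvd_add conjunct2[OF t] dvd_minus_mod_self(1))
    then show ?thesis by (simp add: algebra_simps)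
  qed
qed

lemma wv_cong: "v \<in> V \<Longrightarrow> N dvd z' - z \<Longrightarrow> wv v z' = wv v z"
  using vrel_sym[OF _ vrel_dvd[of v z' z]] by (simp add: wv_eq)

lemma fe_cong: "e \<in> E \<Longrightarrow> N dvd z' - z \<Longrightarrow> fe e z' = fe e z"
  using erel_sym[OF _ erel_dvd[of e z' z]] by (simp add: fe_eq)

lemma dvd_cong_minus: "N dvd z' - z \<Longrightarrow> N dvd z' - k \<longleftrightarrow> N dvd z - (k::int)"
  by (metis dvd_add_right_iff diff_add_cancel add_diff_eq)

lemma tau_cong: "v \<in> V \<Longrightarrow> N dvd z' - z \<Longrightarrow> tau v z' = tau v z"
  unfolding tau_def using wv_cong[of v z' z] dvd_cong_minus[of z' z] by (simp add: mod_eq_dvd_iff[symmetric])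

lemma sig_cong: "e \<in> E \<Longrightarrow> N dvd z' - z \<Longrightarrow> sig e z' = sig e z"
  unfolding sig_def using fe_cong[of e z' z] dvd_cong_minus[of z' z] by (simp add: mod_eq_dvd_iff[symmetric])

lemma tau_vht [simp]: "v \<in> V \<Longrightarrow> tau v (vht (wv v z)) = \<one>\<^bsub>vg v\<^esub>"
  by (simp add: tau_def)

lemma sig_eht [simp]: "e \<in> E \<Longrightarrow> sig e (eht (fe e z)) = \<one>\<^bsub>eg e\<^esub>"
  by (simp add: sig_def)

text \<open>The heights telescope: from the chosen height to \<open>z\<close>, on to
  \<open>z'\<close>, and back to the chosen height, which is the same for both since they lie in one
  orbit.\<close>

lemma transition_subv:
  assumes "v \<in> V" "g \<in> carrier (vg v)" "N dvd z + hv v g - z'" "wv v z' = wv v z"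
  shows "tau v z \<otimes>\<^bsub>vg v\<^esub> g \<otimes>\<^bsub>vg v\<^esub> inv\<^bsub>vg v\<^esub> (tau v z') \<in> subv v"
proof (rule subvI)
  have "N dvd (z' - vht (wv v z') - hv v (tau v z')) - (z - vht (wv v z) - hv v (tau v z)) + (z + hv v g - z')"
    by (intro dvd_add dvd_diff tau_dvd assms)
  then show "N dvd hv v (tau v z \<otimes>\<^bsub>vg v\<^esub> g \<otimes>\<^bsub>vg v\<^esub> inv\<^bsub>vg v\<^esub> (tau v z'))"
    using assms by (simp add: hv_mult hv_inv algebra_simps)
qed (use assms in simp)

section \<open>The lift as a representation with heights\<close>

definition psi :: "'v \<Rightarrow> int \<Rightarrow> 'a \<Rightarrow> (nat, int \<times> int) gog_path set" where
  "psi v z h = H.vcls (wv v z) (jinv v h)"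

lemma psi_closed [simp]: "v \<in> V \<Longrightarrow> psi v z h \<in> carrier M"
  by (simp add: psi_def)

lemma psi_mult: "v \<in> V \<Longrightarrow> g \<in> subv v \<Longrightarrow> h \<in> subv v \<Longrightarrow>
    psi v z (g \<otimes>\<^bsub>vg v\<^esub> h) = psi v z g \<otimes>\<^bsub>M\<^esub> psi v z h"
  using H.vcls_mult[of "wv v z" "jinv v g" "jinv v h"] by (simp add: psi_def jinv_mult)

lemma psi_cong: "wv v z = wv v z' \<Longrightarrow> psi v z = psi v z'"
  by (simp add: psi_def fun_eq_iff)

lemma H_ecls_closed [simp]: "e \<in> E \<Longrightarrow> H.ecls (fe e z, b) \<in> carrier M"
  by (rule H.ecls_closed) simp

lemma ecls_psi_comm:
  assumes "e \<in> E" "c \<in> carrier (eg e)" "N dvd eh e c"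
  shows "H.ecls (fe e z, True) \<otimes>\<^bsub>M\<^esub> psi (tgt e) (z + hx e) (itgt e c) =
    psi (src e) z (isrc e c) \<otimes>\<^bsub>M\<^esub> H.ecls (fe e z, True)"
proof -
  obtain k where k: "c = je e k" using je_range[OF assms] by blast
  show ?thesis
    using H.ecls_vcls_comm[of "(fe e z, True)" k] assms
    by (simp add: psi_def k rev_edge_def edge_start_def)
qed

text \<open>
  The lift of a path started at height \<open>z\<close>: an element is pulled back to the chosen heights by \<open>tau\<close>,
  and an edge is first moved by \<open>sig\<close> to the chosen height of its orbit.
\<close>

definition lamL :: "'v \<Rightarrow> int \<Rightarrow> 'a \<Rightarrow> (nat, int \<times> int) gog_path set" where
  "lamL v z g = psi v z (tau v z \<otimes>\<^bsub>vg v\<^esub> g \<otimes>\<^bsub>vg v\<^esub> inv\<^bsub>vg v\<^esub> (tau v (z + hv v g)))"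

text \<open>With \<open>c = sig e z\<close>, crossing \<open>e\<close> equals
  \<open>isrc e c\<close> inverted, then \<open>e\<close>, then \<open>itgt e c\<close>. Started at
  \<open>z\<close>, the first factor ends, modulo \<open>N\<close>, at the chosen height of the edge
  orbit. \<open>eltS\<close> and \<open>eltT\<close> are the outer factors pulled back to the chosen
  heights of the vertex orbits.\<close>

definition eltS :: "'e \<Rightarrow> int \<Rightarrow> 'a" where
  "eltS e z = tau (src e) z \<otimes>\<^bsub>vg (src e)\<^esub> inv\<^bsub>vg (src e)\<^esub> (isrc e (sig e z))
     \<otimes>\<^bsub>vg (src e)\<^esub> inv\<^bsub>vg (src e)\<^esub> (tau (src e) (eht (fe e z)))"

definition eltT :: "'e \<Rightarrow> int \<Rightarrow> 'a" where
  "eltT e z = tau (tgt e) (eht (fe e z) + hx e) \<otimes>\<^bsub>vg (tgt e)\<^esub> itgt e (sig e z)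
     \<otimes>\<^bsub>vg (tgt e)\<^esub> inv\<^bsub>vg (tgt e)\<^esub> (tau (tgt e) (z + hx e))"

definition muL :: "'e \<Rightarrow> int \<Rightarrow> (nat, int \<times> int) gog_path set" where
  "muL e z = psi (src e) z (eltS e z) \<otimes>\<^bsub>M\<^esub> (H.ecls (fe e z, True) \<otimes>\<^bsub>M\<^esub> psi (tgt e) (z + hx e) (eltT e z))"

lemma eltS_subv: 
  assumes e: "e \<in> E" shows "eltS e z \<in> subv (src e)"
  unfolding eltS_def
proof (rule transition_subv)
  show "N dvd z + hv (src e) (inv\<^bsub>vg (src e)\<^esub> isrc e (sig e z)) - eht (fe e z)"
    using sig_dvd[OF e, of z] e by (simp add: hv_inv eh_src algebra_simps)
qed (use e in simp_all)

lemma eltT_subv: 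
  assumes e: "e \<in> E" shows "eltT e z \<in> subv (tgt e)"
  unfolding eltT_def
proof (rule transition_subv)
  have "N dvd - (z - eht (fe e z) - eh e (sig e z))" using sig_dvd[OF e, of z] by (simp only: dvd_minus_iff)
  then show "N dvd eht (fe e z) + hx e + hv (tgt e) (itgt e (sig e z)) - (z + hx e)"
    by (simp add: eh_def algebra_simps)
qed (use e in simp_all)

lemma lamL_subv: "v \<in> V \<Longrightarrow> g \<in> carrier (vg v) \<Longrightarrow>
    tau v z \<otimes>\<^bsub>vg v\<^esub> g \<otimes>\<^bsub>vg v\<^esub> inv\<^bsub>vg v\<^esub> (tau v (z + hv v g)) \<in> subv v"
  by (rule transition_subv) simp_all

sublocale L: based_rep \<G> v0 hv hx M lamL muL
proof
  fix v g z assume "v \<in> V" "g \<in> carrier (vg v)"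
  then show "lamL v z g \<in> carrier M" by (simp add: lamL_def)
next
  fix e z assume "e \<in> E"
  then show "muL e z \<in> carrier M" by (simp add: muL_def)
next
  fix v g h z assume v: "v \<in> V" and g: "g \<in> carrier (vg v)" and h: "h \<in> carrier (vg v)"
  let ?a = "tau v z \<otimes>\<^bsub>vg v\<^esub> g \<otimes>\<^bsub>vg v\<^esub> inv\<^bsub>vg v\<^esub> (tau v (z + hv v g))"
  let ?b = "tau v (z + hv v g) \<otimes>\<^bsub>vg v\<^esub> h \<otimes>\<^bsub>vg v\<^esub> inv\<^bsub>vg v\<^esub> (tau v (z + hv v g + hv v h))"
  \<comment> \<open>In coordinates the two occurrences of \<open>tau v (z + hv v g)\<close> in the
    middle cancel.\<close>
  have "tau v z \<otimes>\<^bsub>vg v\<^esub> (g \<otimes>\<^bsub>vg v\<^esub> h) \<otimes>\<^bsub>vg v\<^esub> inv\<^bsub>vg v\<^esub> (tau v (z + hv v (g \<otimes>\<^bsub>vg v\<^esub> h)))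
     = ?a \<otimes>\<^bsub>vg v\<^esub> ?b"
    by (rule co_eqI[OF v]) (use v g h in \<open>simp_all add: vg_simps hv_mult add.assoc\<close>)
  moreover have "psi v (z + hv v g) = psi v z" by (rule psi_cong) (use v g in simp)
  ultimately show "lamL v z (g \<otimes>\<^bsub>vg v\<^esub> h) = lamL v z g \<otimes>\<^bsub>M\<^esub> lamL v (z + hv v g) h"
    using psi_mult[OF v lamL_subv[OF v g] lamL_subv[OF v h]] by (simp add: lamL_def)
next
  fix e c z assume e: "e \<in> E" and c: "c \<in> carrier (eg e)"
  define z2 where "z2 = z + eh e c"
  define k where "k = eht (fe e z)"
  have fe2: "fe e z2 = fe e z" using erel_sym[OF e erel_shift[OF e c, of z]] by (simp add: z2_def fe_eq e)
  \<comment> \<open>The change from \<open>sig e z\<close> to \<open>sig e z2\<close> caused by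
    \<open>c\<close>. Its height is divisible by \<open>N\<close>, so it belongs to the covering
    edge group and may cross the covering edge, whereas \<open>c\<close> itself may not.\<close>
  define c' where "c' = sig e z \<otimes>\<^bsub>eg e\<^esub> c \<otimes>\<^bsub>eg e\<^esub> inv\<^bsub>eg e\<^esub> (sig e z2)"
  have c'c: "c' \<in> carrier (eg e)" using e c by (simp add: c'_def)
  have "N dvd (z2 - eht (fe e z2) - eh e (sig e z2)) - (z - eht (fe e z) - eh e (sig e z))"
    by (intro dvd_diff sig_dvd e)
  then have c'h: "N dvd eh e c'"
    using e c by (simp add: c'_def eh_mult eh_inv z2_def fe2[unfolded z2_def] algebra_simps)
  have c's: "isrc e c' \<in> subv (src e)" "itgt e c' \<in> subv (tgt e)"
    using e c'c c'h by (auto intro!: subvI simp: eh_src eh_def)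
  let ?A = "tau (src e) z \<otimes>\<^bsub>vg (src e)\<^esub> isrc e c \<otimes>\<^bsub>vg (src e)\<^esub> inv\<^bsub>vg (src e)\<^esub> (tau (src e) z2)"
  let ?B = "tau (tgt e) (z + hx e) \<otimes>\<^bsub>vg (tgt e)\<^esub> itgt e c \<otimes>\<^bsub>vg (tgt e)\<^esub> inv\<^bsub>vg (tgt e)\<^esub> (tau (tgt e) (z2 + hx e))"
  \<comment> \<open>Here the vertex groups being abelian matters: \<open>sig e z\<close> must cancel
    across the \<open>tau\<close> that separates it from its inverse.\<close>
  have eqA: "eltS e z \<otimes>\<^bsub>vg (src e)\<^esub> isrc e c' = ?A \<otimes>\<^bsub>vg (src e)\<^esub> eltS e z2"
    unfolding eltS_def c'_def fe2
    by (rule co_eqI[of "src e"]) (use e c in \<open>simp_all add: vg_simps\<close>)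
  have eqB: "eltT e z \<otimes>\<^bsub>vg (tgt e)\<^esub> ?B = itgt e c' \<otimes>\<^bsub>vg (tgt e)\<^esub> eltT e z2"
    unfolding eltT_def c'_def fe2
    by (rule co_eqI[of "tgt e"]) (use e c in \<open>simp_all add: vg_simps\<close>)
  have hs: "hv (src e) (isrc e c) = eh e c" "hv (tgt e) (itgt e c) = eh e c"
    using e c by (simp_all add: eh_src eh_def)
  have sA: "?A \<in> subv (src e)" and sB: "?B \<in> subv (tgt e)"
    using lamL_subv[of "src e" "isrc e c" z] lamL_subv[of "tgt e" "itgt e c" "z + hx e"] e c hs
    by (simp_all add: z2_def algebra_simps)
  have ps2: "psi (src e) z2 = psi (src e) z"
    by (rule psi_cong) (use wv_shift[of "src e" "isrc e c" z] e c hs z2_def in simp)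
  have pt2: "psi (tgt e) (z2 + hx e) = psi (tgt e) (z + hx e)"
    by (rule psi_cong) (use wv_shift[of "tgt e" "itgt e c" "z + hx e"] e c hs in \<open>simp add: z2_def algebra_simps\<close>)
  let ?X = "H.ecls (fe e z, True)" and ?u = "psi (src e) z" and ?v = "psi (tgt e) (z + hx e)"
  have cl: "?X \<in> carrier M" "\<And>h. ?u h \<in> carrier M" "\<And>h. ?v h \<in> carrier M" using e by simp_all
  have "muL e z \<otimes>\<^bsub>M\<^esub> lamL (tgt e) (z + hx e) (itgt e c) = ?u (eltS e z) \<otimes>\<^bsub>M\<^esub> (?X \<otimes>\<^bsub>M\<^esub> (?v (eltT e z) \<otimes>\<^bsub>M\<^esub> ?v ?B))"
    using cl by (simp add: muL_def lamL_def hs z2_def H.FG.m_assoc algebra_simps)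
  also have "?v (eltT e z) \<otimes>\<^bsub>M\<^esub> ?v ?B = ?v (itgt e c') \<otimes>\<^bsub>M\<^esub> ?v (eltT e z2)"
    using psi_mult[OF src_tgt(2)[OF e] eltT_subv[OF e] sB, of "z + hx e" z] 
      psi_mult[OF src_tgt(2)[OF e] c's(2) eltT_subv[OF e], of "z + hx e" z2] eqB by simp
  also have "?u (eltS e z) \<otimes>\<^bsub>M\<^esub> (?X \<otimes>\<^bsub>M\<^esub> (?v (itgt e c') \<otimes>\<^bsub>M\<^esub> ?v (eltT e z2))) =
     ?u (eltS e z) \<otimes>\<^bsub>M\<^esub> ((?X \<otimes>\<^bsub>M\<^esub> ?v (itgt e c')) \<otimes>\<^bsub>M\<^esub> ?v (eltT e z2))"
    using cl by (simp add: H.FG.m_assoc)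
  also have "\<dots> = (?u (eltS e z) \<otimes>\<^bsub>M\<^esub> ?u (isrc e c')) \<otimes>\<^bsub>M\<^esub> (?X \<otimes>\<^bsub>M\<^esub> ?v (eltT e z2))"
    unfolding ecls_psi_comm[OF e c'c c'h] using cl by (simp add: H.FG.m_assoc)
  also have "?u (eltS e z) \<otimes>\<^bsub>M\<^esub> ?u (isrc e c') = ?u ?A \<otimes>\<^bsub>M\<^esub> ?u (eltS e z2)"
    using psi_mult[OF src_tgt(1)[OF e] eltS_subv[OF e] c's(1), of z z]
      psi_mult[OF src_tgt(1)[OF e] sA eltS_subv[OF e], of z z2] eqA by simp
  also have "\<dots> \<otimes>\<^bsub>M\<^esub> (?X \<otimes>\<^bsub>M\<^esub> ?v (eltT e z2)) = lamL (src e) z (isrc e c) \<otimes>\<^bsub>M\<^esub> muL e (z + hv (src e) (isrc e c))"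
    unfolding hs z2_def[symmetric] muL_def lamL_def ps2 pt2 fe2 using cl by (simp add: H.FG.m_assoc)
  finally show "muL e z \<otimes>\<^bsub>M\<^esub> lamL (tgt e) (z + hx e) (itgt e c) =
     lamL (src e) z (isrc e c) \<otimes>\<^bsub>M\<^esub> muL e (z + hv (src e) (isrc e c))" .
qed

end

section \<open>Projecting from the covering\<close>

context cover_gog
begin

abbreviation "K \<equiv> FG"

text \<open>The projection of the covering to \<open>\<G>\<close>; the second argument is the height of a representation
  with heights and plays no role.\<close>

definition lamP :: "nat \<Rightarrow> int \<Rightarrow> int \<times> int \<Rightarrow> ('e, 'a) gog_path set" where
  "lamP w z k = vcls (pv w) (jv (pv w) k)"

text \<open>The ends of a covering edge are recorded by the chosen heights of their orbits, which
  may differ from the heights \<open>eht f\<close> and \<open>eht f + hx (pe f)\<close> at which the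
  edge attaches. The two \<open>tau\<close> factors bridge the gaps.\<close>

definition muP :: "nat \<Rightarrow> int \<Rightarrow> ('e, 'a) gog_path set" where
  "muP f z = vcls (src (pe f)) (tau (src (pe f)) (eht f)) \<otimes>\<^bsub>K\<^esub> (ecls (pe f, True) \<otimes>\<^bsub>K\<^esub>
     inv\<^bsub>K\<^esub> (vcls (tgt (pe f)) (tau (tgt (pe f)) (eht f + hx (pe f)))))"

lemma ecls_closed' [simp]: "e \<in> E \<Longrightarrow> ecls (e, b) \<in> carrier K"
  by (rule ecls_closed) simp

lemma pv_closed [simp]: "w \<in> H.V \<Longrightarrow> pv w \<in> V"
  using vdec_ex[of w] by (simp add: cover_verts)

lemma pe_closed [simp]: "f \<in> H.E \<Longrightarrow> pe f \<in> E"
  using edec_ex[of f] by (simp add: cover_arcs)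

lemma vcls_comm: "v \<in> V \<Longrightarrow> g \<in> carrier (vg v) \<Longrightarrow> h \<in> carrier (vg v) \<Longrightarrow>
    vcls v g \<otimes>\<^bsub>K\<^esub> vcls v h = vcls v h \<otimes>\<^bsub>K\<^esub> vcls v g"
  by (metis vcls_mult vg_comm)

lemma vcls_inv: "v \<in> V \<Longrightarrow> g \<in> carrier (vg v) \<Longrightarrow> vcls v (inv\<^bsub>vg v\<^esub> g) = inv\<^bsub>K\<^esub> (vcls v g)"
  using group_hom.hom_inv[of "vg v" K "vcls v" g] vcls_hom[of v]
  by (simp add: group_hom_def group_hom_axioms_def)

sublocale P0: gog_height cover "\<lambda>_ _. 0" "\<lambda>_. 0"
  by unfold_locales simp_all

lemma P0_hgt [simp]: "P0.hgt u p = 0"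
  by (induction p arbitrary: u) (simp_all add: P0.hxx_def)

sublocale P: based_rep cover w0 "\<lambda>_ _. 0" "\<lambda>_. 0" K lamP muP
proof
  show "P0.hgt w0 (H.base_path v) = 0" for v by simp
next
  fix w g z assume "w \<in> H.V" "g \<in> carrier (H.vg w)"
  then show "lamP w z g \<in> carrier K" by (simp add: lamP_def)
next
  fix f z assume "f \<in> H.E"
  then show "muP f z \<in> carrier K" by (simp add: muP_def)
next
  fix w g h z assume "w \<in> H.V"
  then have v: "pv w \<in> V" by (rule pv_closed)
  show "lamP w z (g \<otimes>\<^bsub>H.vg w\<^esub> h) = lamP w z g \<otimes>\<^bsub>K\<^esub> lamP w (z + 0) h"
    unfolding lamP_def cover_simps jv_mult[OF v] by (rule vcls_mult[OF v jv_closed[OF v] jv_closed[OF v]])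
next
  fix f c z assume f: "f \<in> H.E" "c \<in> carrier (H.eg f)"
  define e where "e = pe f"
  define k where "k = eht f"
  have e: "e \<in> E" using f by (simp add: e_def)
  let ?c = "je e c" and ?X = "ecls (e, True)"
  let ?s = "vcls (src e) (tau (src e) k)" and ?t = "vcls (tgt e) (tau (tgt e) (k + hx e))"
  let ?ic = "vcls (src e) (isrc e ?c)" and ?tc = "vcls (tgt e) (itgt e ?c)"
  have cl: "?X \<in> carrier K" "?s \<in> carrier K" "?t \<in> carrier K" "?ic \<in> carrier K" "?tc \<in> carrier K"
    using e by simp_all
  have r: "?X \<otimes>\<^bsub>K\<^esub> ?tc = ?ic \<otimes>\<^bsub>K\<^esub> ?X"
    using ecls_vcls_comm[of "(e, True)" ?c] e by (simp add: rev_edge_def edge_start_def)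
  have "?t \<otimes>\<^bsub>K\<^esub> ?tc = ?tc \<otimes>\<^bsub>K\<^esub> ?t" by (rule vcls_comm) (use e in simp_all)
  then have t: "inv\<^bsub>K\<^esub> ?t \<otimes>\<^bsub>K\<^esub> ?tc = ?tc \<otimes>\<^bsub>K\<^esub> inv\<^bsub>K\<^esub> ?t"
    using cl by (metis FG.inv_closed FG.inv_solve_left FG.inv_solve_right FG.m_assoc FG.m_closed)
  have s: "?s \<otimes>\<^bsub>K\<^esub> ?ic = ?ic \<otimes>\<^bsub>K\<^esub> ?s" by (rule vcls_comm) (use e in simp_all)
  have "?s \<otimes>\<^bsub>K\<^esub> (?X \<otimes>\<^bsub>K\<^esub> inv\<^bsub>K\<^esub> ?t) \<otimes>\<^bsub>K\<^esub> ?tc = ?s \<otimes>\<^bsub>K\<^esub> (?X \<otimes>\<^bsub>K\<^esub> (inv\<^bsub>K\<^esub> ?t \<otimes>\<^bsub>K\<^esub> ?tc))"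
    using cl by (simp add: FG.m_assoc)
  also have "\<dots> = ?s \<otimes>\<^bsub>K\<^esub> ((?X \<otimes>\<^bsub>K\<^esub> ?tc) \<otimes>\<^bsub>K\<^esub> inv\<^bsub>K\<^esub> ?t)"
    unfolding t using cl by (simp add: FG.m_assoc)
  also have "\<dots> = (?s \<otimes>\<^bsub>K\<^esub> ?ic) \<otimes>\<^bsub>K\<^esub> (?X \<otimes>\<^bsub>K\<^esub> inv\<^bsub>K\<^esub> ?t)"
    unfolding r using cl by (simp add: FG.m_assoc)
  also have "\<dots> = ?ic \<otimes>\<^bsub>K\<^esub> (?s \<otimes>\<^bsub>K\<^esub> (?X \<otimes>\<^bsub>K\<^esub> inv\<^bsub>K\<^esub> ?t))"
    unfolding s using cl by (simp add: FG.m_assoc)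
  finally show "muP f z \<otimes>\<^bsub>K\<^esub> lamP (H.fin (f, True)) (z + 0) (H.incl (f, True) c) =
     lamP (H.fin (f, False)) z (H.incl (f, False) c) \<otimes>\<^bsub>K\<^esub> muP f (z + 0)"
    using e by (simp add: muP_def lamP_def e_def[symmetric] k_def[symmetric])
qed

lemma P0_fhgt [simp]: "P.fhgt A = 0"
  by (simp add: P.fhgt_def)

lemma P_mult: "A \<in> carrier M \<Longrightarrow> B \<in> carrier M \<Longrightarrow> P.frep 0 (A \<otimes>\<^bsub>M\<^esub> B) = P.frep 0 A \<otimes>\<^bsub>K\<^esub> P.frep 0 B"
  by (simp add: P.frep_mult)

lemma P_inv: "A \<in> carrier M \<Longrightarrow> P.frep 0 (inv\<^bsub>M\<^esub> A) = inv\<^bsub>K\<^esub> (P.frep 0 A)"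
  by (rule group_hom.hom_inv[of M K]) (auto simp: group_hom_def group_hom_axioms_def hom_def P_mult)

section \<open>Projecting a lift\<close>

definition base_conj :: "'v \<Rightarrow> int \<Rightarrow> ('e, 'a) gog_path set" where
  "base_conj v z = P.conjr (wv v z) 0"

text \<open>\<open>base_conj\<close> belongs to the orbit of \<open>z\<close> and its chosen height;
  the factor \<open>tau\<close> refines it to \<open>z\<close> itself. This is the conjugator by
  which projecting a lift differs from the identity.\<close>

definition point_conj :: "'v \<Rightarrow> int \<Rightarrow> ('e, 'a) gog_path set" where
  "point_conj v z = base_conj v z \<otimes>\<^bsub>K\<^esub> vcls v (tau v z)"

lemma base_conj_closed [simp]: "v \<in> V \<Longrightarrow> base_conj v z \<in> carrier K"
  by (simp add: base_conj_def)

lemma point_conj_closed [simp]: "v \<in> V \<Longrightarrow> point_conj v z \<in> carrier K"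
  by (simp add: point_conj_def)

lemma P_psi:
  assumes "v \<in> V" "h \<in> subv v"
  shows "P.frep 0 (psi v z h) = base_conj v z \<otimes>\<^bsub>K\<^esub> (vcls v h \<otimes>\<^bsub>K\<^esub> inv\<^bsub>K\<^esub> (base_conj v z))"
  using P.frep_loop_cls[of "wv v z" "Elt (jinv v h)" "wv v z" 0] assms
  by (simp add: psi_def H.vcls_def base_conj_def lamP_def)

lemma P_ecls:
  assumes "e \<in> E"
  shows "P.frep 0 (H.ecls (fe e z, True)) = base_conj (src e) z \<otimes>\<^bsub>K\<^esub> (muP (fe e z) 0 \<otimes>\<^bsub>K\<^esub> inv\<^bsub>K\<^esub> (base_conj (tgt e) (z + hx e)))"
proof -
  let ?x = "(fe e z, True)"
  have x: "fst ?x \<in> H.E" "H.start ?x = wv (src e) z" "H.fin ?x = wv (tgt e) (z + hx e)"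
    using assms by (simp_all add: edge_start_def rev_edge_def)
  have m: "muP (fe e z) 0 \<in> carrier K" using x(1) by (simp only: P.mu_closed fst_conv)
  have "P.rep (H.start ?x) 0 (H.edge_path ?x) = muP (fe e z) 0"
    by (simp only: H.edge_path_def P.rep.simps P.lam_one[OF H.start_in_verts[OF x(1)]]
        P.lam_one[OF H.fin_in_verts[OF x(1)]] P.mux_def fst_conv snd_conv if_True add_0_right FG.l_one FG.r_one m)
  then show ?thesis
    using P.frep_loop_cls[OF H.path_edge_path[OF x(1)], of 0]
    by (simp only: H.ecls_def x base_conj_def P0_hgt add_0)
qed

lemma P_muL:
  assumes e: "e \<in> E"
  shows "P.frep 0 (muL e z) = point_conj (src e) z \<otimes>\<^bsub>K\<^esub> (ecls (e, True) \<otimes>\<^bsub>K\<^esub> inv\<^bsub>K\<^esub> (point_conj (tgt e) (z + hx e)))"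
proof -
  define k where "k = eht (fe e z)"
  let ?a = "base_conj (src e) z" and ?b = "base_conj (tgt e) (z + hx e)" and ?X = "ecls (e, True)"
  let ?s = "vcls (src e) (tau (src e) z)" and ?t = "vcls (tgt e) (tau (tgt e) (z + hx e))"
  let ?sk = "vcls (src e) (tau (src e) k)" and ?tk = "vcls (tgt e) (tau (tgt e) (k + hx e))"
  let ?cs = "vcls (src e) (isrc e (sig e z))" and ?ct = "vcls (tgt e) (itgt e (sig e z))"
  have cl: "?a \<in> carrier K" "?b \<in> carrier K" "?X \<in> carrier K" "?s \<in> carrier K" "?t \<in> carrier K"
     "?sk \<in> carrier K" "?tk \<in> carrier K" "?cs \<in> carrier K" "?ct \<in> carrier K"
    using e by simp_all
  have r: "?X \<otimes>\<^bsub>K\<^esub> ?ct = ?cs \<otimes>\<^bsub>K\<^esub> ?X"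
    using ecls_vcls_comm[of "(e, True)" "sig e z"] e by (simp add: rev_edge_def edge_start_def)
  have S: "vcls (src e) (eltS e z) = ?s \<otimes>\<^bsub>K\<^esub> inv\<^bsub>K\<^esub> ?cs \<otimes>\<^bsub>K\<^esub> inv\<^bsub>K\<^esub> ?sk"
    using e by (simp add: eltS_def vcls_mult vcls_inv k_def)
  have T: "vcls (tgt e) (eltT e z) = ?tk \<otimes>\<^bsub>K\<^esub> ?ct \<otimes>\<^bsub>K\<^esub> inv\<^bsub>K\<^esub> ?t"
    using e by (simp add: eltT_def vcls_mult vcls_inv k_def)
  have X: "muP (fe e z) 0 = ?sk \<otimes>\<^bsub>K\<^esub> (?X \<otimes>\<^bsub>K\<^esub> inv\<^bsub>K\<^esub> ?tk)"
    using e by (simp add: muP_def k_def)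
  note [simp] = FG.m_assoc FG.inv_mult_group
  have canc: "inv\<^bsub>K\<^esub> g \<otimes>\<^bsub>K\<^esub> (g \<otimes>\<^bsub>K\<^esub> h) = h" if "g \<in> carrier K" "h \<in> carrier K" for g h
    using that by (simp add: FG.m_assoc[symmetric] del: FG.m_assoc)
  have "P.frep 0 (muL e z) = ?a \<otimes>\<^bsub>K\<^esub> (vcls (src e) (eltS e z) \<otimes>\<^bsub>K\<^esub> inv\<^bsub>K\<^esub> ?a) \<otimes>\<^bsub>K\<^esub>
     ((?a \<otimes>\<^bsub>K\<^esub> (muP (fe e z) 0 \<otimes>\<^bsub>K\<^esub> inv\<^bsub>K\<^esub> ?b)) \<otimes>\<^bsub>K\<^esub> (?b \<otimes>\<^bsub>K\<^esub> (vcls (tgt e) (eltT e z) \<otimes>\<^bsub>K\<^esub> inv\<^bsub>K\<^esub> ?b)))"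
    using e by (simp only: muL_def P_mult psi_closed H_ecls_closed H.FG.m_closed src_tgt
        P_psi[OF _ eltS_subv] P_psi[OF _ eltT_subv] P_ecls)
  also have "\<dots> = ?a \<otimes>\<^bsub>K\<^esub> (?s \<otimes>\<^bsub>K\<^esub> (inv\<^bsub>K\<^esub> ?cs \<otimes>\<^bsub>K\<^esub> ((?X \<otimes>\<^bsub>K\<^esub> ?ct) \<otimes>\<^bsub>K\<^esub> (inv\<^bsub>K\<^esub> ?t \<otimes>\<^bsub>K\<^esub> inv\<^bsub>K\<^esub> ?b))))"
    unfolding S T X using cl by (simp add: canc)
  \<comment> \<open>Pushing the image of \<open>sig e z\<close> back across the edge brings it next
    to its inverse.\<close>
  also have "\<dots> = ?a \<otimes>\<^bsub>K\<^esub> (?s \<otimes>\<^bsub>K\<^esub> (?X \<otimes>\<^bsub>K\<^esub> (inv\<^bsub>K\<^esub> ?t \<otimes>\<^bsub>K\<^esub> inv\<^bsub>K\<^esub> ?b)))"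
    unfolding r using cl by (simp add: canc)
  also have "\<dots> = point_conj (src e) z \<otimes>\<^bsub>K\<^esub> (ecls (e, True) \<otimes>\<^bsub>K\<^esub> inv\<^bsub>K\<^esub> (point_conj (tgt e) (z + hx e)))"
    unfolding point_conj_def using cl by simp
  finally show ?thesis .
qed

lemma base_conj_shift: "v \<in> V \<Longrightarrow> g \<in> carrier (vg v) \<Longrightarrow> base_conj v (z + hv v g) = base_conj v z"
  by (simp add: base_conj_def)

lemma P_lamL:
  assumes v: "v \<in> V" "g \<in> carrier (vg v)"
  shows "P.frep 0 (lamL v z g) = point_conj v z \<otimes>\<^bsub>K\<^esub> (vcls v g \<otimes>\<^bsub>K\<^esub> inv\<^bsub>K\<^esub> (point_conj v (z + hv v g)))"
  using v by (simp add: lamL_def P_psi[OF v(1) lamL_subv[OF v]] point_conj_def base_conj_shift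
     vcls_mult vcls_inv FG.m_assoc FG.inv_mult_group)

lemma P_muxL:
  assumes "fst x \<in> E"
  shows "P.frep 0 (L.mux x z) = point_conj (start x) z \<otimes>\<^bsub>K\<^esub> (ecls x \<otimes>\<^bsub>K\<^esub> inv\<^bsub>K\<^esub> (point_conj (fin x) (z + hxx x)))"
proof -
  obtain e b where x: "x = (e, b)" by (cases x)
  then have e: "e \<in> E" using assms by simp
  show ?thesis
  proof (cases b)
    case True
    then show ?thesis using P_muL[OF e, of z] by (simp add: x L.mux_def hxx_def edge_start_def rev_edge_def)
  next
    case False
    have r: "ecls (e, False) = inv\<^bsub>K\<^esub> (ecls (e, True))"
      using ecls_rev_inv[of "(e, True)"] e by (simp add: rev_edge_def)
    show ?thesis using P_muL[OF e, of "z - hx e"] False e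
      by (simp add: x L.mux_def hxx_def edge_start_def rev_edge_def P_inv L.mu_closed r FG.inv_mult_group FG.m_assoc)
  qed
qed

text \<open>On each generator the composite is the identity up to \<open>point_conj\<close> at both
  ends; along a path the conjugators at interior vertices cancel because the height reached by one
  piece is the starting height of the next.\<close>

lemma P_L_rep: "path u p v \<Longrightarrow>
  P.frep 0 (L.rep u z p) = point_conj u z \<otimes>\<^bsub>K\<^esub> (loop_cls u v p \<otimes>\<^bsub>K\<^esub> inv\<^bsub>K\<^esub> (point_conj v (z + hgt u p)))"
proof (induction p arbitrary: u z)
  case (Elt g)
  then show ?case using P_lamL[of u g z] by (auto simp: vcls_def)
next
  case (Step g x p)
  have x: "fst x \<in> E" "u \<in> V" "u = start x" "g \<in> carrier (vg u)" "path (fin x) p v" "v \<in> V"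
    using Step.prems path_verts[of "fin x" p v] by auto
  define z1 where "z1 = z + hv u g"
  define z2 where "z2 = z1 + hxx x"
  have canc: "inv\<^bsub>K\<^esub> g \<otimes>\<^bsub>K\<^esub> (g \<otimes>\<^bsub>K\<^esub> h) = h" if "g \<in> carrier K" "h \<in> carrier K" for g h
    using that by (simp add: FG.m_assoc[symmetric])
  have "P.frep 0 (L.rep u z (Step g x p)) = P.frep 0 (lamL u z g) \<otimes>\<^bsub>K\<^esub> (P.frep 0 (L.mux x z1) \<otimes>\<^bsub>K\<^esub> P.frep 0 (L.rep (fin x) z2 p))"
    using x by (simp add: P_mult z1_def z2_def L.rep_closed[OF x(5)])
  also have "\<dots> = point_conj u z \<otimes>\<^bsub>K\<^esub> (vcls u g \<otimes>\<^bsub>K\<^esub> (ecls x \<otimes>\<^bsub>K\<^esub> (loop_cls (fin x) v p \<otimes>\<^bsub>K\<^esub> inv\<^bsub>K\<^esub> (point_conj v (z2 + hgt (fin x) p)))))"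
    unfolding P_lamL[OF x(2,4)] P_muxL[OF x(1)] Step.IH[OF x(5)] x(3)[symmetric] z1_def[symmetric] z2_def[symmetric]
    using x by (simp add: FG.m_assoc canc)
  also have "\<dots> = point_conj u z \<otimes>\<^bsub>K\<^esub> (loop_cls u v (Step g x p) \<otimes>\<^bsub>K\<^esub> inv\<^bsub>K\<^esub> (point_conj v (z + hgt u (Step g x p))))"
    unfolding loop_cls_Step[OF Step.prems] using x by (simp add: FG.m_assoc z1_def z2_def add.assoc)
  finally show ?case .
qed

text \<open>This is why the chosen height of the orbit of the base vertex is 0: heights divisible by
  \<open>N\<close> then have trivial \<open>tau\<close> at \<open>v0\<close>.\<close>

lemma point_conj_base: "N dvd z \<Longrightarrow> point_conj v0 z = \<one>\<^bsub>K\<^esub>"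
  using tau_vht[of v0 0] tau_cong[of v0 z 0] wv_cong[of v0 z 0]
  by (simp add: point_conj_def base_conj_def)

lemma P_L:
  assumes "A \<in> carrier K" "N dvd \<phi> A"
  shows "P.frep 0 (L.frep 0 A) = A"
proof -
  obtain p where p: "path v0 p v0" "A = cls p" using assms(1) by (auto simp: carrier_FG)
  have "hgt v0 p = \<phi> A" using fhgt_eq[OF assms(1)] p by (simp add: fhgt_cls)
  then show ?thesis using P_L_rep[OF p(1), of 0] p assms(2)
    by (simp add: L.frep_cls loop_cls_base point_conj_base)
qed

text \<open>Everything in a lift, that is, covering vertices and edges, \<open>tau\<close> and
  \<open>sig\<close>, depends on heights only modulo \<open>N\<close>.\<close>

lemma L_rep_shift:
  assumes "path u p v"
  shows "L.rep u (z + N) p = L.rep u z p"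
proof -
  have "L.rep u (z + N) p = id (L.rep u z p)"
  proof (rule L.rep_shift[OF _ _ _ assms])
  show "id \<in> hom M M" by (simp add: hom_def)
  have *: "N dvd z + N + k - (z + k)" for z k by simp
  show "lamL v (z + N) g = id (lamL v z g)" if "v \<in> V" "g \<in> carrier (vg v)" for v z g
    using tau_cong[OF that(1) *[of z 0]] tau_cong[OF that(1) *[of z "hv v g"]] psi_cong[OF wv_cong[OF that(1) *[of z 0]]]
    by (simp add: lamL_def)
  show "muL e (z + N) = id (muL e z)" if e: "e \<in> E" for e z
    using tau_cong[OF src_tgt(1)[OF e] *[of z 0]] tau_cong[OF src_tgt(2)[OF e] *[of z "hx e"]]
      psi_cong[OF wv_cong[OF src_tgt(1)[OF e] *[of z 0]]] psi_cong[OF wv_cong[OF src_tgt(2)[OF e] *[of z "hx e"]]]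
      fe_cong[OF e *[of z 0]] sig_cong[OF e *[of z 0]]
    by (simp add: muL_def eltS_def eltT_def)
  qed
  then show ?thesis by simp
qed

lemma L_rep_cong:
  assumes "path u p v" "N dvd z' - z"
  shows "L.rep u z' p = L.rep u z p"
proof -
  have *: "L.rep u (z + N * k) p = L.rep u z p" for z k
  proof (induction k rule: int_induct[of _ 0])
    case (step1 i)
    then show ?case using L_rep_shift[OF assms(1), of "z + N * i"] by (simp add: algebra_simps)
  next
    case (step2 i)
    then show ?case using L_rep_shift[OF assms(1), of "z + N * (i - 1)"] by (simp add: algebra_simps)
  qed simp
  obtain k where "z' - z = N * k" using assms(2) by (auto elim: dvdE)
  then have "z' = z + N * k" by simp
  then show ?thesis using * by simp
qed

lemma L_frep_cong: "A \<in> carrier K \<Longrightarrow> N dvd z' - z \<Longrightarrow> L.frep z' A = L.frep z A"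
  using L_rep_cong[of v0 _ v0 z' z] by (auto simp: carrier_FG L.frep_cls)

lemma L_conjr_cong: "v \<in> V \<Longrightarrow> N dvd z' - z \<Longrightarrow> L.conjr v z' = L.conjr v z"
  using L_rep_cong[OF base_path, of v z' z] by (simp add: L.conjr_def)

end

section \<open>The subgroup of finite index\<close>

context cover_gog
begin

lemma vert_eq: "w \<in> H.V \<Longrightarrow> wv (pv w) (vht w) = w"
  using vdec_ex[of w] unfolding cover_verts by simp

lemma arc_eq: "f \<in> H.E \<Longrightarrow> fe (pe f) (eht f) = f"
  using edec_ex[of f] unfolding cover_arcs by simp

lemma tau_vert: "w \<in> H.V \<Longrightarrow> tau (pv w) (vht w) = \<one>\<^bsub>vg (pv w)\<^esub>"
  using tau_vht[of "pv w" "vht w"] by (simp add: vert_eq)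

lemma psi_one [simp]: "v \<in> V \<Longrightarrow> psi v z \<one>\<^bsub>vg v\<^esub> = \<one>\<^bsub>M\<^esub>"
proof -
  assume v: "v \<in> V"
  then have o: "\<one>\<^bsub>vg v\<^esub> \<in> subv v" by (intro subvI) simp_all
  have "psi v z \<one>\<^bsub>vg v\<^esub> \<otimes>\<^bsub>M\<^esub> psi v z \<one>\<^bsub>vg v\<^esub> = psi v z \<one>\<^bsub>vg v\<^esub>"
    using psi_mult[OF v o o, of z] v by (simp add: monoid.l_one)
  then show "psi v z \<one>\<^bsub>vg v\<^esub> = \<one>\<^bsub>M\<^esub>" using v by (metis H.FG.r_cancel_one' psi_closed)
qed

section \<open>Lifting a projection\<close>

lemma L_vcls:
  assumes "v \<in> V" "g \<in> carrier (vg v)"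
  shows "L.frep z (vcls v g) = L.conjr v z \<otimes>\<^bsub>M\<^esub> (lamL v z g \<otimes>\<^bsub>M\<^esub> inv\<^bsub>M\<^esub> (L.conjr v (z + hv v g)))"
  using L.frep_loop_cls[OF path_Elt[OF assms], of z] by (simp add: vcls_def)

lemma L_ecls:
  assumes "e \<in> E"
  shows "L.frep z (ecls (e, True)) = L.conjr (src e) z \<otimes>\<^bsub>M\<^esub> (muL e z \<otimes>\<^bsub>M\<^esub> inv\<^bsub>M\<^esub> (L.conjr (tgt e) (z + hx e)))"
proof -
  let ?x = "(e, True)"
  have x: "fst ?x \<in> E" "start ?x = src e" "hxx ?x = hx e"
    using assms by (simp_all add: edge_start_def rev_edge_def hxx_def)
  have m: "muL e z \<in> carrier M" using assms by (rule L.mu_closed)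
  have "L.rep (start ?x) z (edge_path ?x) = muL e z"
    by (simp only: edge_path_def L.rep.simps L.lam_one[OF start_in_verts[OF x(1)]] hv_one[OF start_in_verts[OF x(1)]]
        L.lam_one[OF fin_in_verts[OF x(1)]] L.mux_def fst_conv snd_conv if_True add_0_right H.FG.l_one H.FG.r_one m)
  moreover have "hgt (start ?x) (edge_path ?x) = hx e"
    by (simp only: edge_path_def hgt.simps hv_one[OF start_in_verts[OF x(1)]] hv_one[OF fin_in_verts[OF x(1)]] x(3) add_0_right add_0_left)
  ultimately show ?thesis
    using L.frep_loop_cls[OF path_edge_path[OF x(1)], of z] by (simp only: ecls_def x(2))
qed

lemma \<phi>_vcls: "\<phi> (vcls v g) = hv v g" by (simp add: hv_def)

definition Lconj :: "nat \<Rightarrow> (nat, int \<times> int) gog_path set" where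
  "Lconj w = L.conjr (pv w) (vht w)"

lemma Lconj_closed [simp]: "w \<in> H.V \<Longrightarrow> Lconj w \<in> carrier M"
  by (simp add: Lconj_def)

text \<open>At the chosen height \<open>tau\<close> is trivial, and elements of \<open>subv\<close>
  change the height only by multiples of \<open>N\<close>, so start and end share one
  conjugator.\<close>

lemma L_lamP:
  assumes w: "w \<in> H.V"
  shows "L.frep (vht w) (lamP w 0 k) = Lconj w \<otimes>\<^bsub>M\<^esub> (H.vcls w k \<otimes>\<^bsub>M\<^esub> inv\<^bsub>M\<^esub> (Lconj w))"
    and "N dvd \<phi> (lamP w 0 k)"
proof -
  let ?v = "pv w" and ?g = "jv (pv w) k"
  have v: "?v \<in> V" using w by simp
  have d: "N dvd hv ?v ?g" using subvD[OF jv_subv[OF v]] .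
  then show "N dvd \<phi> (lamP w 0 k)" by (simp add: lamP_def \<phi>_vcls)
  from d have d': "N dvd vht w + hv ?v ?g - vht w" by simp
  have "tau ?v (vht w + hv ?v ?g) = \<one>\<^bsub>vg ?v\<^esub>" using tau_cong[OF v d'] tau_vert[OF w] by simp
  then have "lamL ?v (vht w) ?g = psi ?v (vht w) ?g"
    using v tau_vert[OF w] by (simp add: lamL_def monoid.l_one monoid.r_one group.is_monoid monoid.inv_one)
  also have "\<dots> = H.vcls w k" using v w by (simp add: psi_def vert_eq)
  finally show "L.frep (vht w) (lamP w 0 k) = Lconj w \<otimes>\<^bsub>M\<^esub> (H.vcls w k \<otimes>\<^bsub>M\<^esub> inv\<^bsub>M\<^esub> (Lconj w))"
    using L_conjr_cong[OF v d'] v by (simp add: lamP_def L_vcls Lconj_def)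
qed

text \<open>Started at the chosen height of \<open>w\<close>, the first \<open>tau\<close> in
  \<open>muP\<close> lifts trivially and reaches \<open>eht f\<close>. There \<open>sig\<close> is
  trivial, so the edge lifts to \<open>f\<close> alone, and the inverse of the second
  \<open>tau\<close> lifts trivially on the way to the chosen height of \<open>w'\<close>.\<close>

lemma L_muP:
  assumes f: "f \<in> H.E" and w: "w = H.fin (f, False)" "w' = H.fin (f, True)"
  shows "L.frep (vht w) (muP f 0) = Lconj w \<otimes>\<^bsub>M\<^esub> (H.ecls (f, True) \<otimes>\<^bsub>M\<^esub> inv\<^bsub>M\<^esub> (Lconj w'))"
    and "N dvd \<phi> (muP f 0) - (vht w' - vht w)"
proof -
  define e where "e = pe f"
  define k where "k = eht f"
  have e: "e \<in> E" using f by (simp add: e_def)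
  have fe: "fe e k = f" using arc_eq[OF f] by (simp add: e_def k_def)
  have wu: "w = wv (src e) k" and wt: "w' = wv (tgt e) (k + hx e)"
    using w by (simp_all add: e_def k_def)
  have wV: "w \<in> H.V" "w' \<in> H.V" and pw: "pv w = src e" "pv w' = tgt e"
    using e by (simp_all add: wu wt)
  let ?u = "src e" and ?v = "tgt e"
  let ?s = "tau ?u k" and ?t = "tau ?v (k + hx e)"
  have ds: "N dvd vht w + hv ?u ?s - k"
  proof -
    have "N dvd - (k - vht w - hv ?u ?s)" using tau_dvd[of ?u k] e by (simp only: dvd_minus_iff wu src_tgt)
    then show ?thesis by (simp add: algebra_simps)
  qed
  have dt: "N dvd k + hx e - hv ?v ?t - vht w'"
    using tau_dvd[of ?v "k + hx e"] e by (simp add: wt algebra_simps)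
  have cl: "?s \<in> carrier (vg ?u)" "?t \<in> carrier (vg ?v)" "inv\<^bsub>vg ?v\<^esub> ?t \<in> carrier (vg ?v)" using e by simp_all
  have mu: "muP f 0 = vcls ?u ?s \<otimes>\<^bsub>K\<^esub> (ecls (e, True) \<otimes>\<^bsub>K\<^esub> vcls ?v (inv\<^bsub>vg ?v\<^esub> ?t))"
    using e by (simp add: muP_def e_def[symmetric] k_def[symmetric] vcls_inv)
  have \<phi>mu: "\<phi> (muP f 0) = hv ?u ?s + (hx e - hv ?v ?t)"
    unfolding mu using e cl by (simp add: \<phi>_mult \<phi>_vcls hx_def hv_inv)
  have "N dvd (vht w + hv ?u ?s - k) + (k + hx e - hv ?v ?t - vht w')" by (intro dvd_add ds dt)
  then show "N dvd \<phi> (muP f 0) - (vht w' - vht w)" by (simp add: \<phi>mu algebra_simps)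
  have tu: "tau ?u (vht w) = \<one>\<^bsub>vg ?u\<^esub>" and tv: "tau ?v (vht w') = \<one>\<^bsub>vg ?v\<^esub>"
    using tau_vert[OF wV(1)] tau_vert[OF wV(2)] pw by simp_all
  have C: "Lconj w = L.conjr ?u (vht w)" "Lconj w' = L.conjr ?v (vht w')"
    by (simp_all add: Lconj_def pw)
  have "lamL ?u (vht w) ?s = \<one>\<^bsub>M\<^esub>"
    using e tau_cong[OF src_tgt(1)[OF e] ds] by (simp add: lamL_def tu monoid.l_one group.r_inv)
  then have 1: "L.frep (vht w) (vcls ?u ?s) = Lconj w \<otimes>\<^bsub>M\<^esub> inv\<^bsub>M\<^esub> (L.conjr ?u k)"
    using e cl L_conjr_cong[OF src_tgt(1)[OF e] ds] by (simp add: L_vcls C)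
  have ek: "eht (fe e k) = k" unfolding fe by (rule k_def[symmetric])
  have "sig e k = \<one>\<^bsub>eg e\<^esub>" using sig_eht[OF e, of k] unfolding ek .
  moreover have "incl (e, b) \<one>\<^bsub>eg e\<^esub> = \<one>\<^bsub>vg (fin (e, b))\<^esub>" for b using incl_one[of "(e, b)"] e by simp
  ultimately have "eltS e k = \<one>\<^bsub>vg ?u\<^esub>" "eltT e k = \<one>\<^bsub>vg ?v\<^esub>"
    using e by (simp_all add: eltS_def eltT_def ek monoid.r_one monoid.inv_one group.r_inv)
  then have "muL e k = H.ecls (f, True)"
    using e H_ecls_closed[OF e, of k True] by (simp add: muL_def fe)
  then have 2: "L.frep k (ecls (e, True)) = L.conjr ?u k \<otimes>\<^bsub>M\<^esub> (H.ecls (f, True) \<otimes>\<^bsub>M\<^esub> inv\<^bsub>M\<^esub> (L.conjr ?v (k + hx e)))"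
    by (simp add: L_ecls[OF e])
  have ht: "hv ?v (inv\<^bsub>vg ?v\<^esub> ?t) = - hv ?v ?t" using e cl by (simp add: hv_inv)
  have "tau ?v (k + hx e - hv ?v ?t) = \<one>\<^bsub>vg ?v\<^esub>" using tau_cong[OF src_tgt(2)[OF e] dt] tv by simp
  then have "lamL ?v (k + hx e) (inv\<^bsub>vg ?v\<^esub> ?t) = \<one>\<^bsub>M\<^esub>"
    using e cl by (simp add: lamL_def ht group.r_inv monoid.inv_one monoid.r_one)
  then have 3: "L.frep (k + hx e) (vcls ?v (inv\<^bsub>vg ?v\<^esub> ?t)) = L.conjr ?v (k + hx e) \<otimes>\<^bsub>M\<^esub> inv\<^bsub>M\<^esub> (Lconj w')"
    using e cl L_conjr_cong[OF src_tgt(2)[OF e] dt] by (simp add: L_vcls C ht)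
  let ?X = "H.ecls (f, True)"
  have X: "?X \<in> carrier M" using H_ecls_closed[OF e, of k True] by (simp add: fe)
  have cc: "L.conjr ?u k \<in> carrier M" "L.conjr ?v (k + hx e) \<in> carrier M" "Lconj w \<in> carrier M" "Lconj w' \<in> carrier M"
    using e wV by simp_all
  have canc: "inv\<^bsub>M\<^esub> g \<otimes>\<^bsub>M\<^esub> (g \<otimes>\<^bsub>M\<^esub> h) = h" if "g \<in> carrier M" "h \<in> carrier M" for g h
    using that by (simp add: H.FG.m_assoc[symmetric])
  have gK: "vcls ?u ?s \<in> carrier K" "ecls (e, True) \<in> carrier K" "vcls ?v (inv\<^bsub>vg ?v\<^esub> ?t) \<in> carrier K"
    using e cl by simp_all
  have "L.frep (vht w) (muP f 0) = L.frep (vht w) (vcls ?u ?s) \<otimes>\<^bsub>M\<^esub>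
     (L.frep (vht w + hv ?u ?s) (ecls (e, True)) \<otimes>\<^bsub>M\<^esub> L.frep (vht w + hv ?u ?s + hx e) (vcls ?v (inv\<^bsub>vg ?v\<^esub> ?t)))"
    unfolding mu using gK by (simp add: L.frep_mult fhgt_eq \<phi>_vcls hx_def)
  also have "\<dots> = L.frep (vht w) (vcls ?u ?s) \<otimes>\<^bsub>M\<^esub> (L.frep k (ecls (e, True)) \<otimes>\<^bsub>M\<^esub> L.frep (k + hx e) (vcls ?v (inv\<^bsub>vg ?v\<^esub> ?t)))"
    using L_frep_cong[OF gK(2) ds] L_frep_cong[OF gK(3), of "vht w + hv ?u ?s + hx e" "k + hx e"] ds by simp
  also have "\<dots> = Lconj w \<otimes>\<^bsub>M\<^esub> (?X \<otimes>\<^bsub>M\<^esub> inv\<^bsub>M\<^esub> (Lconj w'))"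
    unfolding 1 2 3 using X cc by (simp add: H.FG.m_assoc canc)
  finally show "L.frep (vht w) (muP f 0) = Lconj w \<otimes>\<^bsub>M\<^esub> (?X \<otimes>\<^bsub>M\<^esub> inv\<^bsub>M\<^esub> (Lconj w'))" .
qed

text \<open>Crossed multiplicativity applied to \<open>A\<close> and its inverse, the latter being
  lifted from the height at which \<open>A\<close> ends.\<close>

lemma L_inv_cong:
  assumes "A \<in> carrier K" "N dvd z + \<phi> A - z'"
  shows "L.frep z' (inv\<^bsub>K\<^esub> A) = inv\<^bsub>M\<^esub> (L.frep z A)"
proof -
  have "L.frep z (A \<otimes>\<^bsub>K\<^esub> inv\<^bsub>K\<^esub> A) = L.frep z A \<otimes>\<^bsub>M\<^esub> L.frep (z + \<phi> A) (inv\<^bsub>K\<^esub> A)"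
    using assms(1) by (simp only: L.frep_mult FG.inv_closed fhgt_eq)
  moreover have "L.frep (z + \<phi> A) (inv\<^bsub>K\<^esub> A) = L.frep z' (inv\<^bsub>K\<^esub> A)"
    using assms by (intro L_frep_cong) simp_all
  moreover have "L.frep z \<one>\<^bsub>K\<^esub> = \<one>\<^bsub>M\<^esub>"
    using L.lam_one[OF base_vert, of z] by (simp add: one_FG L.frep_cls)
  ultimately have "L.frep z A \<otimes>\<^bsub>M\<^esub> L.frep z' (inv\<^bsub>K\<^esub> A) = \<one>\<^bsub>M\<^esub>" using assms(1) by simp
  then show ?thesis using assms(1) by (metis FG.inv_closed H.FG.inv_equality H.FG.inv_inv L.frep_closed)
qed

lemma L_muxP:
  assumes x: "fst x \<in> H.E"
  shows "L.frep (vht (H.start x)) (P.mux x 0) = Lconj (H.start x) \<otimes>\<^bsub>M\<^esub> (H.ecls x \<otimes>\<^bsub>M\<^esub> inv\<^bsub>M\<^esub> (Lconj (H.fin x)))"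
    and "N dvd \<phi> (P.mux x 0) - (vht (H.fin x) - vht (H.start x))"
proof -
  obtain f b where xf: "x = (f, b)" by (cases x)
  have f: "f \<in> H.E" using x xf by simp
  note mu = L_muP[OF f refl refl]
  have st: "H.start (f, True) = H.fin (f, False)" "H.start (f, False) = H.fin (f, True)"
    by (simp_all only: edge_start_def rev_edge_def fst_conv snd_conv not_True_eq_False not_False_eq_True)
  have m: "muP f 0 \<in> carrier K" using f by (rule P.mu_closed)
  have T: "P.mux (f, True) 0 = muP f 0" and F: "P.mux (f, False) 0 = inv\<^bsub>K\<^esub> (muP f 0)"
    by (simp_all add: P.mux_def)
  have wV: "H.fin (f, False) \<in> H.V" "H.fin (f, True) \<in> H.V"
    using H.fin_in_verts[of "(f, False)"] H.fin_in_verts[of "(f, True)"] f by (simp_all only: fst_conv)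
  have X: "H.ecls (f, True) \<in> carrier M" using H.ecls_closed[of "(f, True)"] f by (simp only: fst_conv)
  have r: "H.ecls (f, False) = inv\<^bsub>M\<^esub> (H.ecls (f, True))"
    using H.ecls_rev_inv[of "(f, True)"] f by (simp add: rev_edge_def)
  have "L.frep (vht (H.fin (f, True))) (inv\<^bsub>K\<^esub> (muP f 0)) = inv\<^bsub>M\<^esub> (L.frep (vht (H.fin (f, False))) (muP f 0))"
    by (rule L_inv_cong[OF m]) (use mu(2) in \<open>simp only: algebra_simps\<close>)
  then have i: "L.frep (vht (H.fin (f, True))) (inv\<^bsub>K\<^esub> (muP f 0)) =
      Lconj (H.fin (f, True)) \<otimes>\<^bsub>M\<^esub> (H.ecls (f, False) \<otimes>\<^bsub>M\<^esub> inv\<^bsub>M\<^esub> (Lconj (H.fin (f, False))))"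
    unfolding mu(1) r using X Lconj_closed[OF wV(1)] Lconj_closed[OF wV(2)]
    by (simp only: H.FG.inv_mult_group H.FG.inv_inv H.FG.m_assoc H.FG.inv_closed H.FG.m_closed)
  have \<phi>i: "\<phi> (inv\<^bsub>K\<^esub> (muP f 0)) = - \<phi> (muP f 0)"
    using \<phi>_mult[of "muP f 0" "inv\<^bsub>K\<^esub> (muP f 0)"] m by simp
  have "N dvd - (\<phi> (muP f 0) - (vht (H.fin (f, True)) - vht (H.fin (f, False))))"
    using mu(2) by (simp only: dvd_minus_iff)
  moreover have "- (\<phi> (muP f 0) - (vht (H.fin (f, True)) - vht (H.fin (f, False)))) =
     \<phi> (inv\<^bsub>K\<^esub> (muP f 0)) - (vht (H.fin (f, False)) - vht (H.fin (f, True)))"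
    unfolding \<phi>i by (simp only: algebra_simps)
  ultimately have d: "N dvd \<phi> (inv\<^bsub>K\<^esub> (muP f 0)) - (vht (H.fin (f, False)) - vht (H.fin (f, True)))"
    by (simp only:)
  show "L.frep (vht (H.start x)) (P.mux x 0) = Lconj (H.start x) \<otimes>\<^bsub>M\<^esub> (H.ecls x \<otimes>\<^bsub>M\<^esub> inv\<^bsub>M\<^esub> (Lconj (H.fin x)))"
    "N dvd \<phi> (P.mux x 0) - (vht (H.fin x) - vht (H.start x))"
    unfolding xf by (cases b; simp only: st T F mu i d)+
qed

text \<open>The height congruence is carried through the induction because it says at which height
  modulo \<open>N\<close> the rest of the path is lifted.\<close>

lemma L_P_rep: "H.path w q w' \<Longrightarrow>
   L.frep (vht w) (P.rep w 0 q) = Lconj w \<otimes>\<^bsub>M\<^esub> (H.loop_cls w w' q \<otimes>\<^bsub>M\<^esub> inv\<^bsub>M\<^esub> (Lconj w')) \<and>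
   N dvd \<phi> (P.rep w 0 q) - (vht w' - vht w)"
proof (induction q arbitrary: w)
  case (Elt k)
  then have w: "w \<in> H.V" "w' = w" by auto
  then show ?case using L_lamP[OF w(1), of k] by (simp add: H.vcls_def)
next
  case (Step g x q)
  have x: "fst x \<in> H.E" "w = H.start x" "H.path (H.fin x) q w'"
    using Step.prems by auto
  have V: "w \<in> H.V" "H.fin x \<in> H.V" "w' \<in> H.V" using H.path_verts[OF Step.prems] H.path_verts[OF x(3)] by auto
  let ?a = "lamP w 0 g" and ?b = "P.mux x 0" and ?c = "P.rep (H.fin x) 0 q"
  have cl: "?a \<in> carrier K" "?b \<in> carrier K" "?c \<in> carrier K"
    using P.lam_closed[OF V(1)] P.mux_closed[OF x(1)] P.rep_closed[OF x(3)] by simp_all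
  have IH: "L.frep (vht (H.fin x)) ?c = Lconj (H.fin x) \<otimes>\<^bsub>M\<^esub> (H.loop_cls (H.fin x) w' q \<otimes>\<^bsub>M\<^esub> inv\<^bsub>M\<^esub> (Lconj w'))"
    "N dvd \<phi> ?c - (vht w' - vht (H.fin x))"
    using Step.IH[OF x(3)] by auto
  have r: "P.rep w 0 (Step g x q) = ?a \<otimes>\<^bsub>K\<^esub> (?b \<otimes>\<^bsub>K\<^esub> ?c)"
    by (simp add: P0.hxx_def)
  have \<phi>: "\<phi> (P.rep w 0 (Step g x q)) = \<phi> ?a + (\<phi> ?b + \<phi> ?c)"
    unfolding r using cl by (simp add: \<phi>_mult)
  note la = L_lamP[OF V(1), of g] and lb = L_muxP[OF x(1), folded x(2)]
  have "N dvd \<phi> ?a + ((\<phi> ?b - (vht (H.fin x) - vht w)) + (\<phi> ?c - (vht w' - vht (H.fin x))))"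
    by (intro dvd_add la lb IH)
  then have d: "N dvd \<phi> (P.rep w 0 (Step g x q)) - (vht w' - vht w)" unfolding \<phi> by (simp add: algebra_simps)
  have d1: "N dvd vht w + \<phi> ?a - vht w" using la(2) by simp
  have "N dvd (\<phi> ?b - (vht (H.fin x) - vht w)) + \<phi> ?a" by (intro dvd_add la lb)
  then have d2: "N dvd vht w + \<phi> ?a + \<phi> ?b - vht (H.fin x)" by (simp add: algebra_simps)
  have canc: "inv\<^bsub>M\<^esub> g \<otimes>\<^bsub>M\<^esub> (g \<otimes>\<^bsub>M\<^esub> h) = h" if "g \<in> carrier M" "h \<in> carrier M" for g h
    using that by (simp add: H.FG.m_assoc[symmetric])
  have "L.frep (vht w) (P.rep w 0 (Step g x q)) =
     L.frep (vht w) ?a \<otimes>\<^bsub>M\<^esub> (L.frep (vht w + \<phi> ?a) ?b \<otimes>\<^bsub>M\<^esub> L.frep (vht w + \<phi> ?a + \<phi> ?b) ?c)"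
    unfolding r using cl by (simp only: L.frep_mult fhgt_eq FG.m_closed)
  also have "\<dots> = L.frep (vht w) ?a \<otimes>\<^bsub>M\<^esub> (L.frep (vht w) ?b \<otimes>\<^bsub>M\<^esub> L.frep (vht (H.fin x)) ?c)"
    by (simp only: L_frep_cong[OF cl(2) d1] L_frep_cong[OF cl(3) d2])
  also have "\<dots> = Lconj w \<otimes>\<^bsub>M\<^esub> ((H.vcls w g \<otimes>\<^bsub>M\<^esub> (H.ecls x \<otimes>\<^bsub>M\<^esub> H.loop_cls (H.fin x) w' q)) \<otimes>\<^bsub>M\<^esub> inv\<^bsub>M\<^esub> (Lconj w'))"
    unfolding la(1) lb(1) IH(1)
    using Lconj_closed[OF V(1)] Lconj_closed[OF V(2)] Lconj_closed[OF V(3)] H.ecls_closed[OF x(1)]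
      H.loop_cls_closed[OF x(3)] H.vcls_closed[OF V(1), of g]
    by (simp add: H.FG.m_assoc canc)
  also have "\<dots> = Lconj w \<otimes>\<^bsub>M\<^esub> (H.loop_cls w w' (Step g x q) \<otimes>\<^bsub>M\<^esub> inv\<^bsub>M\<^esub> (Lconj w'))"
    by (simp only: H.loop_cls_Step[OF Step.prems])
  finally show ?case using d by blast
qed

lemma Lconj_base: "Lconj w0 = \<one>\<^bsub>M\<^esub>"
  by (simp add: Lconj_def)

lemma L_P:
  assumes "B \<in> carrier M"
  shows "L.frep 0 (P.frep 0 B) = B" "N dvd \<phi> (P.frep 0 B)"
proof -
  obtain q where q: "H.path w0 q w0" "B = H.cls q" using assms by (auto simp: H.carrier_FG)
  have "P.frep 0 B = P.rep w0 0 q" by (simp add: q P.frep_cls)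
  then show "L.frep 0 (P.frep 0 B) = B" "N dvd \<phi> (P.frep 0 B)"
    using L_P_rep[OF q(1)] assms by (simp_all add: Lconj_base H.loop_cls_base[OF q(1)] q(2)[symmetric])
qed

definition Hsub :: "('e, 'a) gog_path set set" where
  "Hsub = {A \<in> carrier K. N dvd \<phi> A}"

lemma \<phi>_inv: "A \<in> carrier K \<Longrightarrow> \<phi> (inv\<^bsub>K\<^esub> A) = - \<phi> A"
  using \<phi>_mult[of A "inv\<^bsub>K\<^esub> A"] by simp

lemma subgroup_Hsub: "subgroup Hsub K"
  by (rule FG.subgroupI) (auto simp: Hsub_def \<phi>_mult \<phi>_inv intro!: exI[of _ "\<one>\<^bsub>K\<^esub>"])

text \<open>A right coset is determined by the residue of \<open>\<phi>\<close> modulo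
  \<open>N\<close>.\<close>

lemma finite_rcosets_Hsub: "finite (rcosets\<^bsub>K\<^esub> Hsub)"
proof -
  have "Hsub #>\<^bsub>K\<^esub> A = {B \<in> carrier K. \<phi> B mod N = \<phi> A mod N}" if A: "A \<in> carrier K" for A
  proof
    show "Hsub #>\<^bsub>K\<^esub> A \<subseteq> {B \<in> carrier K. \<phi> B mod N = \<phi> A mod N}"
      using A by (auto simp: r_coset_def Hsub_def \<phi>_mult mod_eq_dvd_iff)
    show "{B \<in> carrier K. \<phi> B mod N = \<phi> A mod N} \<subseteq> Hsub #>\<^bsub>K\<^esub> A"
    proof
      fix B assume B: "B \<in> {B \<in> carrier K. \<phi> B mod N = \<phi> A mod N}"
      then have "B \<otimes>\<^bsub>K\<^esub> inv\<^bsub>K\<^esub> A \<in> Hsub" using A by (simp add: Hsub_def \<phi>_mult \<phi>_inv mod_eq_dvd_iff)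
      moreover have "B = (B \<otimes>\<^bsub>K\<^esub> inv\<^bsub>K\<^esub> A) \<otimes>\<^bsub>K\<^esub> A" using A B by (simp add: FG.m_assoc)
      ultimately show "B \<in> Hsub #>\<^bsub>K\<^esub> A" unfolding r_coset_def by blast
    qed
  qed
  then have "rcosets\<^bsub>K\<^esub> Hsub \<subseteq> (\<lambda>r. {B \<in> carrier K. \<phi> B mod N = r}) ` {0..<N}"
    using N_pos by (auto simp: RCOSETS_def)
  then show ?thesis by (rule finite_subset) simp
qed

text \<open>On \<open>Hsub\<close> the height twist in \<open>L.frep_mult\<close> is a multiple of
  \<open>N\<close> and disappears, so the lift is a genuine homomorphism, with the projection as its
  inverse.\<close>

lemma Hsub_iso: "K\<lparr>carrier := Hsub\<rparr> \<cong> M"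
proof -
  have hom: "L.frep 0 \<in> hom (K\<lparr>carrier := Hsub\<rparr>) M"
  proof (rule homI)
    fix A B assume "A \<in> carrier (K\<lparr>carrier := Hsub\<rparr>)" "B \<in> carrier (K\<lparr>carrier := Hsub\<rparr>)"
    then have AB: "A \<in> carrier K" "N dvd \<phi> A" "B \<in> carrier K" by (simp_all add: Hsub_def)
    then show "L.frep 0 (A \<otimes>\<^bsub>K\<lparr>carrier := Hsub\<rparr>\<^esub> B) = L.frep 0 A \<otimes>\<^bsub>M\<^esub> L.frep 0 B"
      using L_frep_cong[OF AB(3), of "\<phi> A" 0] by (simp add: L.frep_mult fhgt_eq)
  qed (simp add: Hsub_def)
  have "bij_betw (L.frep 0) Hsub (carrier M)"
    by (rule bij_betw_byWitness[of _ "P.frep 0"]) (auto simp: Hsub_def P_L L_P)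
  with hom show ?thesis by (auto simp: is_iso_def iso_def)
qed

theorem finite_index_maximal:
  "\<exists>H. subgroup H K \<and> finite (rcosets\<^bsub>K\<^esub> H) \<and>
     (\<exists>(\<H> :: (nat, nat, int \<times> int, int) gog) w0. finite_connected_Z2_Z_gog \<H> \<and> w0 \<in> verts (gog_graph \<H>) \<and>
        K\<lparr>carrier := H\<rparr> \<cong> fundamental_group \<H> w0 \<and> all_inclusions_maximal \<H>)"
  using subgroup_Hsub finite_rcosets_Hsub finite_connected_cover H.base_vert Hsub_iso cover_maximal by blast

end

theorem proposition3p1:
  fixes \<G> :: "('v, 'e, 'a, 'b) gog" and v0 :: 'v
  assumes "finite_connected_Z2_Z_gog \<G>"
    and "v0 \<in> verts (gog_graph \<G>)"
    and "free_by_Z (fundamental_group \<G> v0)"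
  shows "\<exists>H. subgroup H (fundamental_group \<G> v0) \<and>
           finite (rcosets\<^bsub>fundamental_group \<G> v0\<^esub> H) \<and>
           (\<exists>(\<H> :: (nat, nat, int \<times> int, int) gog) w0.
              finite_connected_Z2_Z_gog \<H> \<and> w0 \<in> verts (gog_graph \<H>) \<and>
              (fundamental_group \<G> v0)\<lparr>carrier := H\<rparr> \<cong> fundamental_group \<H> w0 \<and>
              all_inclusions_maximal \<H>)"
proof -
  have \<G>: "graph_of_groups \<G>" "fin_digraph (gog_graph \<G>)" "connected (gog_graph \<G>)"
    "\<And>v. v \<in> verts (gog_graph \<G>) \<Longrightarrow> vertex_group \<G> v \<cong> integer_group \<times>\<times> integer_group"
    "\<And>e. e \<in> arcs (gog_graph \<G>) \<Longrightarrow> edge_group \<G> e \<cong> integer_group"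
    using assms(1) by (auto simp: finite_connected_Z2_Z_gog_def)
  interpret graph_of_groups \<G> by (rule \<G>(1))
  interpret based_gog \<G> v0
    by unfold_locales (use assms(2) connected_imp_path[OF \<G>(3)] in auto)
  show ?thesis
  proof (rule free_by_Z_derivations[OF FG.group_axioms assms(3)])
    fix \<phi> :: "('e, 'a) gog_path set \<Rightarrow> int" and s
    assume \<phi>: "\<And>x y. x \<in> carrier FG \<Longrightarrow> y \<in> carrier FG \<Longrightarrow> \<phi> (x \<otimes>\<^bsub>FG\<^esub> y) = \<phi> x + \<phi> y"
      and s: "s \<in> carrier FG" "\<phi> s = 1"
      and der: "\<And>(d :: _ \<Rightarrow> rat) x. \<lbrakk>\<And>x y. x \<in> carrier FG \<Longrightarrow> y \<in> carrier FG \<Longrightarrow>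
          d (x \<otimes>\<^bsub>FG\<^esub> y) = d x + 2 powi \<phi> x * d y; d s = 0; x \<in> carrier FG\<rbrakk> \<Longrightarrow> d x = 0"
    have fins: "finite V" "finite E"
      using \<G>(2) by (simp_all add: fin_digraph.finite_verts fin_digraph.finite_arcs)
    interpret Z2_gog \<G> v0 \<phi>
      by unfold_locales (rule \<phi> fins \<G>(4,5); assumption)+
    let ?h = "\<lambda>e. hv (fin (e, True)) (incl (e, True) (ie e 1))"
    have h: "?h e \<noteq> 0" if "e \<in> E" for e
      by (rule edge_height_nonzero[OF s _ that]) (rule der)
    \<comment> \<open>A common multiple of all edge heights; it is positive because each factor is
      nonzero by \<open>h\<close>.\<close>
    define N where "N = (\<Prod>e\<in>E. \<bar>?h e\<bar>)"
    have "cover_gog \<G> v0 \<phi> N"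
    proof
      show "N > 0" using h by (auto simp: N_def intro!: prod_pos)
      show "?h e dvd N" if "e \<in> E" for e
        using dvd_prod_eqI[OF fins(2) that refl, of "\<lambda>e. \<bar>?h e\<bar>"] by (simp add: N_def)
      show "\<exists>s\<in>carrier FG. \<phi> s = 1" using s by blast
    qed
    then show ?thesis by (rule cover_gog.finite_index_maximal)
  qed
qed

end
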